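(* Let $p>3$ be a prime. Then $$\sum_{k=0}^{(p-1)/2}\frac{k^2\binom{2k}k^3}{(-8)^k}\equiv\begin{cases}\frac{10}{27}x^2-\frac49p\pmod{p^2}&\text{if } p\equiv1\pmod 4\text{ and } p=x^2+4y^2 \text{ with } x,y\in\mathbb Z,\\ \frac7{27}p+\frac1{18}R_1(p)\pmod{p^2}&\text{if } p\equiv 3\pmod 4,\end{cases}$$ $$\sum_{k=0}^{(p-1)/2}\frac{k^3\binom{2k}k^3}{(-8)^k}\equiv\begin{cases}-\frac4{81}x^2+\frac4{27}p\pmod{p^2}&\text{if } p\equiv1\pmod 4\text{ and } p=x^2+4y^2 \text{ with } x,y\in\mathbb Z,\\ -\frac{10}{81}p-\frac2{27}R_1(p)\pmod{p^2}&\text{if } p\equiv 3\pmod 4.\end{cases}$$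
   Context: For an odd prime $p$, $R_1(p)=(2p+2-2^{p-1})\binom{(p-1)/2}{[p/4]}^2$, where $[u]$ denotes the greatest integer not exceeding $u$. Congruences modulo $p^r$ between rational numbers with denominators prime to $p$ mean that the difference is $p^r$ times such a rational number. *)

theory Defs
  imports Complex_Main "HOL-Computational_Algebra.Primes"
begin

definition rat_cong :: "rat \<Rightarrow> rat \<Rightarrow> nat \<Rightarrow> nat \<Rightarrow> bool" where
  "rat_cong a b p r \<longleftrightarrow>
     (\<exists>u v :: int. \<not> (int p dvd v) \<and> a - b = of_nat (p ^ r) * (of_int u / of_int v))"

definition R1 :: "nat \<Rightarrow> rat" where
  "R1 p = (2 * of_nat p + 2 - 2 ^ (p - 1)) * of_nat (((p - 1) div 2) choose (p div 4)) ^ 2"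

end

theory Submission
  imports Defs "HOL-Number_Theory.Number_Theory" "HOL-Computational_Algebra.Computational_Algebra"
begin

text \<open>
  Write \<open>n = (p - 1) / 2\<close>. Modulo \<open>p\<^sup>2\<close> the term \<open>C(2k,k)\<^sup>3 / (-8)\<^sup>k\<close> is \<open>C(2k,k) C(n,k) C(n+k,k) 2\<^sup>k\<close>, and Clausen's
  formula \<open>\<Sum>\<^sub>k C(2k,k) C(n,k) C(n+k,k) (u(u+1))\<^sup>k = L(u)\<^sup>2\<close> with \<open>L(u) = \<Sum>\<^sub>k C(n,k) C(n+k,k) u\<^sup>k\<close>, applied at \<open>u = 1\<close>
  together with its derivatives, expresses the power moments of the sum by \<open>A = L(1)\<close> and \<open>B = L(1) + 4 L'(1)\<close>;
  the third moment also uses the telescoping relation between consecutive terms.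

  Both \<open>A\<close> and \<open>B\<close> are, up to \<open>p\<^sup>2\<close>, the average of two deformed series with denominators \<open>(1 + p)\<^sub>k\<close> and
  \<open>(1 - p)\<^sub>k\<close>. These are well-poised at \<open>-1\<close> and have closed forms: one by a Beta integral, the other as a
  coefficient of a power of \<open>1 / (1 - x\<^sup>2)\<close>. This gives \<open>A B \<equiv> (-1)\<^sup>n p\<close> and the square of the factor prime to \<open>p\<close>
  (\<open>A\<close> for even \<open>n\<close>, \<open>B\<close> for odd \<open>n\<close>) in terms of a binomial coefficient and harmonic numbers.

  For \<open>p \<equiv> 3 (mod 4)\<close> the harmonic numbers reduce to the Fermat quotient of 2. For \<open>p = x\<^sup>2 + 4 y\<^sup>2\<close>, Jacobsthal's
  theorem says that the sum of the Legendre symbols of \<open>t\<^sup>3 - t\<close> is \<open>\<plusminus>2x\<close>. Since the symbol of \<open>u\<close> is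
  \<open>(3 u\<^sup>n - u\<^bsup>3n\<^esup>) / 2\<close> modulo \<open>p\<^sup>2\<close>, summation over Teichmueller representatives leaves a few binomial
  coefficients and yields \<open>A\<^sup>2 \<equiv> 4x\<^sup>2 - 2p\<close>, a form of the theorem of Chowla, Dwork and Evans.
\<close>

section \<open>Rationals integral at a prime\<close>

text \<open>For prime \<open>p\<close> this is the localization of the integers at \<open>p\<close>,
  kept as a subset of \<open>rat\<close> so that field arithmetic stays available.\<close>

definition pint :: "nat \<Rightarrow> rat set" where
  "pint p = {of_int u / of_int v | u v :: int. \<not> int p dvd v}"

text \<open>Turns a congruence into an equation with an error term from a ring, so that most rules
  for congruences reduce to the closure properties of \<open>pint p\<close>.\<close>

lemma rat_cong_iff_pint: "rat_cong a b p r \<longleftrightarrow> (\<exists>z\<in>pint p. a = b + of_nat p ^ r * z)"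
proof
  assume "rat_cong a b p r"
  then obtain u v :: int where "\<not> int p dvd v" "a - b = of_nat (p ^ r) * (of_int u / of_int v)"
    unfolding rat_cong_def by blast
  then show "\<exists>z\<in>pint p. a = b + of_nat p ^ r * z"
    by (intro bexI[of _ "of_int u / of_int v"]) (auto simp: pint_def algebra_simps)
next
  assume "\<exists>z\<in>pint p. a = b + of_nat p ^ r * z"
  then obtain u v :: int where "\<not> int p dvd v" "a = b + of_nat p ^ r * (of_int u / of_int v)"
    unfolding pint_def by blast
  then show "rat_cong a b p r"
    unfolding rat_cong_def by (intro exI[of _ u] exI[of _ v]) simp
qed

locale prime_gt_3 =
  fixes p :: nat
  assumes prime_p: "prime p" and p_gt_3: "p > 3"
begin

abbreviation pcong :: "rat \<Rightarrow> rat \<Rightarrow> nat \<Rightarrow> bool" where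
  "pcong a b r \<equiv> rat_cong a b p r"

abbreviation P :: rat where "P \<equiv> of_nat p"

lemma prime_int_p: "prime (int p)"
  using prime_p by simp

lemma of_int_pint [simp, intro]: "of_int k \<in> pint p"
proof -
  have "\<not> int p dvd 1" using p_gt_3 by simp
  then show ?thesis unfolding pint_def
    by (intro CollectI exI[of _ k] exI[of _ 1]) auto
qed

lemma of_nat_pint [simp, intro]: "of_nat k \<in> pint p"
  using of_int_pint[of "int k"] by simp

lemma const_pint [simp, intro]: "0 \<in> pint p" "1 \<in> pint p" "numeral w \<in> pint p"
  using of_nat_pint[of 0] of_nat_pint[of 1] of_nat_pint[of "numeral w"] by simp_all

lemma add_pint [simp, intro]:
  assumes "a \<in> pint p" "b \<in> pint p" shows "a + b \<in> pint p"
proof -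
  obtain u v where a: "a = of_int u / of_int v" "\<not> int p dvd v" using assms(1) by (auto simp: pint_def)
  obtain s t where b: "b = of_int s / of_int t" "\<not> int p dvd t" using assms(2) by (auto simp: pint_def)
  have "v \<noteq> 0" "t \<noteq> 0" using a b by auto
  then have "a + b = of_int (u * t + s * v) / of_int (v * t)"
    by (simp add: a b field_simps)
  moreover have "\<not> int p dvd v * t"
    using a b prime_int_p by (simp add: prime_dvd_mult_iff)
  ultimately show ?thesis unfolding pint_def by blast
qed

lemma mult_pint [simp, intro]:
  assumes "a \<in> pint p" "b \<in> pint p" shows "a * b \<in> pint p"
proof -
  obtain u v where a: "a = of_int u / of_int v" "\<not> int p dvd v" using assms(1) by (auto simp: pint_def)
  obtain s t where b: "b = of_int s / of_int t" "\<not> int p dvd t" using assms(2) by (auto simp: pint_def)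
  have "a * b = of_int (u * s) / of_int (v * t)"
    by (simp add: a b)
  moreover have "\<not> int p dvd v * t"
    using a b prime_int_p by (simp add: prime_dvd_mult_iff)
  ultimately show ?thesis unfolding pint_def by blast
qed

lemma uminus_pint [simp, intro]: "a \<in> pint p \<Longrightarrow> - a \<in> pint p"
  using mult_pint[of "-1" a] of_int_pint[of "-1"] by simp

lemma diff_pint [simp, intro]: "a \<in> pint p \<Longrightarrow> b \<in> pint p \<Longrightarrow> a - b \<in> pint p"
  using add_pint[of a "-b"] by simp

lemma power_pint [simp, intro]: "a \<in> pint p \<Longrightarrow> a ^ k \<in> pint p"
  by (induction k) auto

lemma sum_pint [intro]: "(\<And>i. i \<in> I \<Longrightarrow> f i \<in> pint p) \<Longrightarrow> sum f I \<in> pint p"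
  by (induction I rule: infinite_finite_induct) auto

lemma prod_pint [intro]: "(\<And>i. i \<in> I \<Longrightarrow> f i \<in> pint p) \<Longrightarrow> prod f I \<in> pint p"
  by (induction I rule: infinite_finite_induct) auto

text \<open>The units of \<open>pint p\<close>. As \<open>inverse 0 = 0\<close> in HOL, zero has to
  be excluded explicitly.\<close>

definition punit :: "rat \<Rightarrow> bool" where
  "punit a \<longleftrightarrow> a \<noteq> 0 \<and> a \<in> pint p \<and> inverse a \<in> pint p"

lemma punitD: "punit a \<Longrightarrow> a \<noteq> 0" "punit a \<Longrightarrow> a \<in> pint p" "punit a \<Longrightarrow> inverse a \<in> pint p"
  by (auto simp: punit_def)

lemma divide_pint: "a \<in> pint p \<Longrightarrow> punit b \<Longrightarrow> a / b \<in> pint p"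
  by (simp add: divide_inverse punit_def)

lemma punit_of_int: "\<not> int p dvd k \<Longrightarrow> punit (of_int k)"
proof -
  assume k: "\<not> int p dvd k"
  then have "inverse (of_int k) \<in> pint p"
    unfolding pint_def by (intro CollectI exI[of _ 1] exI[of _ k]) (auto simp: inverse_eq_divide)
  then show ?thesis using k by (auto simp: punit_def)
qed

lemma punit_of_nat: "\<not> p dvd k \<Longrightarrow> punit (of_nat k)"
  using punit_of_int[of "int k"] by simp

lemma punit_of_nat_less: "0 < k \<Longrightarrow> k < p \<Longrightarrow> punit (of_nat k)"
  by (rule punit_of_nat) (auto dest: dvd_imp_le)

lemma punit_mult [intro]: "punit a \<Longrightarrow> punit b \<Longrightarrow> punit (a * b)"
  by (auto simp: punit_def)

lemma punit_inverse [intro]: "punit a \<Longrightarrow> punit (inverse a)"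
  by (auto simp: punit_def)

lemma punit_divide [intro]: "punit a \<Longrightarrow> punit b \<Longrightarrow> punit (a / b)"
  by (auto simp: divide_inverse)

lemma punit_1 [simp]: "punit 1"
  by (simp add: punit_def)

lemma punit_uminus [intro]: "punit a \<Longrightarrow> punit (- a)"
  by (auto simp: punit_def)

lemma punit_power [intro]: "punit a \<Longrightarrow> punit (a ^ k)"
  by (induction k) auto

lemma punit_prod [intro]: "(\<And>i. i \<in> I \<Longrightarrow> punit (f i)) \<Longrightarrow> punit (prod f I)"
  by (induction I rule: infinite_finite_induct) auto

lemma punit_fact: "k < p \<Longrightarrow> punit (fact k)"
  using punit_of_nat[of "fact k"] prime_p by (simp add: prime_dvd_fact_iff)

lemma punit_numeral: "numeral w < p \<Longrightarrow> punit (numeral w)"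
  using punit_of_nat_less[of "numeral w"] by simp

lemma odd_p: "odd p"
  using prime_p p_gt_3 prime_odd_nat by force

text \<open>All numerical constants cancelled later are products of 2 and 3, which are units because
  \<open>p > 3\<close>.\<close>

lemma punit_2: "punit 2" and punit_3: "punit 3"
  using p_gt_3 by (auto intro: punit_numeral)

lemma punit_4: "punit 4"
  using punit_mult[OF punit_2 punit_2] by simp

lemma punit_8: "punit 8"
  using punit_mult[OF punit_2 punit_4] by simp

lemma punit_9: "punit 9"
  using punit_mult[OF punit_3 punit_3] by simp

lemma punit_27: "punit 27"
  using punit_mult[OF punit_3 punit_9] by simp

section \<open>Congruences between p-integral rationals\<close>

lemma pcong_refl [simp]: "pcong a a r"
  unfolding rat_cong_iff_pint by (rule bexI[of _ 0]) auto

lemma pcong_sym: "pcong a b r \<Longrightarrow> pcong b a r"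
  unfolding rat_cong_iff_pint
proof (elim bexE)
  fix z assume "z \<in> pint p" "a = b + P ^ r * z"
  then show "\<exists>z\<in>pint p. b = a + P ^ r * z" by (intro bexI[of _ "-z"]) auto
qed

lemma pcong_add: "pcong a b r \<Longrightarrow> pcong c d r \<Longrightarrow> pcong (a + c) (b + d) r"
  unfolding rat_cong_iff_pint
proof (elim bexE)
  fix z w assume "z \<in> pint p" "a = b + P ^ r * z" "w \<in> pint p" "c = d + P ^ r * w"
  then show "\<exists>z\<in>pint p. a + c = b + d + P ^ r * z" 
    by (intro bexI[of _ "z + w"]) (auto simp: algebra_simps)
qed

lemma pcong_trans [trans]: "pcong a b r \<Longrightarrow> pcong b c r \<Longrightarrow> pcong a c r"
  using pcong_add[of a b r b c] unfolding rat_cong_def by (simp add: algebra_simps)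

lemma pcong_scale: "c \<in> pint p \<Longrightarrow> pcong a b r \<Longrightarrow> pcong (c * a) (c * b) r"
  unfolding rat_cong_iff_pint
proof (elim bexE)
  fix z assume "c \<in> pint p" "z \<in> pint p" "a = b + P ^ r * z"
  then show "\<exists>z\<in>pint p. c * a = c * b + P ^ r * z" 
    by (intro bexI[of _ "c * z"]) (auto simp: algebra_simps)
qed

lemma pcong_uminus: "pcong a b r \<Longrightarrow> pcong (- a) (- b) r"
  using pcong_scale[of "-1" a b r] uminus_pint[of 1] by simp

lemma pcong_diff: "pcong a b r \<Longrightarrow> pcong c d r \<Longrightarrow> pcong (a - c) (b - d) r"
  using pcong_add[of a b r "-c" "-d"] pcong_uminus[of c d r] by simp

text \<open>The congruence passes through \<open>a * d\<close>: first the second factors are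
  exchanged under \<open>a\<close>, then the first factors under \<open>d\<close>. Hence the
  integrality of exactly these two.\<close>

lemma pcong_mult:
  assumes "pcong a b r" "pcong c d r" "a \<in> pint p" "d \<in> pint p"
  shows "pcong (a * c) (b * d) r"
  using pcong_trans[OF pcong_scale[OF assms(3,2)]] pcong_scale[OF assms(4,1)]
  by (simp add: mult.commute)

lemma pint_pcong: "pcong a b r \<Longrightarrow> b \<in> pint p \<Longrightarrow> a \<in> pint p"
  unfolding rat_cong_iff_pint by (elim bexE) auto

lemma pcong_power:
  assumes "pcong a b r" "b \<in> pint p"
  shows "pcong (a ^ k) (b ^ k) r"
proof (induction k)
  case (Suc k)
  show ?case unfolding power_Suc
    by (rule pcong_mult[OF assms(1) Suc pint_pcong[OF assms] power_pint[OF assms(2)]])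
qed auto

lemma pcong_sum: "(\<And>i. i \<in> I \<Longrightarrow> pcong (f i) (g i) r) \<Longrightarrow> pcong (sum f I) (sum g I) r"
  by (induction I rule: infinite_finite_induct) (auto intro!: pcong_add)

lemma pcong_prod:
  "(\<And>i. i \<in> I \<Longrightarrow> pcong (f i) (g i) r) \<Longrightarrow> (\<And>i. i \<in> I \<Longrightarrow> g i \<in> pint p) \<Longrightarrow> 
    pcong (prod f I) (prod g I) r"
proof (induction I rule: infinite_finite_induct)
  case (insert x F)
  have "f x \<in> pint p" by (rule pint_pcong) (use insert in auto)
  moreover have "prod g F \<in> pint p" using insert by auto
  ultimately show ?case using insert by (simp add: pcong_mult)
qed auto

lemma pcong_cancel: "punit c \<Longrightarrow> pcong (c * a) (c * b) r \<Longrightarrow> pcong a b r"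
  using pcong_scale[of "inverse c" "c * a" "c * b" r] 
  by (simp add: punit_def mult.assoc[symmetric])

lemma pcong_P_0: "z \<in> pint p \<Longrightarrow> pcong (P ^ r * z) 0 r"
  unfolding rat_cong_iff_pint by auto

text \<open>Once a factor \<open>P\<close> is visible, the cofactor has to be known modulo p
  only.\<close>

lemma pcong_lift: "pcong a b 1 \<Longrightarrow> pcong (P * a) (P * b) 2"
  unfolding rat_cong_iff_pint
proof (elim bexE)
  fix z assume "z \<in> pint p" "a = b + P ^ 1 * z"
  then show "\<exists>z\<in>pint p. P * a = P * b + P\<^sup>2 * z" 
    by (intro bexI[of _ z]) (auto simp: algebra_simps power2_eq_square)
qed

lemma pcong_weaken: "pcong a b 2 \<Longrightarrow> pcong a b 1"
  unfolding rat_cong_iff_pint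
proof (elim bexE)
  fix z assume "z \<in> pint p" "a = b + P\<^sup>2 * z"
  then show "\<exists>z\<in>pint p. a = b + P ^ 1 * z" 
    by (intro bexI[of _ "P * z"]) (auto simp: algebra_simps power2_eq_square)
qed

lemma pcong_inverse:
  assumes "pcong a b r" "punit a" "punit b"
  shows "pcong (inverse a) (inverse b) r"
proof -
  have "pcong (inverse a * inverse b * b) (inverse a * inverse b * a) r"
    using assms by (intro pcong_scale pcong_sym[OF assms(1)]) (auto simp: punit_def)
  moreover have "inverse a * inverse b * b = inverse a" "inverse a * inverse b * a = inverse b"
    using assms by (simp_all add: punit_def)
  ultimately show ?thesis by simp
qed

lemma pcong_P_dvd: "z \<in> pint p \<Longrightarrow> pcong (P * z) 0 1"
  using pcong_P_0[of z 1] by simp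

lemma pcong_of_int: "[a = b] (mod int p ^ r) \<Longrightarrow> pcong (of_int a) (of_int b) r"
  unfolding rat_cong_iff_pint cong_iff_dvd_diff
proof (elim dvdE)
  fix k assume "a - b = int p ^ r * k"
  then have "(of_int a :: rat) - of_int b = P ^ r * of_int k"
    by (metis of_int_diff of_int_mult of_int_of_nat_eq of_int_power)
  then show "\<exists>z\<in>pint p. of_int a = of_int b + P ^ r * z" 
    by (intro bexI[of _ "of_int k"]) auto
qed

text \<open>First-order expansion: every product of two different \<open>P * c i\<close> is a
  multiple of p^2.\<close>

lemma prod_one_plus_pcong:
  assumes "finite I" "\<And>i. i \<in> I \<Longrightarrow> c i \<in> pint p"
  shows "pcong (\<Prod>i\<in>I. 1 + P * c i) (1 + P * (\<Sum>i\<in>I. c i)) 2"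
  using assms
proof (induction I rule: finite_induct)
  case (insert x F)
  have s: "sum c F \<in> pint p" using insert by auto
  have "pcong ((1 + P * c x) * (\<Prod>i\<in>F. 1 + P * c i)) ((1 + P * c x) * (1 + P * sum c F)) 2"
    using insert by (intro pcong_scale) auto
  also have "(1 + P * c x) * (1 + P * sum c F) = 
      1 + P * (c x + sum c F) + P ^ 2 * (c x * sum c F)"
    by (simp add: algebra_simps power2_eq_square)
  also have "pcong \<dots> (1 + P * (c x + sum c F) + 0) 2"
    using insert s by (intro pcong_add pcong_P_0) auto
  finally show ?case using insert by simp
qed auto

lemma punit_one_plus:
  assumes "c \<in> pint p" shows "punit (1 + P * c)"
proof -
  obtain u v where c: "c = of_int u / of_int v" "\<not> int p dvd v"
    using assms by (auto simp: pint_def)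
  moreover have "v \<noteq> 0" using c by auto
  ultimately have "1 + P * c = of_int (v + int p * u) / of_int v"
    by (simp add: field_simps)
  moreover have "\<not> int p dvd v + int p * u" using c by (simp add: dvd_add_left_iff)
  ultimately show ?thesis using c by (simp only:) (intro punit_divide punit_of_int)
qed

text \<open>The product of 1 + pc and 1 - pc is 1 - p^2 c^2.\<close>

lemma inverse_one_plus_pcong:
  assumes "c \<in> pint p" shows "pcong (inverse (1 + P * c)) (1 - P * c) 2"
proof (rule pcong_cancel[OF punit_one_plus[OF assms]])
  have "(1 + P * c) * inverse (1 + P * c) = 1" using punitD[OF punit_one_plus[OF assms]] by simp
  moreover have "(1 + P * c) * (1 - P * c) = 1 - P^2 * c^2" by (simp add: algebra_simps power2_eq_square)
  moreover have "pcong (1 - 0) (1 - P^2 * c^2) 2"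
    using assms by (intro pcong_diff pcong_sym[OF pcong_P_0]) auto
  ultimately show "pcong ((1 + P * c) * inverse (1 + P * c)) ((1 + P * c) * (1 - P * c)) 2"
    by simp
qed

definition half :: nat where "half = (p - 1) div 2"

lemma p_eq: "p = 2 * half + 1"
  using odd_p p_gt_3 unfolding half_def by presburger

lemma half_gt_1: "half > 1" using p_eq p_gt_3 by linarith

lemma P_eq: "P = 2 * of_nat half + 1"
  by (subst p_eq) simp

end

section \<open>Clausen's formula\<close>

text \<open>The coefficient of u^k in P_n(1 + 2u), where P_n is the Legendre polynomial.\<close>

definition shifted_legendre_coeff :: "nat \<Rightarrow> nat \<Rightarrow> rat" where
  "shifted_legendre_coeff n k = of_nat (n choose k) * of_nat ((n + k) choose k)"

text \<open>The factor on the right is (n - k)(n + k + 1). Written through n(n + 1), it yields the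
  Legendre equation, and for \<open>n = half\<close> it exposes p^2, because n(n + 1) = (p^2 -
  1)/4.\<close>

lemma shifted_legendre_coeff_Suc:
  "of_nat (Suc k) ^ 2 * shifted_legendre_coeff n (Suc k) =
   (of_nat n * (of_nat n + 1) - of_nat k * (of_nat k + 1)) * shifted_legendre_coeff n k"
proof (cases "k \<le> n")
  case True
  have 1: "of_nat (Suc k) * (of_nat (n choose Suc k) :: rat) = (of_nat n - of_nat k) * of_nat (n choose k)"
    using True binomial_absorb_comp[of n k] Suc_times_binomial_add[of k "n - k - 1"]
    by (metis binomial_absorption of_nat_diff of_nat_mult binomial_absorb_comp)
  have "Suc k * ((n + Suc k) choose Suc k) = Suc (n + k) * ((n + k) choose k)"
    using Suc_times_binomial_eq[of "n + k" k] by (simp del: binomial_Suc_Suc)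
  then have 2: "of_nat (Suc k) * (of_nat ((n + Suc k) choose Suc k) :: rat) = 
      (of_nat n + of_nat k + 1) * of_nat ((n + k) choose k)"
    by (metis (no_types, opaque_lifting) add.commute add.left_commute of_nat_Suc of_nat_add of_nat_mult)
  have "of_nat (Suc k) ^ 2 * shifted_legendre_coeff n (Suc k) = 
    (of_nat (Suc k) * of_nat (n choose Suc k)) * (of_nat (Suc k) * of_nat ((n + Suc k) choose Suc k))"
    by (simp add: shifted_legendre_coeff_def power2_eq_square mult_ac del: of_nat_Suc binomial_Suc_Suc)
  then show ?thesis unfolding 1 2 by (simp add: shifted_legendre_coeff_def algebra_simps)
next
  case False
  then have 0: "n choose k = 0" "n choose Suc k = 0" by (simp_all add: binomial_eq_0)
  show ?thesis unfolding shifted_legendre_coeff_def 0 by simp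
qed

lemma central_binomial_Suc:
  "of_nat (Suc k) * of_nat (2 * Suc k choose Suc k) = 2 * (2 * of_nat k + 1) * (of_nat (2 * k choose k) :: rat)"
proof -
  have "Suc k * (2 * Suc k choose Suc k) = 2 * Suc k * (Suc (2 * k) choose k)"
    using Suc_times_binomial_eq[of "Suc (2 * k)" k] by (simp del: binomial_Suc_Suc)
  moreover have "Suc k * (Suc (2 * k) choose k) = Suc (2 * k) * (2 * k choose k)"
    using binomial_absorb_comp[of "Suc (2 * k)" k] by (simp add: Suc_diff_le del: binomial_Suc_Suc)
  ultimately have "Suc k * (2 * Suc k choose Suc k) = 2 * Suc (2 * k) * (2 * k choose k)"
    by (simp only: mult.assoc)
  then have "of_nat (Suc k * (2 * Suc k choose Suc k)) = (of_nat (2 * Suc (2 * k) * (2 * k choose k)) :: rat)"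
    by (rule arg_cong)
  then show ?thesis by (simp only: of_nat_mult of_nat_Suc of_nat_numeral add.commute)
qed

text \<open>The coefficient of t^k in the terminating series 3F2(-n, n + 1, 1/2; 1, 1; -4t).\<close>

definition clausen_coeff :: "nat \<Rightarrow> nat \<Rightarrow> rat" where
  "clausen_coeff n k = of_nat (2 * k choose k) * shifted_legendre_coeff n k"

lemma clausen_coeff_Suc:
  "of_nat (Suc k) ^ 3 * clausen_coeff n (Suc k) =
   2 * (2 * of_nat k + 1) * (of_nat n * (of_nat n + 1) - of_nat k * (of_nat k + 1)) * clausen_coeff n k"
proof -
  have "of_nat (Suc k) ^ 3 * clausen_coeff n (Suc k) = 
    (of_nat (Suc k) * of_nat (2 * Suc k choose Suc k)) * (of_nat (Suc k) ^ 2 * shifted_legendre_coeff n (Suc k))"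
    unfolding clausen_coeff_def by (simp only: power3_eq_cube power2_eq_square mult_ac)
  also have "\<dots> = 2 * (2 * of_nat k + 1) * (of_nat n * (of_nat n + 1) - of_nat k * (of_nat k + 1)) * clausen_coeff n k"
    unfolding shifted_legendre_coeff_Suc central_binomial_Suc clausen_coeff_def
    by (simp only: mult_ac)
  finally show ?thesis .
qed

section \<open>Generating polynomials and their differential equations\<close>

definition shifted_legendre :: "nat \<Rightarrow> rat poly" where
  "shifted_legendre n = (\<Sum>k\<le>n. monom (shifted_legendre_coeff n k) k)"

definition clausen_poly :: "nat \<Rightarrow> rat poly" where
  "clausen_poly n = (\<Sum>k\<le>n. monom (clausen_coeff n k) k)"

lemma coeff_shifted_legendre: "coeff (shifted_legendre n) k = shifted_legendre_coeff n k"
  by (simp add: shifted_legendre_def coeff_sum shifted_legendre_coeff_def)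

lemma coeff_clausen_poly: "coeff (clausen_poly n) k = clausen_coeff n k"
  by (simp add: clausen_poly_def coeff_sum clausen_coeff_def shifted_legendre_coeff_def)

text \<open>The Legendre equation in the variable u; comparing coefficients gives back the two-term
  recurrence.\<close>

lemma shifted_legendre_ode:
  "[:0, 1, 1:] * pderiv (pderiv (shifted_legendre n)) + [:1, 2:] * pderiv (shifted_legendre n) =
   smult (of_nat n * (of_nat n + 1)) (shifted_legendre n)"
proof (rule poly_eqI)
  fix k
  have "coeff ([:0, 1, 1:] * pderiv (pderiv (shifted_legendre n)) + [:1, 2:] * pderiv (shifted_legendre n)) k
    = of_nat (Suc k) ^ 2 * shifted_legendre_coeff n (Suc k) + of_nat k * (of_nat k + 1) * shifted_legendre_coeff n k"
    \<comment> \<open>The case splits settle which of the shifted coefficients have a negative index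
      and vanish.\<close>
    by (cases k; cases "k - 1")
      (simp_all add: coeff_pderiv coeff_shifted_legendre coeff_pCons algebra_simps power2_eq_square)
  then show "coeff ([:0, 1, 1:] * pderiv (pderiv (shifted_legendre n)) + [:1, 2:] * pderiv (shifted_legendre n)) k =
    coeff (smult (of_nat n * (of_nat n + 1)) (shifted_legendre n)) k"
    unfolding shifted_legendre_coeff_Suc by (simp add: coeff_shifted_legendre algebra_simps)
qed

text \<open>The third-order hypergeometric equation, again equivalent to the recurrence of the
  coefficients.\<close>

lemma clausen_poly_ode:
  fixes n defines "N \<equiv> of_nat n * (of_nat n + 1) :: rat"
  shows "[:0, 0, 1, 4:] * pderiv (pderiv (pderiv (clausen_poly n))) + [:0, 3, 18:] * pderiv (pderiv (clausen_poly n))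
    + [:1, 12 - 4 * N:] * pderiv (clausen_poly n) = smult (2 * N) (clausen_poly n)"
proof (rule poly_eqI)
  fix k
  define j :: rat where "j = of_nat k"
  define c where "c = clausen_coeff n"
  have rec: "(j + 1) ^ 3 * c (Suc k) = 2 * (2 * j + 1) * (N - j * (j + 1)) * c k"
    using clausen_coeff_Suc[of k n] unfolding j_def N_def c_def of_nat_Suc by (simp only: add.commute)
  have "coeff ([:0, 0, 1, 4:] * pderiv (pderiv (pderiv (clausen_poly n))) + [:0, 3, 18:] * pderiv (pderiv (clausen_poly n))
    + [:1, 12 - 4 * N:] * pderiv (clausen_poly n)) k
    = (j + 1) ^ 3 * c (Suc k) + (4 * j ^ 3 + 6 * j ^ 2 + 2 * j - 4 * N * j) * c k"
    by (cases k; cases "k - 1"; cases "k - 2")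
      (simp_all add: j_def c_def coeff_pderiv coeff_clausen_poly coeff_pCons algebra_simps power2_eq_square power3_eq_cube)
  then show "coeff ([:0, 0, 1, 4:] * pderiv (pderiv (pderiv (clausen_poly n))) + [:0, 3, 18:] * pderiv (pderiv (clausen_poly n))
    + [:1, 12 - 4 * N:] * pderiv (clausen_poly n)) k = coeff (smult (2 * N) (clausen_poly n)) k"
    unfolding rec by (simp add: coeff_clausen_poly c_def algebra_simps power2_eq_square power3_eq_cube)
qed

text \<open>The symmetric square of the Legendre operator. With q = u(u + 1) it is q^2 Y''' + 3 q q'
  Y'' + (2q + q'^2 - 4Nq) Y' - 2N q' Y, and it annihilates products of two solutions of q L'' + q'
  L' = N L.\<close>

definition sym_square_op :: "rat \<Rightarrow> rat poly \<Rightarrow> rat poly" where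
  "sym_square_op N Y = [:0, 0, 1, 2, 1:] * pderiv (pderiv (pderiv Y)) + [:0, 3, 9, 6:] * pderiv (pderiv Y)
     + [:1, 6 - 4 * N, 6 - 4 * N:] * pderiv Y - smult (2 * N) ([:1, 2:] * Y)"

lemma sym_square_op_diff: "sym_square_op N (Y - Z) = sym_square_op N Y - sym_square_op N Z"
  by (simp only: sym_square_op_def pderiv_diff right_diff_distrib smult_diff_right algebra_simps)

text \<open>The indicial polynomial at the origin is \<open>k ^ 3\<close>, so a polynomial solution is determined by
  its constant term.\<close>

lemma sym_square_op_unique:
  assumes "sym_square_op N Y = 0" "coeff Y 0 = 0"
  shows "Y = 0"
proof -
  have step: "coeff Y (Suc k) = 0" if "\<forall>j\<le>k. coeff Y j = 0" for k
  proof -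
    have "coeff (sym_square_op N Y) k = of_nat (Suc k) ^ 3 * coeff Y (Suc k)"
      using that unfolding sym_square_op_def
      by (cases k; cases "k - 1"; cases "k - 2"; cases "k - 3")
        (simp_all add: coeff_pderiv coeff_pCons algebra_simps power3_eq_cube)
    then show ?thesis using assms(1) by (simp del: of_nat_Suc)
  qed
  have "\<forall>j\<le>k. coeff Y j = 0" for k
  proof (induction k)
    case (Suc k)
    then show ?case using step[of k] le_Suc_eq by auto
  qed (use assms in auto)
  then show ?thesis by (intro poly_eqI) auto
qed

text \<open>The value on L^2 is a combination of the second-order equation \<open>e\<close> and its
  derivative \<open>e'\<close>.\<close>

lemma sym_square_op_power2:
  assumes "[:0, 1, 1:] * pderiv (pderiv L) + [:1, 2:] * pderiv L = smult N L"
  shows "sym_square_op N (L ^ 2) = 0"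
proof -
  define q q' :: "rat poly" where "q = [:0, 1, 1:]" and "q' = [:1, 2:]"
  define K L1 L2 L3 :: "rat poly" where "K = [:N:]" and "L1 = pderiv L" and "L2 = pderiv L1" and "L3 = pderiv L2"
  have dq: "pderiv q = q'" "pderiv q' = 2" "pderiv K = 0"
    by (simp_all add: q_def q'_def K_def pderiv_pCons numeral_poly)
  have e: "q * L2 + q' * L1 = K * L" using assms by (simp add: q_def q'_def K_def L1_def L2_def)
  have "pderiv (q * L2 + q' * L1) = pderiv (K * L)" using e by simp
  then have e': "q * L3 + 2 * q' * L2 + 2 * L1 = K * L1"
    by (simp add: pderiv_mult pderiv_add dq L3_def[symmetric] L2_def[symmetric] L1_def[symmetric] algebra_simps)
  have Y1: "pderiv (L ^ 2) = 2 * L * L1" by (simp add: power2_eq_square pderiv_mult L1_def)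
  have Y2: "pderiv (2 * L * L1) = 2 * L1 * L1 + 2 * L * L2"
    by (simp add: pderiv_mult L1_def[symmetric] L2_def[symmetric] algebra_simps)
  have Y3: "pderiv (2 * L1 * L1 + 2 * L * L2) = 6 * L1 * L2 + 2 * L * L3"
    by (simp add: pderiv_mult pderiv_add L1_def[symmetric] L2_def[symmetric] L3_def[symmetric] algebra_simps)
  have co: "[:0, 0, 1, 2, 1:] = q ^ 2" "[:0, 3, 9, 6:] = 3 * q * q'"
    "[:1, 6 - 4 * N, 6 - 4 * N:] = 2 * q + q' ^ 2 - 4 * K * q"
    by (simp_all add: q_def q'_def K_def power2_eq_square numeral_poly)
  have "sym_square_op N (L ^ 2) = q ^ 2 * (6 * L1 * L2 + 2 * L * L3) + 3 * q * q' * (2 * L1 * L1 + 2 * L * L2)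
    + (2 * q + q' ^ 2 - 4 * K * q) * (2 * L * L1) - 2 * K * q' * L ^ 2"
    unfolding sym_square_op_def Y1 Y2 Y3 co q'_def[symmetric] by (simp add: K_def numeral_poly mult.commute[of N])
  \<comment> \<open>The multipliers of \<open>e\<close> and \<open>e'\<close> are read off from the
    terms containing L' L'' and L L'''.\<close>
  also have "\<dots> = 6 * q * L1 * (q * L2 + q' * L1 - K * L) + 2 * q * L * (q * L3 + 2 * q' * L2 + 2 * L1 - K * L1)
      + 2 * q' * L * (q * L2 + q' * L1 - K * L)"
    by (simp add: algebra_simps power2_eq_square)
  also have "\<dots> = 0" by (simp add: e e')
  finally show ?thesis .
qed

text \<open>Under the substitution t = u(u + 1) the chain rule produces powers of q' = 2u + 1. Up to
  a factor q' the operator becomes the third-order equation of the Clausen polynomial at t.\<close>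

lemma sym_square_op_clausen: 
  "sym_square_op (of_nat n * (of_nat n + 1)) (pcompose (clausen_poly n) [:0, 1, 1:]) = 0"
proof -
  define N where "N = (of_nat n * (of_nat n + 1) :: rat)"
  define q q' :: "rat poly" where "q = [:0, 1, 1:]" and "q' = [:1, 2:]"
  define K where "K = [:N:]"
  define F where "F = clausen_poly n"
  define F0 F1 F2 F3 where "F0 = pcompose F q" and "F1 = pcompose (pderiv F) q" 
    and "F2 = pcompose (pderiv (pderiv F)) q" and "F3 = pcompose (pderiv (pderiv (pderiv F))) q"
  have dq: "pderiv q = q'" "pderiv q' = 2" "q' ^ 2 = 1 + 4 * q"
    by (simp_all add: q_def q'_def pderiv_pCons numeral_poly power2_eq_square one_pCons)
  have co': "pcompose [:0, 0, 1, 4:] q = q ^ 2 + 4 * q ^ 3" "pcompose [:0, 3, 18:] q = 3 * q + 18 * q ^ 2"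
    "pcompose [:1, 12 - 4 * N:] q = 1 + 12 * q - 4 * K * q" "\<And>f. smult (2 * N) f = 2 * K * f"
    by (simp_all add: pcompose_pCons K_def numeral_poly one_pCons algebra_simps power2_eq_square power3_eq_cube
        smult_diff_left)
  have "pcompose ([:0, 0, 1, 4:] * pderiv (pderiv (pderiv F)) + [:0, 3, 18:] * pderiv (pderiv F)
    + [:1, 12 - 4 * N:] * pderiv F) q = pcompose (smult (2 * N) F) q"
    using clausen_poly_ode[of n] by (simp add: F_def N_def)
  then have e: "(q ^ 2 + 4 * q ^ 3) * F3 + (3 * q + 18 * q ^ 2) * F2 + (1 + 12 * q - 4 * K * q) * F1 - 2 * K * F0 = 0"
    unfolding pcompose_add pcompose_mult pcompose_smult co'(1-3) F0_def[symmetric] F1_def[symmetric] 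
      F2_def[symmetric] F3_def[symmetric] unfolding co'(4) by simp
  have Y1: "pderiv F0 = q' * F1" by (simp add: F0_def F1_def pderiv_pcompose dq mult.commute)
  have dF1: "pderiv F1 = q' * F2" by (simp add: F1_def F2_def pderiv_pcompose dq mult.commute)
  have dF2: "pderiv F2 = q' * F3" by (simp add: F3_def F2_def pderiv_pcompose dq mult.commute)
  have Y2: "pderiv (q' * F1) = q' ^ 2 * F2 + 2 * F1"
    by (simp add: pderiv_mult dF1 dq(1,2) power2_eq_square algebra_simps)
  have Y3: "pderiv (q' ^ 2 * F2 + 2 * F1) = q' ^ 3 * F3 + 6 * q' * F2"
    by (simp add: pderiv_mult pderiv_add dF1 dF2 dq(1,2) power2_eq_square power3_eq_cube algebra_simps)
  have co: "[:0, 0, 1, 2, 1:] = q ^ 2" "[:0, 3, 9, 6:] = 3 * q * q'"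
    "[:1, 6 - 4 * N, 6 - 4 * N:] = 2 * q + q' ^ 2 - 4 * K * q"
    by (simp_all add: q_def q'_def K_def power2_eq_square numeral_poly)
  have "sym_square_op N F0 = q ^ 2 * (q' ^ 3 * F3 + 6 * q' * F2) + 3 * q * q' * (q' ^ 2 * F2 + 2 * F1)
    + (2 * q + q' ^ 2 - 4 * K * q) * (q' * F1) - 2 * K * q' * F0"
    unfolding sym_square_op_def Y1 Y2 Y3 co q'_def[symmetric] by (simp add: K_def numeral_poly mult.commute[of N])
  also have "\<dots> = q' * (q ^ 2 * (q' ^ 2 * F3 + 6 * F2) + 3 * q * (q' ^ 2 * F2 + 2 * F1)
    + (2 * q + q' ^ 2 - 4 * K * q) * F1 - 2 * K * F0)"
    by (simp add: algebra_simps power2_eq_square power3_eq_cube)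
  \<comment> \<open>Here q'^2 = 1 + 4q removes the remaining even power of q'.\<close>
  also have "\<dots> = q' * ((q ^ 2 + 4 * q ^ 3) * F3 + (3 * q + 18 * q ^ 2) * F2 + (1 + 12 * q - 4 * K * q) * F1 - 2 * K * F0)"
    unfolding dq(3) by (simp add: algebra_simps power2_eq_square power3_eq_cube)
  also have "\<dots> = 0" by (simp add: e)
  finally show ?thesis by (simp add: F0_def F_def q_def N_def)
qed

text \<open>Clausen's formula for the square of a Legendre polynomial, in the variable \<open>u (u + 1)\<close>.\<close>

lemma shifted_legendre_square:
  "shifted_legendre n ^ 2 = pcompose (clausen_poly n) [:0, 1, 1:]"
proof -
  let ?D = "shifted_legendre n ^ 2 - pcompose (clausen_poly n) [:0, 1, 1:]"
  have "sym_square_op (of_nat n * (of_nat n + 1)) ?D = 0"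
    unfolding sym_square_op_diff sym_square_op_clausen
    using sym_square_op_power2[OF shifted_legendre_ode] by simp
  moreover have "coeff ?D 0 = 0"
    by (simp add: power2_eq_square coeff_mult coeff_shifted_legendre coeff_pcompose_0 poly_0_coeff_0 coeff_clausen_poly
        clausen_coeff_def shifted_legendre_coeff_def)
  ultimately have "?D = 0" by (rule sym_square_op_unique)
  then show ?thesis by simp
qed

section \<open>Evaluation of Clausen's formula and its derivatives\<close>

lemma pderiv_sum: "pderiv (\<Sum>i\<in>I. f i) = (\<Sum>i\<in>I. pderiv (f i))"
  by (induction I rule: infinite_finite_induct) (auto simp: pderiv_add)

text \<open>The factors \<open>t\<close> and \<open>t ^ 2\<close> restore the exponent k, so that no
  truncated subtraction survives on the right.\<close>

lemma poly_clausen_derivs: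
  "poly (clausen_poly n) t = (\<Sum>k\<le>n. clausen_coeff n k * t ^ k)"
  "t * poly (pderiv (clausen_poly n)) t = (\<Sum>k\<le>n. of_nat k * clausen_coeff n k * t ^ k)"
  "t ^ 2 * poly (pderiv (pderiv (clausen_poly n))) t = (\<Sum>k\<le>n. of_nat k * (of_nat k - 1) * clausen_coeff n k * t ^ k)"
proof -
  show "poly (clausen_poly n) t = (\<Sum>k\<le>n. clausen_coeff n k * t ^ k)"
    by (simp add: clausen_poly_def poly_sum poly_monom)
  have 1: "pderiv (clausen_poly n) = (\<Sum>k\<le>n. monom (of_nat k * clausen_coeff n k) (k - 1))"
    by (simp add: clausen_poly_def pderiv_sum pderiv_monom)
  have 2: "t * t ^ (k - 1) = t ^ k" if "k > 0" for k
    using that by (cases k) auto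
  show "t * poly (pderiv (clausen_poly n)) t = (\<Sum>k\<le>n. of_nat k * clausen_coeff n k * t ^ k)"
    unfolding 1 poly_sum sum_distrib_left
    by (intro sum.cong refl) (use 2 in \<open>force simp: poly_monom mult_ac\<close>)
  have 3: "t ^ 2 * t ^ (k - 2) = t ^ k" if "k > 1" for k
    using that by (auto simp: power2_eq_square less_iff_Suc_add)
  show "t ^ 2 * poly (pderiv (pderiv (clausen_poly n))) t = (\<Sum>k\<le>n. of_nat k * (of_nat k - 1) * clausen_coeff n k * t ^ k)"
    unfolding 1 pderiv_sum pderiv_monom poly_sum sum_distrib_left
  proof (intro sum.cong refl)
    fix k
    show "t\<^sup>2 * poly (monom (of_nat (k - 1) * (of_nat k * clausen_coeff n k)) (k - 1 - 1)) t =
         of_nat k * (of_nat k - 1) * clausen_coeff n k * t ^ k"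
    proof (cases "k > 1")
      case True
      then have "t\<^sup>2 * poly (monom (of_nat (k - 1) * (of_nat k * clausen_coeff n k)) (k - 1 - 1)) t =
         of_nat (k - 1) * of_nat k * clausen_coeff n k * (t ^ 2 * t ^ (k - 2))"
        by (simp add: poly_monom numeral_2_eq_2)
      then show ?thesis using True unfolding 3[OF True] by (simp add: of_nat_diff)
    next
      case False
      then consider "k = 0" | "k = 1" by linarith
      then show ?thesis by cases (simp_all add: poly_monom)
    qed
  qed
qed

text \<open>At \<open>u = 1\<close> the variable \<open>u (u + 1)\<close> equals 2.\<close>

lemma clausen_sums:
  fixes n defines "A \<equiv> (\<Sum>k\<le>n. shifted_legendre_coeff n k)"
    and "A1 \<equiv> (\<Sum>k\<le>n. of_nat k * shifted_legendre_coeff n k)"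
  shows "(\<Sum>k\<le>n. clausen_coeff n k * 2 ^ k) = A ^ 2"
    "3 * (\<Sum>k\<le>n. of_nat k * clausen_coeff n k * 2 ^ k) = 4 * A * A1"
    "27 * (\<Sum>k\<le>n. of_nat k ^ 2 * clausen_coeff n k * 2 ^ k) =
       24 * A1 ^ 2 + 12 * (of_nat n * (of_nat n + 1)) * A ^ 2 - 16 * A * A1"
proof -
  define L F where "L = shifted_legendre n" and "F = clausen_poly n"
  define N where "N = (of_nat n * (of_nat n + 1) :: rat)"
  define L0 L1 L2 where "L0 = poly L 1" and "L1 = poly (pderiv L) 1" and "L2 = poly (pderiv (pderiv L)) 1"
  define F0 F1 F2 where "F0 = poly F 2" and "F1 = poly (pderiv F) 2" and "F2 = poly (pderiv (pderiv F)) 2"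
  have A: "L0 = A" by (simp add: L0_def L_def shifted_legendre_def poly_sum poly_monom A_def)
  have A1: "L1 = A1"
    by (simp add: L1_def L_def shifted_legendre_def pderiv_sum pderiv_monom poly_sum poly_monom A1_def)
  have sq: "L ^ 2 = pcompose F [:0, 1, 1:]" by (simp add: L_def F_def shifted_legendre_square)
  have dq: "pderiv [:0, 1, 1 :: rat:] = [:1, 2:]" "pderiv [:1, 2 :: rat:] = [:2:]" by (simp_all add: pderiv_pCons)
  have F0: "F0 = A ^ 2" using arg_cong[OF sq, of "\<lambda>f. poly f 1"] by (simp add: F0_def poly_pcompose A[symmetric] L0_def)
  have d1: "2 * L * pderiv L = pcompose (pderiv F) [:0, 1, 1:] * [:1, 2:]"
    using arg_cong[OF sq, of pderiv] by (simp add: pderiv_pcompose dq power2_eq_square pderiv_mult)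
  have F1: "2 * A * A1 = 3 * F1" using arg_cong[OF d1, of "\<lambda>f. poly f 1"] 
    by (simp add: F1_def poly_pcompose A[symmetric] L0_def A1[symmetric] L1_def)
  have d2: "2 * pderiv L * pderiv L + 2 * L * pderiv (pderiv L) = 
      pcompose (pderiv (pderiv F)) [:0, 1, 1:] * [:1, 2:] * [:1, 2:] + pcompose (pderiv F) [:0, 1, 1:] * [:2:]"
  proof -
    have "2 * pderiv L * pderiv L + 2 * L * pderiv (pderiv L) = pderiv (2 * L * pderiv L)"
      by (simp add: pderiv_mult algebra_simps)
    also have "\<dots> = pcompose (pderiv (pderiv F)) [:0, 1, 1:] * [:1, 2:] * [:1, 2:] + pcompose (pderiv F) [:0, 1, 1:] * [:2:]"
      unfolding d1 pderiv_mult pderiv_pcompose dq by (simp only: ac_simps)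
    finally show ?thesis .
  qed
  have F2: "2 * A1 ^ 2 + 2 * A * L2 = 9 * F2 + 2 * F1" using arg_cong[OF d2, of "\<lambda>f. poly f 1"] 
    by (simp add: F1_def F2_def poly_pcompose A[symmetric] L0_def A1[symmetric] L1_def L2_def power2_eq_square)
  \<comment> \<open>The Legendre equation at u = 1 has coefficients 2 and 3 there and eliminates the
    second derivative.\<close>
  have L2: "2 * L2 + 3 * A1 = N * A" using arg_cong[OF shifted_legendre_ode[of n], of "\<lambda>f. poly f 1"]
    by (simp add: A[symmetric] A1[symmetric] L0_def L1_def L2_def L_def N_def)
  show "(\<Sum>k\<le>n. clausen_coeff n k * 2 ^ k) = A ^ 2"
    using poly_clausen_derivs(1)[of n 2] F0 by (simp add: F0_def F_def)
  have s1: "(\<Sum>k\<le>n. of_nat k * clausen_coeff n k * 2 ^ k) = 2 * F1"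
    using poly_clausen_derivs(2)[of 2 n] by (simp add: F1_def F_def)
  then show "3 * (\<Sum>k\<le>n. of_nat k * clausen_coeff n k * 2 ^ k) = 4 * A * A1"
    using F1 by simp
  have "(\<Sum>k\<le>n. of_nat k ^ 2 * clausen_coeff n k * 2 ^ k) = 
      (\<Sum>k\<le>n. of_nat k * (of_nat k - 1) * clausen_coeff n k * 2 ^ k) + (\<Sum>k\<le>n. of_nat k * clausen_coeff n k * 2 ^ k)"
    by (simp add: sum.distrib[symmetric] algebra_simps power2_eq_square)
  also have "\<dots> = 4 * F2 + 2 * F1"
    using poly_clausen_derivs(3)[of 2 n] s1 by (simp add: F2_def F_def)
  finally have "27 * (\<Sum>k\<le>n. of_nat k ^ 2 * clausen_coeff n k * 2 ^ k) = 12 * (9 * F2 + 2 * F1) + 10 * (3 * F1)"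
    by simp
  also have "\<dots> = 24 * A1 ^ 2 + 12 * A * (2 * L2 + 3 * A1) - 16 * A * A1"
    unfolding F2[symmetric] F1[symmetric] by (simp add: algebra_simps)
  finally show "27 * (\<Sum>k\<le>n. of_nat k ^ 2 * clausen_coeff n k * 2 ^ k) =
       24 * A1 ^ 2 + 12 * (of_nat n * (of_nat n + 1)) * A ^ 2 - 16 * A * A1"
    unfolding L2 N_def by (simp add: power2_eq_square)
qed

section \<open>Beta integrals of polynomials\<close>

text \<open>The integral over [0, 1], defined formally on coefficients so that all values stay
  rational.\<close>

definition unit_integral :: "rat poly \<Rightarrow> rat" where
  "unit_integral f = (\<Sum>i\<le>degree f. coeff f i / of_nat (Suc i))"

lemma unit_integral_eq: 
  assumes "degree f \<le> d" shows "unit_integral f = (\<Sum>i\<le>d. coeff f i / of_nat (Suc i))"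
  unfolding unit_integral_def
  by (rule sum.mono_neutral_left) (use assms in \<open>auto simp: coeff_eq_0\<close>)

lemma unit_integral_add: "unit_integral (f + g) = unit_integral f + unit_integral g"
proof -
  let ?d = "max (degree f) (degree g)"
  have "degree (f + g) \<le> ?d" by (rule degree_add_le_max)
  then show ?thesis
    by (simp add: unit_integral_eq[of _ ?d] sum.distrib add_divide_distrib del: of_nat_Suc)
qed

lemma unit_integral_smult: "unit_integral (smult c f) = c * unit_integral f"
  using unit_integral_eq[of "smult c f" "degree f"]
  by (simp add: degree_smult_le unit_integral_def sum_distrib_left del: of_nat_Suc)

lemma unit_integral_0 [simp]: "unit_integral 0 = 0"
  by (simp add: unit_integral_def)

lemma unit_integral_sum: "unit_integral (\<Sum>i\<in>I. f i) = (\<Sum>i\<in>I. unit_integral (f i))"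
  by (induction I rule: infinite_finite_induct) (auto simp: unit_integral_add)

text \<open>The fundamental theorem of calculus; it makes integration by parts purely
  algebraic.\<close>

lemma unit_integral_pderiv: "unit_integral (pderiv f) = poly f 1 - poly f 0"
proof -
  have "unit_integral (pderiv f) = (\<Sum>i\<le>degree f. coeff f (Suc i))"
    by (subst unit_integral_eq[of _ "degree f"]) 
      (simp_all add: degree_pderiv coeff_pderiv del: of_nat_Suc)
  also have "\<dots> = (\<Sum>i\<le>Suc (degree f). coeff f i) - coeff f 0"
    by (simp add: sum.atMost_Suc_shift del: sum.atMost_Suc)
  also have "\<dots> = poly f 1 - poly f 0"
    by (simp add: poly_altdef[of f 1] poly_0_coeff_0 coeff_eq_0)
  finally show ?thesis .
qed

definition qbeta :: "nat \<Rightarrow> nat \<Rightarrow> rat poly \<Rightarrow> rat" where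
  "qbeta a b f = unit_integral ([:0, 1:] ^ a * f ^ b)"

lemma qbeta_0: "qbeta a 0 f = 1 / of_nat (Suc a)"
proof -
  have "of_nat (Suc a) * unit_integral ([:0, 1:] ^ a) = unit_integral (pderiv ([:0, 1:] ^ Suc a))"
    unfolding pderiv_power_Suc by (simp add: pderiv_pCons unit_integral_smult del: of_nat_Suc)
  also have "\<dots> = 1" by (simp add: unit_integral_pderiv)
  finally show ?thesis by (simp add: qbeta_def field_simps del: of_nat_Suc)
qed

lemma of_nat_Suc_mult_cancel: "of_nat (Suc a) * x = of_nat (Suc a) * (y :: rat) \<Longrightarrow> x = y"
  by (simp del: of_nat_Suc)

text \<open>Integration by parts. The boundary term vanishes at 0 because of the factor x^(a + 1),
  and at 1 by assumption.\<close>

lemma qbeta_Suc: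
  assumes "poly f 1 = 0"
  shows "of_nat (Suc a) * qbeta a (Suc b) f =
    - of_nat (Suc b) * unit_integral ([:0, 1:] ^ Suc a * f ^ b * pderiv f)"
proof -
  have "unit_integral (pderiv ([:0, 1:] ^ Suc a * f ^ Suc b)) = 0"
    using assms by (simp add: unit_integral_pderiv)
  moreover have "pderiv ([:0, 1:] ^ Suc a * f ^ Suc b) =
     smult (of_nat (Suc b)) ([:0, 1:] ^ Suc a * f ^ b * pderiv f) + smult (of_nat (Suc a)) ([:0, 1:] ^ a * f ^ Suc b)"
    unfolding pderiv_mult pderiv_power_Suc by (simp add: pderiv_pCons mult_ac del: of_nat_Suc)
  ultimately show ?thesis
    by (simp add: qbeta_def unit_integral_add unit_integral_smult del: of_nat_Suc power_Suc)
qed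

lemma qbeta_linear: "qbeta a b [:1, -1:] = fact a * fact b / fact (a + b + 1)"
proof (induction b arbitrary: a)
  case 0
  then show ?case by (simp add: qbeta_0)
next
  case (Suc b)
  have "pderiv [:1, - 1 :: rat:] = - 1" by (simp add: pderiv_pCons one_pCons)
  then have "of_nat (Suc a) * qbeta a (Suc b) [:1, -1:] = of_nat (Suc b) * qbeta (Suc a) b [:1, -1:]"
    using unit_integral_smult[of "-1"] 
    by (subst qbeta_Suc) (simp_all add: qbeta_def del: of_nat_Suc power_Suc)
  also have "\<dots> = of_nat (Suc b) * (fact (Suc a) * fact b / fact (a + Suc b + 1))"
    unfolding Suc by simp
  also have "\<dots> = of_nat (Suc a) * (fact a * fact (Suc b) / fact (a + Suc b + 1))"
    by (simp add: fact_Suc del: of_nat_Suc)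
  finally show ?case by (rule of_nat_Suc_mult_cancel)
qed

text \<open>As the derivative of 1 - x^2 is -2x, each integration by parts raises the exponent
  \<open>a\<close> by 2; this explains the steps of 2 in the denominator and the induction with
  \<open>a\<close> arbitrary.\<close>

lemma qbeta_square: "qbeta a b [:1, 0, -1:] = 2 ^ b * fact b / (\<Prod>i\<le>b. of_nat (a + 1 + 2 * i))"
proof (induction b arbitrary: a)
  case 0
  then show ?case by (simp add: qbeta_0)
next
  case (Suc b)
  have "pderiv [:1, 0, - 1 :: rat:] = smult (- 2) [:0, 1:]" by (simp add: pderiv_pCons one_pCons)
  then have "[:0, 1:] ^ Suc a * f * pderiv [:1, 0, - 1:] = smult (- 2) ([:0, 1:] ^ (a + 2) * f)" for f :: "rat poly"
    by (simp only: mult_smult_right) (simp add: mult_ac)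
  then have "of_nat (Suc a) * qbeta a (Suc b) [:1, 0, -1:] = - of_nat (Suc b) * (- 2 * qbeta (a + 2) b [:1, 0, -1:])"
    unfolding qbeta_def[of "a + 2"] by (subst qbeta_Suc) (simp, simp only: unit_integral_smult)
  also have "\<dots> = 2 * of_nat (Suc b) * qbeta (a + 2) b [:1, 0, -1:]" by (simp del: of_nat_Suc)
  also have "\<dots> = 2 * of_nat (Suc b) * (2 ^ b * fact b / (\<Prod>i\<le>b. of_nat (a + 3 + 2 * i)))"
    unfolding Suc by (simp add: eval_nat_numeral)
  also have "\<dots> = of_nat (Suc a) * (2 ^ Suc b * fact (Suc b) / (\<Prod>i\<le>Suc b. of_nat (a + 1 + 2 * i)))"
    by (subst prod.atMost_Suc_shift) (simp add: eval_nat_numeral fact_Suc del: of_nat_Suc)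
  finally show ?case by (rule of_nat_Suc_mult_cancel)
qed

section \<open>Well-poised sums at -1 as Beta integrals\<close>

lemma one_plus_X_power: "[:1, 1:] ^ n = (\<Sum>k\<le>n. smult (of_nat (n choose k)) ([:0, 1:] ^ k :: rat poly))"
proof -
  have "[:1, 1:] = [:0, 1:] + (1 :: rat poly)" by (simp add: one_pCons)
  then show ?thesis using binomial_ring[of "[:0, 1:]" "1 :: rat poly" n] by (simp add: of_nat_poly)
qed

lemma one_minus_X_square_power: "[:1, 1:] ^ k * [:1, -1:] ^ k = ([:1, 0, -1:] ^ k :: rat poly)"
  by (simp flip: power_mult_distrib)

text \<open>Each quotient (n + k)! / (2n + 1 + k)! is, up to n!, the Beta integral of x^(n + k) (1 -
  x)^n, so the sum can be moved under the integral.\<close>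

lemma rising_sum_eq:
  "(\<Sum>k\<le>n. of_nat (n choose k) * c k * (fact (n + k) / fact n) / (fact (2 * n + 1 + k) / fact (2 * n + 1))) =
   fact (2 * n + 1) / fact n ^ 2 *
     unit_integral ((\<Sum>k\<le>n. smult (of_nat (n choose k) * c k) ([:0, 1:] ^ (n + k))) * [:1, -1:] ^ n)"
proof -
  have "unit_integral ((\<Sum>k\<le>n. smult (of_nat (n choose k) * c k) ([:0, 1:] ^ (n + k))) * [:1, -1:] ^ n)
    = (\<Sum>k\<le>n. of_nat (n choose k) * c k * qbeta (n + k) n [:1, -1:])"
    by (simp add: sum_distrib_right unit_integral_sum unit_integral_smult qbeta_def)
  moreover have "fact (2 * n + 1) / fact n ^ 2 * (of_nat (n choose k) * c k * qbeta (n + k) n [:1, -1:]) =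
      of_nat (n choose k) * c k * (fact (n + k) / fact n) / (fact (2 * n + 1 + k) / fact (2 * n + 1))" for k
  proof -
    have "n + k + n + 1 = 2 * n + 1 + k" by simp
    then show ?thesis unfolding qbeta_linear by (simp only: power2_eq_square) (simp del: fact_Suc add: mult_ac)
  qed
  ultimately show ?thesis by (simp only: sum_distrib_left)
qed

text \<open>The value 2F1(-n, n + 1; 2n + 2; -1), a case of Kummer's theorem. The binomial theorem
  makes the integrand x^n (1 + x)^n (1 - x)^n = x^n (1 - x^2)^n.\<close>

lemma rising_sum:
  "(\<Sum>k\<le>n. of_nat (n choose k) * (fact (n + k) / fact n) / (fact (2 * n + 1 + k) / fact (2 * n + 1))) =
   fact (2 * n + 1) / fact n * 2 ^ n / (\<Prod>i\<le>n. of_nat (n + 1 + 2 * i) :: rat)"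
proof -
  have "(\<Sum>k\<le>n. smult (of_nat (n choose k) * 1) ([:0, 1 :: rat:] ^ (n + k))) * [:1, -1:] ^ n
    = [:0, 1:] ^ n * [:1, 0, -1:] ^ n"
    unfolding one_minus_X_square_power[symmetric] one_plus_X_power
    by (simp add: sum_distrib_left sum_distrib_right power_add mult_ac)
  then have "unit_integral ((\<Sum>k\<le>n. smult (of_nat (n choose k) * 1) ([:0, 1 :: rat:] ^ (n + k))) * [:1, -1:] ^ n)
    = 2 ^ n * fact n / (\<Prod>i\<le>n. of_nat (n + 1 + 2 * i))"
    unfolding qbeta_square[symmetric] qbeta_def by simp
  then show ?thesis using rising_sum_eq[of n "\<lambda>_. 1"]
    by (simp add: power2_eq_square del: fact_Suc of_nat_Suc of_nat_add)
qed

text \<open>The weight splits as (n + k + 1) + k. The first part differentiates x^(n + 1) (1 + x)^n,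
  the second only the factor (1 + x)^n. After multiplication by (1 - x)^n and removal of a total
  derivative, which integrates to 0 because n > 0, what is left is 2n x^(n + 1) (1 - x^2)^(n -
  1).\<close>

lemma rising_sum_weighted:
  assumes "n > 0"
  shows "(\<Sum>k\<le>n. of_nat (n choose k) * of_nat (2 * k + n + 1) * (fact (n + k) / fact n) / (fact (2 * n + 1 + k) / fact (2 * n + 1))) =
   fact (2 * n + 1) / fact n * 2 ^ n / (\<Prod>i<n. of_nat (n + 2 + 2 * i) :: rat)"
proof -
  define x y z :: "rat poly" where "x = [:0, 1:]" and "y = [:1, 1:]" and "z = [:1, -1:]"
  obtain m where m: "n = Suc m" using assms by (cases n) auto
  have dy: "pderiv y = 1" "pderiv z = - 1" "pderiv x = 1" "y + z = 2"
    by (simp_all add: x_def y_def z_def pderiv_pCons one_pCons numeral_poly)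
  have yn: "y ^ n = y * y ^ m" "z ^ n = z * z ^ m" by (simp_all add: m)
  have pz: "pderiv (z ^ n) = - smult (of_nat n) (z ^ m)"
    unfolding m pderiv_power_Suc dy by simp
  have e1: "x ^ Suc n * y ^ n = (\<Sum>k\<le>n. smult (of_nat (n choose k)) (x ^ (n + k + 1)))"
    unfolding y_def one_plus_X_power by (simp add: sum_distrib_left power_add x_def mult_ac)
  have d1: "pderiv (x ^ Suc n * y ^ n) = (\<Sum>k\<le>n. smult (of_nat (n choose k) * of_nat (n + k + 1)) (x ^ (n + k)))"
    unfolding e1 pderiv_sum pderiv_smult by (simp add: pderiv_power_Suc dy mult_ac del: power_Suc)
  have "pderiv (y ^ n) = (\<Sum>k\<le>n. smult (of_nat (n choose k) * of_nat k) (x ^ (k - 1)))"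
    unfolding y_def one_plus_X_power x_def[symmetric] pderiv_sum pderiv_smult by (simp add: pderiv_power dy)
  then have "x ^ Suc n * pderiv (y ^ n) = (\<Sum>k\<le>n. smult (of_nat (n choose k) * of_nat k) (x ^ Suc n * x ^ (k - 1)))"
    by (simp add: sum_distrib_left)
  also have "\<dots> = (\<Sum>k\<le>n. smult (of_nat (n choose k) * of_nat k) (x ^ (n + k)))"
  proof (intro sum.cong refl)
    fix k show "smult (of_nat (n choose k) * of_nat k) (x ^ Suc n * x ^ (k - 1)) = smult (of_nat (n choose k) * of_nat k) (x ^ (n + k))"
      by (cases k) (simp_all add: power_add mult_ac)
  qed
  finally have d2: "x ^ Suc n * pderiv (y ^ n) = (\<Sum>k\<le>n. smult (of_nat (n choose k) * of_nat k) (x ^ (n + k)))" .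
  have w: "smult (of_nat (n choose k) * of_nat (2 * k + n + 1)) f = 
      smult (of_nat (n choose k) * of_nat (n + k + 1)) f + smult (of_nat (n choose k) * of_nat k) f" for k and f :: "rat poly"
    by (simp add: smult_add_left[symmetric] algebra_simps)
  have "(\<Sum>k\<le>n. smult (of_nat (n choose k) * of_nat (2 * k + n + 1)) (x ^ (n + k))) = 
    pderiv (x ^ Suc n * y ^ n) + x ^ Suc n * pderiv (y ^ n)"
    unfolding d1 d2 w sum.distrib ..
  then have "(\<Sum>k\<le>n. smult (of_nat (n choose k) * of_nat (2 * k + n + 1)) (x ^ (n + k))) * z ^ n = 
    pderiv (x ^ Suc n * y ^ n) * z ^ n + x ^ Suc n * pderiv (y ^ n) * z ^ n"
    by (simp add: algebra_simps)
  also have "pderiv (x ^ Suc n * y ^ n) * z ^ n = pderiv (x ^ Suc n * y ^ n * z ^ n) + smult (of_nat n) (x ^ Suc n * y ^ n * z ^ m)"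
    unfolding pderiv_mult[of "x ^ Suc n * y ^ n"] pz by (simp add: mult_ac)
  also have "x ^ Suc n * pderiv (y ^ n) * z ^ n = smult (of_nat n) (x ^ Suc n * y ^ m * z ^ n)"
    unfolding m pderiv_power_Suc dy by simp
  also have "pderiv (x ^ Suc n * y ^ n * z ^ n) + smult (of_nat n) (x ^ Suc n * y ^ n * z ^ m) + smult (of_nat n) (x ^ Suc n * y ^ m * z ^ n)
    = pderiv (x ^ Suc n * y ^ n * z ^ n) + smult (of_nat n) (x ^ Suc n * (y ^ m * z ^ m) * (y + z))"
    unfolding yn by (simp only: distrib_left distrib_right smult_add_right ac_simps)
  also have "\<dots> = pderiv (x ^ Suc n * y ^ n * z ^ n) + smult (2 * of_nat n) (x ^ Suc n * [:1, 0, -1:] ^ m)"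
    unfolding dy y_def z_def one_minus_X_square_power by (simp add: numeral_poly mult_ac)
  finally have e: "(\<Sum>k\<le>n. smult (of_nat (n choose k) * of_nat (2 * k + n + 1)) (x ^ (n + k))) * z ^ n =
     pderiv (x ^ Suc n * y ^ n * z ^ n) + smult (2 * of_nat n) (x ^ Suc n * [:1, 0, -1:] ^ m)" .
  have "unit_integral (pderiv (x ^ Suc n * y ^ n * z ^ n)) = 0"
    using assms by (simp add: unit_integral_pderiv x_def z_def)
  then have "unit_integral ((\<Sum>k\<le>n. smult (of_nat (n choose k) * of_nat (2 * k + n + 1)) (x ^ (n + k))) * z ^ n) =
    2 * of_nat n * (2 ^ m * fact m / (\<Prod>i\<le>m. of_nat (Suc n + 1 + 2 * i)))"
    unfolding e unit_integral_add unit_integral_smult qbeta_square[symmetric] by (simp add: qbeta_def x_def)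
  also have "\<dots> = 2 ^ n * fact n / (\<Prod>i<n. of_nat (n + 2 + 2 * i))"
    by (simp add: m lessThan_Suc_atMost fact_Suc del: of_nat_Suc prod.atMost_Suc)
  finally have U: "unit_integral ((\<Sum>k\<le>n. smult (of_nat (n choose k) * of_nat (2 * k + n + 1)) (x ^ (n + k))) * z ^ n) = 
    2 ^ n * fact n / (\<Prod>i<n. of_nat (n + 2 + 2 * i))" .
  have "(\<Sum>k\<le>n. of_nat (n choose k) * of_nat (2 * k + n + 1) * (fact (n + k) / fact n) / (fact (2 * n + 1 + k) / fact (2 * n + 1))) =
   fact (2 * n + 1) / fact n ^ 2 * (2 ^ n * fact n / (\<Prod>i<n. of_nat (n + 2 + 2 * i) :: rat))"
    unfolding U[symmetric] x_def z_def by (rule rising_sum_eq)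
  also have "\<dots> = fact (2 * n + 1) / fact n * 2 ^ n / (\<Prod>i<n. of_nat (n + 2 + 2 * i) :: rat)"
    by (simp add: power2_eq_square del: fact_Suc of_nat_Suc of_nat_add)
  finally show ?thesis .
qed

section \<open>Alternating convolutions of binomial coefficients\<close>

lemma fps_nth_inverse_one_minus_X_power:
  "n > 0 \<Longrightarrow> inverse ((1 - fps_X) ^ n) $ k = (of_nat (n + k - 1 choose k) :: rat)"
  "n > 0 \<Longrightarrow> inverse ((1 + fps_X) ^ n) $ k = (-1) ^ k * (of_nat (n + k - 1 choose k) :: rat)"
proof -
  have "1 + fps_X = 1 - fps_const (-1 :: rat) * fps_X" 
    by (simp add: fps_const_neg[symmetric] del: fps_const_neg)
  then show "n > 0 \<Longrightarrow> inverse ((1 + fps_X) ^ n) $ k = (-1) ^ k * (of_nat (n + k - 1 choose k) :: rat)"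
    using one_minus_const_fps_X_neg_power'[of n "-1 :: rat"] by (simp only:) simp
  show "n > 0 \<Longrightarrow> inverse ((1 - fps_X) ^ n) $ k = (of_nat (n + k - 1 choose k) :: rat)"
    using one_minus_const_fps_X_neg_power'[of n "1 :: rat"] by simp
qed

text \<open>The series of (1 - X)^(-n) with X^2 substituted for X.\<close>

lemma fps_nth_inverse_one_minus_X2_power:
  assumes "n > 0"
  shows "inverse ((1 - fps_X ^ 2) ^ n) $ k = (if even k then of_nat (n + k div 2 - 1 choose (k div 2)) else (0 :: rat))"
proof -
  have nz: "((1 - fps_X) ^ n :: rat fps) $ 0 \<noteq> 0" "((1 - fps_X ^ 2) ^ n :: rat fps) $ 0 \<noteq> 0" 
    by (simp_all add: fps_power_zeroth)
  have "inverse ((1 - fps_X) ^ n) * ((1 - fps_X) ^ n) = (1 :: rat fps)"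
    using nz(1) by (rule inverse_mult_eq_1)
  then have "(inverse ((1 - fps_X) ^ n) * ((1 - fps_X) ^ n)) oo fps_X ^ 2 = (1 :: rat fps)" by simp
  then have "(inverse ((1 - fps_X) ^ n) oo fps_X ^ 2) * (1 - fps_X ^ 2) ^ n = (1 :: rat fps)"
    by (simp add: fps_compose_mult_distrib fps_compose_power[symmetric] fps_compose_sub_distrib)
  then have "inverse ((1 - fps_X ^ 2) ^ n) = (inverse ((1 - fps_X) ^ n) oo fps_X ^ 2 :: rat fps)"
    by (metis fps_inverse_unique mult.commute)
  then show ?thesis using assms
    by (simp add: fps_nth_compose_X_power fps_nth_inverse_one_minus_X_power)
qed

text \<open>The coefficient of X^i in (1 + X)^(-n) (1 - X)^(-n) = (1 - X^2)^(-n).\<close>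

lemma alternating_convolution:
  assumes "n > 0"
  shows "(\<Sum>k\<le>i. (-1) ^ k * of_nat (n + k - 1 choose k) * of_nat (n + (i - k) - 1 choose (i - k))) = 
    (if even i then of_nat (n + i div 2 - 1 choose (i div 2)) else (0 :: rat))"
proof -
  have "inverse ((1 + fps_X) ^ n) * inverse ((1 - fps_X) ^ n) = (inverse ((1 - fps_X ^ 2) ^ n) :: rat fps)"
    by (simp add: fps_inverse_mult[symmetric] power_mult_distrib[symmetric] algebra_simps power2_eq_square)
  then have "(inverse ((1 + fps_X) ^ n) * inverse ((1 - fps_X) ^ n)) $ i = (inverse ((1 - fps_X ^ 2) ^ n) :: rat fps) $ i"
    by simp
  then show ?thesis using assms
    by (simp add: fps_nth_inverse_one_minus_X2_power fps_mult_nth fps_nth_inverse_one_minus_X_power atLeast0AtMost)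
qed

text \<open>The weight is k minus the complementary index, so the sum is a coefficient of X (f' h -
  f h') with f = (1 + X)^(-n) and h = (1 - X)^(-n). Here f' h - f h' = -2n (1 - X^2)^(-n - 1), and
  the factor X accounts for the index \<open>Suc i\<close>.\<close>

lemma alternating_convolution_weighted:
  assumes "n > 0"
  shows "(\<Sum>k\<le>Suc i. (2 * of_nat k - of_nat (Suc i)) * (-1) ^ k * of_nat (n + k - 1 choose k) * of_nat (n + (Suc i - k) - 1 choose (Suc i - k))) = 
    (if even i then - 2 * of_nat n * of_nat (n + i div 2 choose (i div 2)) else (0 :: rat))"
proof -
  define u v :: "rat fps" where "u = 1 + fps_X" and "v = 1 - fps_X"
  define f h where "f = inverse (u ^ n)" and "h = inverse (v ^ n)"
  define c :: "rat fps" where "c = of_nat n"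
  obtain m where m: "n = Suc m" using assms by (cases n) auto
  have d: "fps_deriv u = 1" "fps_deriv v = - 1" by (simp_all add: u_def v_def)
  have fu: "f * u ^ n = 1" unfolding f_def by (rule inverse_mult_eq_1) (simp add: u_def fps_power_zeroth)
  have hv: "h * v ^ n = 1" unfolding h_def by (rule inverse_mult_eq_1) (simp add: v_def fps_power_zeroth)
  have "fps_deriv (f * u ^ n) = 0" by (simp add: fu)
  then have "fps_deriv f * u ^ n + c * f * u ^ m = 0"
    by (simp add: fps_deriv_power d m c_def algebra_simps fps_of_nat del: of_nat_Suc power_Suc)
  \<comment> \<open>Multiplying by \<open>f * u\<close> brings in \<open>f * u ^ n = 1\<close> and
    leaves the logarithmic derivative of f.\<close>
  then have "f * (u * (fps_deriv f * u ^ n + c * f * u ^ m)) = 0" by simp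
  then have "u * fps_deriv f * (f * u ^ n) + c * f * (f * u ^ n) = 0"
    by (simp add: algebra_simps m)
  then have df: "u * fps_deriv f = - c * f" unfolding fu by (simp add: eq_neg_iff_add_eq_0)
  have "fps_deriv (h * v ^ n) = 0" by (simp add: hv)
  then have "fps_deriv h * v ^ n - c * h * v ^ m = 0"
    by (simp add: fps_deriv_power d m c_def algebra_simps fps_of_nat del: of_nat_Suc power_Suc)
  then have "h * (v * (fps_deriv h * v ^ n - c * h * v ^ m)) = 0" by simp
  then have "v * fps_deriv h * (h * v ^ n) - c * h * (h * v ^ n) = 0"
    by (simp add: algebra_simps m)
  then have dh: "v * fps_deriv h = c * h" unfolding hv by simp
  have uv: "u * v = 1 - fps_X ^ 2" "u + v = 2" by (simp_all add: u_def v_def algebra_simps power2_eq_square)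
  have "(fps_deriv f * h - f * fps_deriv h) * (u * v) ^ Suc n = 
     ((u * fps_deriv f) * v * h - f * u * (v * fps_deriv h)) * (u * v) ^ n"
    by (simp add: algebra_simps)
  also have "\<dots> = - c * (u + v) * (f * u ^ n) * (h * v ^ n)"
    unfolding df dh by (simp add: algebra_simps power_mult_distrib)
  also have "\<dots> = - 2 * c" unfolding fu hv uv by simp
  finally have e: "(fps_deriv f * h - f * fps_deriv h) * (1 - fps_X ^ 2) ^ Suc n = - 2 * c" unfolding uv .
  have "(1 - fps_X ^ 2) ^ Suc n * inverse ((1 - fps_X ^ 2) ^ Suc n) = (1 :: rat fps)"
    by (rule inverse_mult_eq_1') (simp add: fps_power_zeroth)
  then have "fps_deriv f * h - f * fps_deriv h = (fps_deriv f * h - f * fps_deriv h) * (1 - fps_X ^ 2) ^ Suc n * inverse ((1 - fps_X ^ 2) ^ Suc n)"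
    by (simp only: mult.assoc mult_1_right)
  then have "(fps_deriv f * h - f * fps_deriv h) $ i = (fps_const (- 2 * of_nat n) * inverse ((1 - fps_X ^ 2) ^ Suc n)) $ i"
    unfolding e c_def by (simp add: fps_of_nat[symmetric] fps_numeral_fps_const fps_const_neg[symmetric] fps_const_mult[symmetric] 
       del: fps_const_mult fps_const_neg power_Suc)
  also have "\<dots> = (if even i then - 2 * of_nat n * of_nat (n + i div 2 choose (i div 2)) else 0)"
    by (simp add: fps_nth_inverse_one_minus_X2_power del: power_Suc)
  finally have R: "(fps_deriv f * h - f * fps_deriv h) $ i = 
    (if even i then - 2 * of_nat n * of_nat (n + i div 2 choose (i div 2)) else 0)" .
  have "(fps_deriv f * h - f * fps_deriv h) $ i = (fps_X * (fps_deriv f * h) - f * (fps_X * fps_deriv h)) $ Suc i"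
    by (simp add: mult.left_commute[of f])
  also have "\<dots> = ((fps_X * fps_deriv f) * h - f * (fps_X * fps_deriv h)) $ Suc i" by (simp add: mult.assoc)
  also have "\<dots> = (\<Sum>k\<le>Suc i. of_nat k * f $ k * h $ (Suc i - k)) - (\<Sum>k\<le>Suc i. f $ k * (of_nat (Suc i - k) * h $ (Suc i - k)))"
  proof -
    have X: "(fps_X * fps_deriv g) $ k = of_nat k * g $ k" for k and g :: "rat fps" by (cases k) simp_all
    show ?thesis by (simp only: fps_sub_nth fps_mult_nth[of "fps_X * _"] fps_mult_nth[of f] X atLeast0AtMost)
  qed
  also have "\<dots> = (\<Sum>k\<le>Suc i. (2 * of_nat k - of_nat (Suc i)) * (f $ k * h $ (Suc i - k)))"
    unfolding sum_subtractf[symmetric]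
    by (intro sum.cong refl) (simp add: of_nat_diff algebra_simps)
  finally show ?thesis unfolding R using assms
    by (simp add: f_def h_def u_def v_def fps_nth_inverse_one_minus_X_power mult.assoc del: sum.atMost_Suc)
qed

section \<open>Reduction to Legendre polynomials\<close>

text \<open>The factors at distance 2j on both sides of the middle one pair up to c^2 - 4
  j^2.\<close>

lemma prod_arith_progression_centered:
  "(\<Prod>i\<le>2 * m. c + 2 * of_nat i - 2 * of_nat m) = c * (\<Prod>j=1..m. c ^ 2 - 4 * of_nat j ^ 2)" for c :: rat
proof (induction m)
  case (Suc m)
  have "(\<Prod>i\<le>2 * Suc m. c + 2 * of_nat i - 2 * of_nat (Suc m)) =
     (c - 2 * of_nat (Suc m)) * ((\<Prod>i\<le>2 * m. c + 2 * of_nat (Suc i) - 2 * of_nat (Suc m)) * (c + 2 * of_nat (2 * Suc m) - 2 * of_nat (Suc m)))"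
    by (simp only: mult_Suc_right add_2_eq_Suc prod.atMost_Suc_shift[of _ "Suc (2 * m)"]) (simp add: mult_ac)
  also have "(\<Prod>i\<le>2 * m. c + 2 * of_nat (Suc i) - 2 * of_nat (Suc m)) = c * (\<Prod>j=1..m. c ^ 2 - 4 * of_nat j ^ 2)"
    unfolding Suc[symmetric] by (intro prod.cong refl) (simp add: algebra_simps)
  also have "(c - 2 * of_nat (Suc m)) * (c * (\<Prod>j=1..m. c ^ 2 - 4 * of_nat j ^ 2) * (c + 2 * of_nat (2 * Suc m) - 2 * of_nat (Suc m))) = 
     c * (\<Prod>j=1..m. c ^ 2 - 4 * of_nat j ^ 2) * (c ^ 2 - 4 * of_nat (Suc m) ^ 2)"
    by (simp add: algebra_simps power2_eq_square)
  finally show ?case by simp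
qed simp

lemma prod_even_shift: "(\<Prod>i<k. of_nat (2 * a + 2 + 2 * i)) = (2 ^ k * fact (a + k) / fact a :: rat)"
proof (induction k)
  case (Suc k)
  have "(of_nat (2 * a + 2 + 2 * k) :: rat) = 2 * of_nat (Suc (a + k))" by simp
  then show ?case unfolding prod.lessThan_Suc Suc by (simp add: fact_Suc del: of_nat_Suc)
qed simp

context prime_gt_3
begin

section \<open>Harmonic numbers and deformed factorials\<close>

abbreviation harmonic :: "nat \<Rightarrow> rat" where
  "harmonic k \<equiv> (\<Sum>i=1..k. 1 / of_nat i)"

lemma inverse_pint: "0 < i \<Longrightarrow> i < p \<Longrightarrow> 1 / of_nat i \<in> pint p"
  using punit_of_nat_less[of i] by (simp add: punit_def inverse_eq_divide)

lemma harmonic_pint: "k < p \<Longrightarrow> harmonic k \<in> pint p"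
  by (intro sum_pint inverse_pint) auto

text \<open>In terms of rising factorials, \<open>up k\<close> is (1 + p)_k / k! and
  \<open>dn k\<close> is (1 - p)_k / k!. The factors have the shape \<open>1 + P * c\<close> to
  which the first-order expansion applies.\<close>

definition up :: "nat \<Rightarrow> rat" where "up k = (\<Prod>i=1..k. 1 + P * (1 / of_nat i))"
definition dn :: "nat \<Rightarrow> rat" where "dn k = (\<Prod>i=1..k. 1 + P * - (1 / of_nat i))"

lemma punit_up: "k < p \<Longrightarrow> punit (up k)" and punit_dn: "k < p \<Longrightarrow> punit (dn k)"
  unfolding up_def dn_def by (intro punit_prod punit_one_plus uminus_pint inverse_pint; simp)+

lemma up_pcong: "k < p \<Longrightarrow> pcong (up k) (1 + P * harmonic k) 2"
  unfolding up_def by (rule prod_one_plus_pcong) (auto intro!: inverse_pint)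

lemma dn_pcong: "k < p \<Longrightarrow> pcong (dn k) (1 - P * harmonic k) 2"
proof -
  assume "k < p"
  then have "pcong (dn k) (1 + P * (\<Sum>i=1..k. - (1 / of_nat i))) 2"
    unfolding dn_def by (intro prod_one_plus_pcong uminus_pint inverse_pint) auto
  then show ?thesis by (simp add: sum_negf)
qed

lemma inverse_up_pcong:
  assumes "k < p" shows "pcong (inverse (up k)) (1 - P * harmonic k) 2"
proof -
  have h: "harmonic k \<in> pint p" by (rule harmonic_pint[OF assms])
  show ?thesis
    by (rule pcong_trans[OF pcong_inverse[OF up_pcong[OF assms] punit_up[OF assms] punit_one_plus[OF h]] 
        inverse_one_plus_pcong[OF h]])
qed

lemma inverse_dn_pcong:
  assumes "k < p" shows "pcong (inverse (dn k)) (1 + P * harmonic k) 2"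
proof -
  have h: "- harmonic k \<in> pint p" using harmonic_pint[OF assms] by (rule uminus_pint)
  have "pcong (dn k) (1 + P * - harmonic k) 2" using dn_pcong[OF assms] by simp
  from pcong_trans[OF pcong_inverse[OF this punit_dn[OF assms] punit_one_plus[OF h]] inverse_one_plus_pcong[OF h]]
  show ?thesis by simp
qed

lemma pcong_of_one_plus: "c \<in> pint p \<Longrightarrow> pcong (1 + P * c) 1 1" "c \<in> pint p \<Longrightarrow> pcong (1 - P * c) 1 1"
  using pcong_add[OF pcong_refl[of 1 1] pcong_P_dvd[of c]] pcong_diff[OF pcong_refl[of 1 1] pcong_P_dvd[of c]] by simp_all

lemma dn_pcong_1: "k < p \<Longrightarrow> pcong (dn k) 1 1"
  using pcong_trans[OF pcong_weaken[OF dn_pcong] pcong_of_one_plus(2)] harmonic_pint by blast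

lemma inverse_dn_pcong_1: "k < p \<Longrightarrow> pcong (inverse (dn k)) 1 1"
  using pcong_trans[OF pcong_weaken[OF inverse_dn_pcong] pcong_of_one_plus(1)] harmonic_pint by blast

lemma up_eq: "up k = fact (p + k) / (fact p * fact k)"
proof (induction k)
  case (Suc k)
  have "up (Suc k) = up k * (1 + P / of_nat (Suc k))" by (simp add: up_def)
  then show ?case unfolding Suc by (simp add: field_simps fact_Suc del: of_nat_Suc) (simp add: algebra_simps)
qed (simp add: up_def)

text \<open>An exact reflection formula for (p - 1)!: its k largest factors are p - i = -i (1 - p/i)
  for i = 1, ..., k.\<close>

lemma fact_eq_dn: "k \<le> 2 * half \<Longrightarrow> fact (2 * half) = fact (2 * half - k) * (-1) ^ k * fact k * dn k"
proof (induction k)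
  case (Suc k)
  define e where "e = 1 + P * - (1 / of_nat (Suc k))"
  have s: "2 * half - k = Suc (2 * half - Suc k)" using Suc by simp
  have f: "fact (2 * half - k) = (of_nat (2 * half - k) * fact (2 * half - Suc k) :: rat)"
    by (subst s) (simp only: fact_Suc s)
  have "of_nat (2 * half - k) = P - of_nat (Suc k)" using Suc by (simp add: of_nat_diff P_eq)
  also have "\<dots> = - of_nat (Suc k) * e" 
    by (simp add: e_def field_simps del: of_nat_Suc)
  finally have "fact (2 * half - k) = - of_nat (Suc k) * e * fact (2 * half - Suc k)"
    using f by simp
  moreover have "dn (Suc k) = dn k * e" by (simp add: dn_def e_def)
  moreover have "fact (2 * half) = fact (2 * half - k) * (-1) ^ k * fact k * dn k" using Suc by simp
  ultimately show ?case unfolding fact_Suc power_Suc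
    by (simp only: mult_ac mult_minus_left mult_minus_right mult_1_left)
qed (simp add: dn_def)

section \<open>Reduction of the sums modulo p^2\<close>

lemma P_unfold: "of_nat half * (of_nat half + 1) = (P ^ 2 - 1) / 4"
  by (simp add: P_eq power2_eq_square algebra_simps)

lemma half_less: "half < p" using p_eq by linarith

abbreviation slc :: "nat \<Rightarrow> rat" where "slc \<equiv> shifted_legendre_coeff half"

lemma slc_pint: "slc k \<in> pint p"
  by (simp add: shifted_legendre_coeff_def)

text \<open>Both sides satisfy first-order recurrences with denominator 4(k + 1)^2. The numerators
  are -(2k + 1)^2 on the left and p^2 - (2k + 1)^2 on the right; for k < half the denominator is a
  unit.\<close>

lemma central_binomial_square_pcong:
  "k \<le> half \<Longrightarrow> pcong (of_nat (2 * k choose k) ^ 2 / (-16) ^ k) (slc k) 2"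
proof (induction k)
  case (Suc k)
  define w :: "nat \<Rightarrow> rat" where "w k = of_nat (2 * k choose k) ^ 2 / (-16) ^ k" for k
  define d :: rat where "d = 2 * of_nat k + 1"
  have k: "Suc k < p" using Suc half_less by simp
  have u: "punit (4 * of_nat (Suc k) ^ 2)"
    using k by (intro punit_mult punit_4 punit_power punit_of_nat_less) auto
  have "4 * of_nat (Suc k) ^ 2 * w (Suc k) = 4 * (of_nat (Suc k) * of_nat (2 * Suc k choose Suc k)) ^ 2 / (-16) ^ Suc k"
    by (simp only: w_def power_mult_distrib) simp
  also have "\<dots> = - (d ^ 2) * w k"
    unfolding central_binomial_Suc d_def[symmetric] by (simp add: w_def power_mult_distrib field_simps)
  also have "pcong \<dots> (- (d ^ 2) * slc k) 2"
    unfolding w_def by (intro pcong_scale Suc.IH) (use Suc.prems in \<open>auto simp: d_def\<close>)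
  also have "pcong (- (d ^ 2) * slc k) (- (d ^ 2) * slc k + P ^ 2 * slc k) 2"
    using pcong_add[OF pcong_refl pcong_sym[OF pcong_P_0], of "slc k" "- (d ^ 2) * slc k"] slc_pint by simp
  also have "- (d ^ 2) * slc k + P ^ 2 * slc k = 4 * (of_nat (Suc k) ^ 2 * slc (Suc k))"
    unfolding shifted_legendre_coeff_Suc P_unfold by (simp add: d_def field_simps power2_eq_square)
  finally have "pcong (4 * of_nat (Suc k) ^ 2 * w (Suc k)) (4 * of_nat (Suc k) ^ 2 * slc (Suc k)) 2" by (simp only: mult.assoc)
  then show ?case using pcong_cancel[OF u] by (simp add: w_def)
qed (simp add: shifted_legendre_coeff_def)

text \<open>\<open>S 2\<close> and \<open>S 3\<close> are literally the two sums of the theorem;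
  \<open>S 0\<close> and \<open>S 1\<close> enter through a linear relation.\<close>

definition S :: "nat \<Rightarrow> rat" where
  "S j = (\<Sum>k=0..(p - 1) div 2. of_nat (k ^ j * (2 * k choose k) ^ 3) / (-8) ^ k)"

text \<open>In terms of the Legendre polynomial \<open>L\<close> of degree \<open>half\<close>, \<open>A\<close> is \<open>L(3)\<close> and \<open>B\<close> is \<open>L(3) + 8 L'(3)\<close>.\<close>

definition A :: rat where "A = (\<Sum>k\<le>half. slc k)"
definition B :: rat where "B = (\<Sum>k\<le>half. (4 * of_nat k + 1) * slc k)"

lemma A_pint: "A \<in> pint p" and B_pint: "B \<in> pint p"
  unfolding A_def B_def using slc_pint by auto

text \<open>Since (-16)^k = 2^k (-8)^k, two of the three central binomial coefficients are replaced,
  and one of them survives together with 2^k.\<close>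

lemma S_pcong: "pcong (S j) (\<Sum>k\<le>half. of_nat k ^ j * clausen_coeff half k * 2 ^ k) 2"
  unfolding S_def half_def[symmetric] atLeast0AtMost
proof (rule pcong_sum)
  fix k assume "k \<in> {..half}"
  then have "pcong (of_nat k ^ j * 2 ^ k * of_nat (2 * k choose k) * (of_nat (2 * k choose k) ^ 2 / (-16) ^ k))
     (of_nat k ^ j * 2 ^ k * of_nat (2 * k choose k) * slc k) 2"
    by (intro pcong_scale central_binomial_square_pcong) auto
  moreover have "(-16 :: rat) ^ k = 2 ^ k * (-8) ^ k" by (simp flip: power_mult_distrib)
  ultimately show "pcong (of_nat (k ^ j * (2 * k choose k) ^ 3) / (-8) ^ k) (of_nat k ^ j * clausen_coeff half k * 2 ^ k) 2"
    by (simp add: clausen_coeff_def power2_eq_square power3_eq_cube mult_ac)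
qed

text \<open>With \<open>a k\<close> the \<open>k\<close>-th term of \<open>S 0\<close>, the relation \<open>(k + 1) ^ 3 * a (k + 1) = - (2 * k + 1) ^ 3 * a k\<close>
  makes \<open>(k ^ 3 + (2 * k + 1) ^ 3) * a k\<close> telescope.\<close>

lemma S_linear_relation: "pcong (9 * S 3 + 12 * S 2 + 6 * S 1 + S 0) 0 2"
proof -
  define a :: "nat \<Rightarrow> rat" where "a k = of_nat (2 * k choose k) ^ 3 / (-8) ^ k" for k
  have rec: "of_nat (Suc k) ^ 3 * a (Suc k) = - ((2 * of_nat k + 1) ^ 3 * a k)" for k
  proof -
    have "of_nat (Suc k) ^ 3 * a (Suc k) = (of_nat (Suc k) * of_nat (2 * Suc k choose Suc k)) ^ 3 / (-8) ^ Suc k"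
      by (simp only: a_def power_mult_distrib) simp
    moreover define d :: rat where "d = 2 * of_nat k + 1"
    ultimately show ?thesis unfolding central_binomial_Suc d_def[symmetric] by (simp add: a_def power_mult_distrib)
  qed
  have tel: "(\<Sum>k\<le>n. (of_nat k ^ 3 + (2 * of_nat k + 1) ^ 3) * a k) = (2 * of_nat n + 1) ^ 3 * a n" for n
  proof (induction n)
    case (Suc n)
    have "(\<Sum>k\<le>Suc n. (of_nat k ^ 3 + (2 * of_nat k + 1) ^ 3) * a k) = 
      (2 * of_nat n + 1) ^ 3 * a n + of_nat (Suc n) ^ 3 * a (Suc n) + (2 * of_nat (Suc n) + 1) ^ 3 * a (Suc n)"
      unfolding sum.atMost_Suc Suc by (simp add: algebra_simps)
    then show ?case unfolding rec by simp
  qed simp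
  have Sa: "S j = (\<Sum>k\<le>half. of_nat k ^ j * a k)" for j
    unfolding S_def half_def[symmetric] atLeast0AtMost by (simp add: a_def)
  \<comment> \<open>The coefficients are those of k^3 + (2k + 1)^3 = 9k^3 + 12k^2 + 6k + 1.\<close>
  have "9 * S 3 + 12 * S 2 + 6 * S 1 + S 0 = (\<Sum>k\<le>half. (of_nat k ^ 3 + (2 * of_nat k + 1) ^ 3) * a k)"
    unfolding Sa sum_distrib_left sum.distrib[symmetric]
    by (intro sum.cong refl) (simp add: algebra_simps power2_eq_square power3_eq_cube)
  \<comment> \<open>At the upper end 2k + 1 equals p, so the boundary term is divisible by
    p^3.\<close>
  also have "\<dots> = P ^ 2 * (P * a half)"
    unfolding tel P_eq[symmetric] by (simp add: power2_eq_square power3_eq_cube)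
  also have "pcong \<dots> 0 2"
    unfolding a_def using punit_power[OF punit_uminus[OF punit_8]] by (intro pcong_P_0 mult_pint divide_pint) auto
  finally show ?thesis .
qed

text \<open>The moments 0, 1 and 2 come from Clausen's formula with N = (p^2 - 1)/4, which acts as
  -1/4 modulo p^2, and the third moment from \<open>S_linear_relation\<close>. Passing from
  \<open>A1\<close> to \<open>B = A + 4 * A1\<close> is what makes the mixed product
  \<open>A * B\<close> computable.\<close>

lemma S_reduction:
  "pcong (54 * S 2) (3 * B ^ 2 - 14 * (A * B) + 5 * A ^ 2) 2"
  "pcong (81 * S 3) (- (6 * B ^ 2 - 10 * (A * B) + A ^ 2)) 2"
proof -
  define A1 where "A1 = (\<Sum>k\<le>half. of_nat k * slc k)"
  have B: "B = A + 4 * A1" unfolding B_def A_def A1_def sum_distrib_left sum.distrib[symmetric]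
    by (simp add: algebra_simps)
  note cl = clausen_sums[of half, folded A_def A1_def]
  have S0: "pcong (S 0) (A ^ 2) 2" using S_pcong[of 0] cl(1) by simp
  have "pcong (3 * S 1) (3 * (\<Sum>k\<le>half. of_nat k ^ 1 * clausen_coeff half k * 2 ^ k)) 2"
    by (intro pcong_scale S_pcong) auto
  then have S1: "pcong (3 * S 1) (4 * A * A1) 2" using cl(2) by simp
  have "pcong (27 * S 2) (27 * (\<Sum>k\<le>half. of_nat k ^ 2 * clausen_coeff half k * 2 ^ k)) 2"
    by (intro pcong_scale S_pcong) auto
  also have "27 * (\<Sum>k\<le>half. of_nat k ^ 2 * clausen_coeff half k * 2 ^ k) = 24 * A1 ^ 2 - 3 * A ^ 2 - 16 * A * A1 + P ^ 2 * (3 * A ^ 2)"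
    unfolding cl(3) P_unfold by (simp add: field_simps)
  also have "pcong \<dots> (24 * A1 ^ 2 - 3 * A ^ 2 - 16 * A * A1 + 0) 2"
    using A_pint by (intro pcong_add pcong_refl pcong_P_0) auto
  finally have S2': "pcong (27 * S 2) (24 * A1 ^ 2 - 3 * A ^ 2 - 16 * A * A1) 2" by simp
  have "pcong (2 * (27 * S 2)) (2 * (24 * A1 ^ 2 - 3 * A ^ 2 - 16 * A * A1)) 2"
    by (intro pcong_scale S2') auto
  moreover have "2 * (24 * A1 ^ 2 - 3 * A ^ 2 - 16 * A * A1) = 3 * B ^ 2 - 14 * (A * B) + 5 * A ^ 2"
    unfolding B by (simp add: algebra_simps power2_eq_square)
  moreover have "2 * (27 * S 2) = 54 * S 2" by simp
  ultimately show S2: "pcong (54 * S 2) (3 * B ^ 2 - 14 * (A * B) + 5 * A ^ 2) 2" by (simp only:)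
  \<comment> \<open>The multipliers are chosen so that only 81 times the third moment remains on the
    left.\<close>
  have "pcong (9 * (9 * S 3 + 12 * S 2 + 6 * S 1 + S 0) - 2 * (54 * S 2) - 18 * (3 * S 1) - 9 * S 0)
      (9 * 0 - 2 * (3 * B ^ 2 - 14 * (A * B) + 5 * A ^ 2) - 18 * (4 * A * A1) - 9 * A ^ 2) 2"
    by (intro pcong_diff pcong_scale S2 S1 S0 S_linear_relation) auto
  moreover have "9 * (9 * S 3 + 12 * S 2 + 6 * S 1 + S 0) - 2 * (54 * S 2) - 18 * (3 * S 1) - 9 * S 0 = 81 * S 3" by simp
  moreover have "9 * 0 - 2 * (3 * B ^ 2 - 14 * (A * B) + 5 * A ^ 2) - 18 * (4 * A * A1) - 9 * A ^ 2 = - (6 * B ^ 2 - 10 * (A * B) + A ^ 2)"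
    unfolding B by (simp add: algebra_simps power2_eq_square)
  ultimately show "pcong (81 * S 3) (- (6 * B ^ 2 - 10 * (A * B) + A ^ 2)) 2" by (simp only:)
qed

text \<open>Replacing the denominator \<open>k!\<close> of the \<open>k\<close>-th coefficient by \<open>(1 + p)\<^sub>k\<close> or \<open>(1 - p)\<^sub>k\<close> turns the
  sums \<open>A\<close> and \<open>B\<close> into well-poised series at \<open>-1\<close>, summable by Kummer's theorem; the first-order
  errors of the two deformations cancel.\<close>

lemma A_deformation:
  "pcong (2 * A) ((\<Sum>k\<le>half. slc k * inverse (dn k)) + (\<Sum>k\<le>half. slc k * inverse (up k))) 2"
proof -
  have "pcong (slc k * (inverse (dn k) + inverse (up k))) (slc k * ((1 + P * harmonic k) + (1 - P * harmonic k))) 2"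
    if "k \<le> half" for k
    by (intro pcong_scale pcong_add inverse_up_pcong inverse_dn_pcong slc_pint) (use that half_less in auto)
  then have "pcong (\<Sum>k\<le>half. slc k * (inverse (dn k) + inverse (up k))) (\<Sum>k\<le>half. slc k * ((1 + P * harmonic k) + (1 - P * harmonic k))) 2"
    by (intro pcong_sum) auto
  moreover have "(\<Sum>k\<le>half. slc k * ((1 + P * harmonic k) + (1 - P * harmonic k))) = 2 * A"
    by (simp add: A_def sum_distrib_left mult.commute)
  ultimately show ?thesis by (simp add: pcong_sym distrib_left sum.distrib)
qed

text \<open>The two weights add up to 4k + 1 and differ by 2 * half + 1 = p, so the first-order
  errors combine to a multiple of p^2.\<close>

lemma B_deformation:
  "pcong B ((\<Sum>k\<le>half. (2 * of_nat k - of_nat half) * (slc k * inverse (dn k))) 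
    + (\<Sum>k\<le>half. of_nat (2 * k + half + 1) * (slc k * inverse (up k)))) 2"
proof -
  have "pcong (slc k * ((2 * of_nat k - of_nat half) * inverse (dn k) + of_nat (2 * k + half + 1) * inverse (up k))) 
      ((4 * of_nat k + 1) * slc k) 2"
    if "k \<le> half" for k
  proof -
    have h: "harmonic k \<in> pint p" using that half_less by (intro harmonic_pint) auto
    have "pcong (slc k * ((2 * of_nat k - of_nat half) * inverse (dn k) + of_nat (2 * k + half + 1) * inverse (up k))) 
      (slc k * ((2 * of_nat k - of_nat half) * (1 + P * harmonic k) + of_nat (2 * k + half + 1) * (1 - P * harmonic k))) 2"
      by (intro pcong_scale pcong_add inverse_up_pcong inverse_dn_pcong slc_pint) (use that half_less in auto)
    also have "slc k * ((2 * of_nat k - of_nat half) * (1 + P * harmonic k) + of_nat (2 * k + half + 1) * (1 - P * harmonic k)) = 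
      (4 * of_nat k + 1) * slc k - P ^ 2 * (harmonic k * slc k)"
      by (simp add: P_eq algebra_simps power2_eq_square)
    also have "pcong \<dots> ((4 * of_nat k + 1) * slc k - 0) 2"
      by (intro pcong_diff pcong_refl pcong_P_0 mult_pint h slc_pint)
    finally show ?thesis by simp
  qed
  then have "pcong (\<Sum>k\<le>half. slc k * ((2 * of_nat k - of_nat half) * inverse (dn k) + of_nat (2 * k + half + 1) * inverse (up k))) B 2"
    unfolding B_def by (intro pcong_sum) auto
  then show ?thesis by (simp add: pcong_sym distrib_left sum.distrib mult_ac)
qed

section \<open>Closed forms of the deformed sums\<close>

lemma slc_up:
  "slc k * inverse (up k) = of_nat (half choose k) * (fact (half + k) / fact half) / (fact (2 * half + 1 + k) / fact (2 * half + 1))"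
proof -
  have "(of_nat (half + k choose k) :: rat) = fact (half + k) / (fact k * fact half)"
    using binomial_fact[of k "half + k"] by simp
  then show ?thesis unfolding shifted_legendre_coeff_def up_eq p_eq[symmetric]
    by (simp del: fact_Suc)
qed

text \<open>The reflection formula for (p - 1)! turns the quotient of \<open>half choose k\<close>
  by \<open>dn k\<close> into a signed quotient of binomial coefficients, which gives the sum the
  shape of a convolution.\<close>

lemma slc_dn:
  assumes "k \<le> half"
  shows "slc k * inverse (dn k) = (-1) ^ k * of_nat (half + k choose k) * of_nat (2 * half - k choose (half - k)) / of_nat (2 * half choose half)"
proof -
  have c1: "(of_nat (half choose k) :: rat) = fact half / (fact k * fact (half - k))"
    using binomial_fact[OF assms] by simp
  have c2: "(of_nat (2 * half - k choose (half - k)) :: rat) = fact (2 * half - k) / (fact (half - k) * fact half)"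
    using binomial_fact[where ?'a = rat and k = "half - k" and n = "2 * half - k"] assms by simp
  have c3: "(of_nat (2 * half choose half) :: rat) = fact (2 * half) / (fact half * fact half)"
    using binomial_fact[of half "2 * half"] by simp
  have "k < p" using assms half_less by simp
  then have "dn k \<noteq> 0" using punit_dn punitD(1) by blast
  \<comment> \<open>Stating the cancellation for arbitrary nonzero values keeps
    \<open>field_simps\<close> away from the factorials.\<close>
  have gen: "x / (y * z) * b * inverse d = s * b * (w / (z * x)) / (w * s * y * d / (x * x))"
    if "x \<noteq> 0" "y \<noteq> 0" "z \<noteq> 0" "w \<noteq> 0" "s \<noteq> 0" "d \<noteq> 0" for x y z b d s w :: rat
    using that by (simp add: field_simps)
  have f: "fact (2 * half) = fact (2 * half - k) * (-1) ^ k * fact k * dn k"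
    using assms by (intro fact_eq_dn) auto
  show ?thesis unfolding shifted_legendre_coeff_def c1 c2 c3 f
    by (rule gen) (use \<open>dn k \<noteq> 0\<close> in simp_all)
qed

text \<open>The factor p comes from (2 * half + 1)! = p!. The denominator cancels it exactly when
  \<open>half\<close> is even, for then p is its middle factor.\<close>

lemma sum_slc_up:
  "(\<Sum>k\<le>half. slc k * inverse (up k)) = P * fact (2 * half) / fact half * 2 ^ half / (\<Prod>i\<le>half. of_nat (half + 1 + 2 * i))"
proof -
  have "fact (2 * half + 1) = P * fact (2 * half)" by (simp add: P_eq)
  then show ?thesis using rising_sum[of half] unfolding slc_up by simp
qed

text \<open>Here the denominator contains p exactly when \<open>half\<close> is odd.\<close>

lemma sum_slc_up_weighted:
  "(\<Sum>k\<le>half. of_nat (2 * k + half + 1) * (slc k * inverse (up k))) = 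
     P * fact (2 * half) / fact half * 2 ^ half / (\<Prod>i<half. of_nat (half + 2 + 2 * i))"
proof -
  have "fact (2 * half + 1) = P * fact (2 * half)" by (simp add: P_eq)
  moreover have "(\<Sum>k\<le>half. of_nat (2 * k + half + 1) * (slc k * inverse (up k))) = 
     fact (2 * half + 1) / fact half * 2 ^ half / (\<Prod>i<half. of_nat (half + 2 + 2 * i))"
    unfolding slc_up rising_sum_weighted[OF less_trans[OF zero_less_one half_gt_1], symmetric]
    by (simp add: mult_ac)
  ultimately show ?thesis by simp
qed

text \<open>The plain convolution vanishes for odd \<open>half\<close>, the weighted one for even
  \<open>half\<close>. Thus the parity of \<open>half\<close> decides which of \<open>A\<close> and
  \<open>B\<close> is divisible by p.\<close>

lemma sum_slc_dn:
  "(\<Sum>k\<le>half. slc k * inverse (dn k)) = 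
    (if even half then of_nat (half + half div 2 choose (half div 2)) / of_nat (2 * half choose half) else 0)"
proof -
  have "(\<Sum>k\<le>half. slc k * inverse (dn k)) = 
    (\<Sum>k\<le>half. (-1) ^ k * of_nat (Suc half + k - 1 choose k) * of_nat (Suc half + (half - k) - 1 choose (half - k))) / of_nat (2 * half choose half)"
    unfolding sum_divide_distrib by (intro sum.cong refl) (simp add: slc_dn mult_2)
  then show ?thesis unfolding alternating_convolution[OF zero_less_Suc] by simp
qed

lemma sum_slc_dn_weighted:
  "(\<Sum>k\<le>half. (2 * of_nat k - of_nat half) * (slc k * inverse (dn k))) = 
    (if even half then 0 else - 2 * of_nat (half + 1) * of_nat (half + 1 + half div 2 choose (half div 2)) / of_nat (2 * half choose half))"
proof -
  obtain i where i: "half = Suc i" using half_gt_1 by (cases half) auto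
  have "(\<Sum>k\<le>half. (2 * of_nat k - of_nat half) * (slc k * inverse (dn k))) = 
    (\<Sum>k\<le>half. (2 * of_nat k - of_nat half) * (-1) ^ k * of_nat (Suc half + k - 1 choose k) * of_nat (Suc half + (half - k) - 1 choose (half - k))) / of_nat (2 * half choose half)"
    unfolding sum_divide_distrib
  proof (intro sum.cong refl)
    fix k assume "k \<in> {..half}"
    then have e: "2 * half - k = Suc half + (half - k) - 1" "half + k = Suc half + k - 1" and "k \<le> half" by auto
    from slc_dn[OF this(3)] show "(2 * of_nat k - of_nat half) * (slc k * inverse (dn k)) =
      (2 * of_nat k - of_nat half) * (-1) ^ k * of_nat (Suc half + k - 1 choose k) * 
        of_nat (Suc half + (half - k) - 1 choose (half - k)) / of_nat (2 * half choose half)"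
      unfolding e by (simp only: times_divide_eq_right mult.assoc)
  qed
  also have "(\<Sum>k\<le>half. (2 * of_nat k - of_nat half) * (-1) ^ k * of_nat (Suc half + k - 1 choose k) * of_nat (Suc half + (half - k) - 1 choose (half - k))) =
    (if even i then - 2 * of_nat (Suc half) * of_nat (Suc half + i div 2 choose (i div 2)) else (0 :: rat))"
    using alternating_convolution_weighted[of "Suc half" i, OF zero_less_Suc] unfolding i[symmetric] .
  finally have *: "(\<Sum>k\<le>half. (2 * of_nat k - of_nat half) * (slc k * inverse (dn k))) = 
    (if even i then - 2 * of_nat (Suc half) * of_nat (Suc half + i div 2 choose (i div 2)) else 0) / of_nat (2 * half choose half)" .
  \<comment> \<open>The weighted convolution is stated at the index \<open>Suc i\<close>, so
    \<open>i\<close> and \<open>half\<close> have opposite parity.\<close>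
  have "even i \<longleftrightarrow> odd half" "odd half \<Longrightarrow> i div 2 = half div 2" using i by auto
  then show ?thesis unfolding * Suc_eq_plus1 by (cases "even half") (simp_all only: if_True if_False not_True_eq_False not_False_eq_True div_0)
qed

text \<open>The product of 1 - p^2 / (4 j^2), by which the product of p^2 - 4 j^2 deviates from that
  of -4 j^2. One factor \<open>P\<close> stays outside to fit the pattern
  \<open>1 + P * c\<close>.\<close>

definition Qprod :: "nat \<Rightarrow> rat" where "Qprod m = (\<Prod>j=1..m. 1 + P * (P * - (1 / (4 * of_nat j ^ 2))))"

lemma inv_4_square_pint: "0 < j \<Longrightarrow> j < p \<Longrightarrow> 1 / (4 * of_nat j ^ 2) \<in> pint p"
  by (intro divide_pint punit_mult punit_4 punit_power punit_of_nat_less) auto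

lemma punit_Qprod: "m < p \<Longrightarrow> punit (Qprod m)"
  unfolding Qprod_def by (intro punit_prod punit_one_plus mult_pint uminus_pint inv_4_square_pint) auto

lemma Qprod_pcong: "m < p \<Longrightarrow> pcong (Qprod m) 1 2"
proof -
  assume m: "m < p"
  have "pcong (Qprod m) (\<Prod>j=1..m. 1) 2"
    unfolding Qprod_def
  proof (rule pcong_prod)
    fix j assume "j \<in> {1..m}"
    then have "- (1 / (4 * of_nat j ^ 2)) \<in> pint p" using m by (intro uminus_pint inv_4_square_pint) auto
    from pcong_add[OF pcong_refl[of 1 2] pcong_P_0[OF this, of 2]]
    show "pcong (1 + P * (P * - (1 / (4 * of_nat j ^ 2)))) 1 2" by (simp add: power2_eq_square mult.assoc)
  qed auto
  then show ?thesis by simp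
qed

lemma inverse_Qprod_pcong: "m < p \<Longrightarrow> pcong (inverse (Qprod m)) 1 2"
  using pcong_inverse[OF Qprod_pcong punit_Qprod, of m] by simp

text \<open>Isolates the middle factor p; everything else is prime to p if m < p.\<close>

lemma prod_centered_P:
  "(\<Prod>i\<le>2 * m. P + 2 * of_nat i - 2 * of_nat m) = P * (-4) ^ m * fact m ^ 2 * Qprod m"
proof -
  have "(\<Prod>j=1..m. P ^ 2 - 4 * of_nat j ^ 2) = (-4) ^ m * fact m ^ 2 * Qprod m"
  proof (induction m)
    case (Suc m)
    have "P ^ 2 - 4 * of_nat (Suc m) ^ 2 = (-4) * of_nat (Suc m) ^ 2 * (1 + P * (P * - (1 / (4 * of_nat (Suc m) ^ 2))))"
      by (simp add: field_simps power2_eq_square del: of_nat_Suc)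
    then have "(\<Prod>j=1..Suc m. P ^ 2 - 4 * of_nat j ^ 2) = 
      (-4) ^ m * fact m ^ 2 * Qprod m * ((-4) * of_nat (Suc m) ^ 2 * (1 + P * (P * - (1 / (4 * of_nat (Suc m) ^ 2)))))"
      using Suc by simp
    also have "\<dots> = (-4) ^ Suc m * fact (Suc m) ^ 2 * (Qprod m * (1 + P * (P * - (1 / (4 * of_nat (Suc m) ^ 2)))))"
      by (simp only: fact_Suc power_Suc power_mult_distrib mult_ac of_nat_mult)
    also have "Qprod m * (1 + P * (P * - (1 / (4 * of_nat (Suc m) ^ 2)))) = Qprod (Suc m)"
      by (simp add: Qprod_def)
    finally show ?case .
  qed (simp add: Qprod_def)
  then show ?thesis unfolding prod_arith_progression_centered by simp
qed

section \<open>The values of A and B modulo p^2\<close>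

lemma binomial_mid: "(of_nat (2 * k choose k) :: rat) = fact (2 * k) / (fact k * fact k)"
  using binomial_fact[where ?'a = rat and k = k and n = "2 * k"] by simp

lemma dn_inverse_Qprod_pcong: "k < p \<Longrightarrow> m < p \<Longrightarrow> pcong (dn k * inverse (Qprod m)) (1 - P * harmonic k) 2"
  using pcong_mult[OF dn_pcong inverse_Qprod_pcong, of k m] punitD(2)[OF punit_dn] by simp

lemma sign_square: "((-1) ^ k * (-1) ^ k :: rat) = 1"
  by (simp flip: power_mult_distrib)

text \<open>For p = 4m + 1 both deformed series of \<open>A\<close> equal (-1)^m \<open>b\<close> up
  to factors that are 1 modulo p, and their first-order terms average to -ph/2. For \<open>B\<close>
  the convolution vanishes and the other series is p times (-1)^m / \<open>b\<close> up to such a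
  factor, so \<open>b\<close> cancels in the product.\<close>

lemma A_B_even:
  assumes m: "half = 2 * m"
  defines "b \<equiv> of_nat (2 * m choose m)" and "h \<equiv> harmonic (2 * m) - harmonic m"
  shows "pcong (A * B) P 2" "pcong (B ^ 2) 0 2" "pcong (A ^ 2) (b ^ 2 * (1 - P * h)) 2"
proof -
  define e :: rat where "e = (-1) ^ m"
  have e: "e * e = 1" "e \<noteq> 0" by (simp_all add: e_def sign_square)
  have mp: "m < p" "2 * m < p" using half_less m by auto
  have h: "h \<in> pint p" unfolding h_def using mp by (intro diff_pint harmonic_pint)
  have b: "b = fact (2 * m) / (fact m * fact m)" unfolding b_def by (rule binomial_mid)
  have bu: "punit b" unfolding b using mp by (intro punit_divide punit_mult punit_fact)
  have nz: "dn m \<noteq> 0" "dn (2 * m) \<noteq> 0" "Qprod m \<noteq> 0" "P \<noteq> 0"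
    using punit_dn punit_Qprod mp punitD(1) p_gt_3 by auto
  have eu: "punit e" unfolding e_def by (intro punit_power punit_uminus punit_1)
  have pi: "e \<in> pint p" "b \<in> pint p" "inverse b \<in> pint p" using punitD[OF bu] punitD[OF eu] by auto
  \<comment> \<open>Reflection at k = m and at k = 2m gives two expressions for (p - 1)!; each
    closed form below uses the one whose factorials cancel.\<close>
  have f1: "fact (2 * half) = fact (3 * m) * e * fact m * dn m"
    using fact_eq_dn[of m] m by (simp add: e_def)
  have f2: "fact (2 * half) = fact (2 * m) * fact (2 * m) * dn (2 * m)"
    using fact_eq_dn[of half] m by simp
  have V2: "(\<Sum>k\<le>half. slc k * inverse (dn k)) = e * b * inverse (dn m)"
  proof -
    have "(of_nat (half + half div 2 choose (half div 2)) :: rat) = fact (3 * m) / (fact m * fact (2 * m))"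
      using binomial_fact[where ?'a = rat and k = m and n = "3 * m"] m by simp
    moreover have "(of_nat (2 * half choose half) :: rat) = fact (3 * m) * e * fact m * dn m / (fact (2 * m) * fact (2 * m))"
      unfolding binomial_mid f1 by (simp add: m)
    moreover have "x / (y * z) / (x * e * y * d / (z * z)) = e * (z / (y * y)) * inverse d"
      if "x \<noteq> 0" "y \<noteq> 0" "z \<noteq> 0" "d \<noteq> 0" for x y z d :: rat
    proof -
      have "x / (y * z) / (x * e * y * d / (z * z)) = (e * e) * z / (y * y * d * e)" using that e by (simp add: field_simps)
      also have "\<dots> = e * (z / (y * y)) * inverse d" using that e(2) by (simp add: field_simps)
      finally show ?thesis .
    qed
    ultimately show ?thesis unfolding sum_slc_dn b using m nz by (simp del: fact_Suc)
  qed
  have V4: "(\<Sum>k\<le>half. slc k * inverse (up k)) = e * b * (dn (2 * m) * inverse (Qprod m))"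
  proof -
    \<comment> \<open>The progression from 2m + 1 to 6m + 1 is centred at 4m + 1 = p.\<close>
    have "(\<Prod>i\<le>half. of_nat (half + 1 + 2 * i)) = (\<Prod>i\<le>2 * m. P + 2 * of_nat i - 2 * of_nat m)"
      unfolding P_eq m by (intro prod.cong refl) simp
    also have "\<dots> = P * (e * 4 ^ m) * fact m ^ 2 * Qprod m"
    proof -
      have "(-4 :: rat) ^ m = e * 4 ^ m" unfolding e_def by (simp flip: power_mult_distrib)
      then show ?thesis unfolding prod_centered_P by simp
    qed
    finally have "(\<Sum>k\<le>half. slc k * inverse (up k)) = 
      P * (fact (2 * m) * fact (2 * m) * dn (2 * m)) / fact (2 * m) * 4 ^ m / (P * (e * 4 ^ m) * fact m ^ 2 * Qprod m)"
      unfolding sum_slc_up f2 by (simp add: m power_mult)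
    also have "\<dots> = (e * e) * fact (2 * m) * dn (2 * m) / (e * (fact m * fact m) * Qprod m)"
      using nz e by (simp add: power2_eq_square)
    also have "\<dots> = e * b * (dn (2 * m) * inverse (Qprod m))"
      unfolding b using e(2) by (simp add: field_simps)
    finally show ?thesis .
  qed
  have "pcong (2 * A) (e * b * inverse (dn m) + e * b * (dn (2 * m) * inverse (Qprod m))) 2"
    using A_deformation unfolding V2 V4 .
  also have "pcong (e * b * inverse (dn m) + e * b * (dn (2 * m) * inverse (Qprod m))) 
      (e * b * (1 + P * harmonic m) + e * b * (1 - P * harmonic (2 * m))) 2"
    using pi mp bu eu by (intro pcong_add pcong_scale inverse_dn_pcong dn_inverse_Qprod_pcong mult_pint) auto
  also have "e * b * (1 + P * harmonic m) + e * b * (1 - P * harmonic (2 * m)) = e * b * (2 - P * h)"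
    by (simp add: h_def algebra_simps)
  finally have A2: "pcong (2 * A) (e * b * (2 - P * h)) 2" .
  have "pcong ((2 * A) ^ 2) ((e * b * (2 - P * h)) ^ 2) 2"
    using pi bu eu h by (intro pcong_power A2 mult_pint diff_pint) auto
  also have "(e * b * (2 - P * h)) ^ 2 = (e * e) * (4 * (b ^ 2 * (1 - P * h)) + P ^ 2 * (b ^ 2 * h ^ 2))"
    by (simp add: algebra_simps power2_eq_square)
  also have "\<dots> = 4 * (b ^ 2 * (1 - P * h)) + P ^ 2 * (b ^ 2 * h ^ 2)" using e by simp
  also have "pcong \<dots> (4 * (b ^ 2 * (1 - P * h)) + 0) 2"
    using pi bu h by (intro pcong_add pcong_refl pcong_P_0 mult_pint power_pint) auto
  finally have "pcong (4 * A ^ 2) (4 * (b ^ 2 * (1 - P * h))) 2" by (simp add: power_mult_distrib)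
  then show "pcong (A ^ 2) (b ^ 2 * (1 - P * h)) 2" by (rule pcong_cancel[OF punit_4])
  have W4: "(\<Sum>k\<le>half. of_nat (2 * k + half + 1) * (slc k * inverse (up k))) = P * (e * inverse b * dn m)"
  proof -
    have "(\<Prod>i<half. of_nat (half + 2 + 2 * i)) = (2 ^ half * fact (3 * m) / fact m :: rat)"
      using prod_even_shift[of m half] by (simp add: m)
    then have "(\<Sum>k\<le>half. of_nat (2 * k + half + 1) * (slc k * inverse (up k))) = 
      P * (fact (3 * m) * e * fact m * dn m) / fact (2 * m) * 2 ^ half / (2 ^ half * fact (3 * m) / fact m)"
      unfolding sum_slc_up_weighted f1 by (simp add: m)
    then show ?thesis unfolding b by (simp add: field_simps)
  qed
  have "pcong B (P * (e * inverse b * dn m)) 2"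
    using B_deformation unfolding W4 sum_slc_dn_weighted using m by simp
  \<comment> \<open>Because of the explicit factor p, it is enough that \<open>dn m\<close> is 1
    modulo p.\<close>
  also have "pcong (P * (e * inverse b * dn m)) (P * (e * inverse b * 1)) 2"
    using pi mp bu eu by (intro pcong_lift pcong_scale dn_pcong_1 mult_pint) auto
  finally have B2: "pcong B (P * (e * inverse b)) 2" by simp
  have "pcong (B ^ 2) ((P * (e * inverse b)) ^ 2) 2"
    using pi bu eu by (intro pcong_power B2 mult_pint) auto
  also have "(P * (e * inverse b)) ^ 2 = P ^ 2 * (e * inverse b) ^ 2" by (simp add: power_mult_distrib)
  also have "pcong \<dots> 0 2" using pi bu eu by (intro pcong_P_0 power_pint mult_pint) auto
  finally show "pcong (B ^ 2) 0 2" .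
  have "pcong (2 * A * B) (e * b * (2 - P * h) * (P * (e * inverse b))) 2"
    using pi bu eu A_pint by (intro pcong_mult A2 B2 mult_pint) auto
  also have "e * b * (2 - P * h) * (P * (e * inverse b)) = (e * e) * (b * inverse b) * (2 * P - P ^ 2 * h)"
    by (simp add: algebra_simps power2_eq_square)
  also have "\<dots> = 2 * P - P ^ 2 * h" using e punitD(1)[OF bu] by simp
  also have "pcong \<dots> (2 * P - 0) 2" by (intro pcong_diff pcong_refl pcong_P_0 h)
  finally have "pcong (2 * (A * B)) (2 * P) 2" by (simp add: mult.assoc)
  then show "pcong (A * B) P 2" by (rule pcong_cancel[OF punit_2])
qed

text \<open>For p = 4j + 3 the roles are exchanged: \<open>A\<close> keeps only the series with the
  factor p, while both series of \<open>B\<close> survive and equal -2 (-1)^j \<open>M\<close> up to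
  factors that are 1 modulo p.\<close>

lemma A_B_odd:
  assumes j: "half = 2 * j + 1"
  defines "c \<equiv> of_nat (half choose j)" and "h \<equiv> harmonic half - harmonic j"
  shows "pcong (A * B) (- P) 2" "pcong (A ^ 2) 0 2" "pcong (B ^ 2) ((1 + 2 * P - P * h) * c ^ 2) 2"
proof -
  define e :: rat where "e = (-1) ^ j"
  define M :: rat where "M = fact half / (fact j * fact j)"
  have e: "e * e = 1" "e \<noteq> 0" by (simp_all add: e_def sign_square)
  have jp: "j < p" "half < p" using half_less j by auto
  have h: "h \<in> pint p" unfolding h_def using jp by (intro diff_pint harmonic_pint)
  have Mu: "punit M" unfolding M_def using jp by (intro punit_divide punit_mult punit_fact)
  have nz: "dn j \<noteq> 0" "dn half \<noteq> 0" "Qprod j \<noteq> 0" "P \<noteq> 0"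
    using punit_dn punit_Qprod jp punitD(1) p_gt_3 by auto
  have eu: "punit e" unfolding e_def by (intro punit_power punit_uminus punit_1)
  have "punit (2 * M)" using Mu punit_2 by auto
  then have pi: "e \<in> pint p" "M \<in> pint p" "inverse (2 * M) \<in> pint p" using punitD Mu eu by blast+
  have "2 * half - j = half + 1 + j" using j by simp
  then have f1: "fact (2 * half) = fact (half + 1 + j) * e * fact j * dn j"
    using fact_eq_dn[of j] j by (simp add: e_def)
  have f2: "fact (2 * half) = - (fact half * fact half * dn half)"
    using fact_eq_dn[of half] j by simp
  have V4: "(\<Sum>k\<le>half. slc k * inverse (up k)) = P * (e * inverse (2 * M) * dn j)"
  proof -
    have "(\<Prod>i\<le>half. of_nat (half + 1 + 2 * i)) = (\<Prod>i<Suc half. of_nat (2 * j + 2 + 2 * i) :: rat)"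
      unfolding lessThan_Suc_atMost by (simp add: j)
    also have "\<dots> = 2 ^ Suc half * fact (half + 1 + j) / fact j"
      unfolding prod_even_shift by (simp add: add_ac)
    finally have "(\<Sum>k\<le>half. slc k * inverse (up k)) = 
      P * (fact (half + 1 + j) * e * fact j * dn j) / fact half * 2 ^ half / (2 ^ Suc half * fact (half + 1 + j) / fact j)"
      unfolding sum_slc_up f1 by simp
    also have "\<dots> = P * (e * inverse (2 * M) * dn j)"
    proof -
      have gen: "q * (x * e * y * d) / z * w / (2 * w * x / y) = q * (e * inverse (2 * (z / (y * y))) * d)"
        if "x \<noteq> 0" "y \<noteq> 0" "z \<noteq> 0" "w \<noteq> 0" for q x y z w d :: rat
        using that by (simp add: field_simps)
      show ?thesis unfolding M_def power_Suc by (rule gen) simp_all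
    qed
    finally show ?thesis .
  qed
  have "pcong (2 * A) (P * (e * inverse (2 * M) * dn j)) 2"
    using A_deformation unfolding V4 sum_slc_dn using j by simp
  also have "pcong (P * (e * inverse (2 * M) * dn j)) (P * (e * inverse (2 * M) * 1)) 2"
    using pi jp Mu eu by (intro pcong_lift pcong_scale dn_pcong_1 mult_pint) auto
  finally have A2: "pcong (2 * A) (P * (e * inverse (2 * M))) 2" by simp
  have "pcong ((2 * A) ^ 2) ((P * (e * inverse (2 * M))) ^ 2) 2"
    using pi Mu eu by (intro pcong_power A2 mult_pint) auto
  also have "(P * (e * inverse (2 * M))) ^ 2 = P ^ 2 * (e * inverse (2 * M)) ^ 2" by (simp only: power_mult_distrib)
  also have "pcong \<dots> 0 2" using pi Mu eu by (intro pcong_P_0 power_pint mult_pint) auto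
  finally have "pcong (4 * A ^ 2) (4 * 0) 2" by (simp add: power_mult_distrib)
  then show "pcong (A ^ 2) 0 2" by (rule pcong_cancel[OF punit_4])
  have W2: "(\<Sum>k\<le>half. (2 * of_nat k - of_nat half) * (slc k * inverse (dn k))) = - 2 * e * M * inverse (dn j)"
  proof -
    have "(of_nat (half + 1 + half div 2 choose (half div 2)) :: rat) = fact (half + 1 + j) / (fact j * (of_nat (half + 1) * fact half))"
      using binomial_fact[where ?'a = rat and k = j and n = "half + 1 + j"] j by (simp add: mult_ac)
    moreover have "(of_nat (2 * half choose half) :: rat) = fact (half + 1 + j) * e * fact j * dn j / (fact half * fact half)"
      unfolding binomial_mid f1 by simp
    moreover have "- 2 * n * (x / (y * (n * z))) / (x * e * y * d / (z * z)) = - 2 * e * (z / (y * y)) * inverse d"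
      if "x \<noteq> 0" "y \<noteq> 0" "z \<noteq> 0" "d \<noteq> 0" "n \<noteq> 0" for x y z d n :: rat
    proof -
      have "- 2 * n * (x / (y * (n * z))) / (x * e * y * d / (z * z)) = - 2 * (e * e) * z / (y * y * d * e)" using that e by (simp add: field_simps)
      also have "\<dots> = - 2 * e * (z / (y * y)) * inverse d" using that e(2) by (simp add: field_simps)
      finally show ?thesis .
    qed
    ultimately show ?thesis unfolding sum_slc_dn_weighted M_def using j nz by (simp del: fact_Suc of_nat_add of_nat_Suc)
  qed
  have W4: "(\<Sum>k\<le>half. of_nat (2 * k + half + 1) * (slc k * inverse (up k))) = - 2 * e * M * (dn half * inverse (Qprod j))"
  proof -
    have "(\<Prod>i<half. of_nat (half + 2 + 2 * i)) = (\<Prod>i\<le>2 * j. P + 2 * of_nat i - 2 * of_nat j)"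
      unfolding P_eq j by (intro prod.cong) auto
    also have "\<dots> = P * (e * 4 ^ j) * fact j ^ 2 * Qprod j"
    proof -
      have "(-4 :: rat) ^ j = e * 4 ^ j" unfolding e_def by (simp flip: power_mult_distrib)
      then show ?thesis unfolding prod_centered_P by simp
    qed
    finally have P1: "(\<Prod>i<half. of_nat (half + 2 + 2 * i)) = P * (e * 4 ^ j) * fact j ^ 2 * Qprod j" .
    have P2: "(2 :: rat) ^ half = 2 * 4 ^ j" by (simp add: j power_mult)
    have "(\<Sum>k\<le>half. of_nat (2 * k + half + 1) * (slc k * inverse (up k))) = 
      P * (- (fact half * fact half * dn half)) / fact half * (2 * 4 ^ j) / (P * (e * 4 ^ j) * fact j ^ 2 * Qprod j)"
      unfolding sum_slc_up_weighted f2 P1 P2 ..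
    also have "\<dots> = - 2 * (e * e) * fact half * dn half / (e * (fact j * fact j) * Qprod j)"
      using nz e by (simp add: power2_eq_square mult_ac)
    also have "\<dots> = - 2 * e * M * (dn half * inverse (Qprod j))"
      unfolding M_def using e(2) by (simp add: field_simps)
    finally show ?thesis .
  qed
  have "pcong B (- 2 * e * M * inverse (dn j) + - 2 * e * M * (dn half * inverse (Qprod j))) 2"
    using B_deformation unfolding W2 W4 .
  also have "pcong (- 2 * e * M * inverse (dn j) + - 2 * e * M * (dn half * inverse (Qprod j))) 
      (- 2 * e * M * (1 + P * harmonic j) + - 2 * e * M * (1 - P * harmonic half)) 2"
    using pi jp Mu eu by (intro pcong_add pcong_scale inverse_dn_pcong dn_inverse_Qprod_pcong mult_pint) auto
  also have "- 2 * e * M * (1 + P * harmonic j) + - 2 * e * M * (1 - P * harmonic half) = - 2 * e * M * (2 - P * h)"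
    by (simp add: h_def algebra_simps)
  finally have B2: "pcong B (- 2 * e * M * (2 - P * h)) 2" .
  have "pcong (B ^ 2) ((- 2 * e * M * (2 - P * h)) ^ 2) 2"
    using pi Mu eu h by (intro pcong_power B2 mult_pint diff_pint) auto
  also have "(- 2 * e * M * (2 - P * h)) ^ 2 = (e * e) * ((4 * M) ^ 2 * (1 - P * h) + P ^ 2 * (4 * M ^ 2 * h ^ 2))"
    by (simp add: algebra_simps power2_eq_square)
  \<comment> \<open>From half!/(j!)^2 = (j + 1) \<open>c\<close> and p + 1 = 4(j + 1). The square of
    p + 1 is the source of the term 2p in the result.\<close>
  also have "4 * M = (P + 1) * c"
  proof -
    have "c = fact half / (fact j * (of_nat (j + 1) * fact j))"
      unfolding c_def using binomial_fact[where ?'a = rat and k = j and n = half] j by (simp add: mult_ac)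
    moreover have "P + 1 = 4 * of_nat (j + 1)" unfolding P_eq j by simp
    ultimately show ?thesis unfolding M_def by (simp add: field_simps del: of_nat_add of_nat_Suc)
  qed
  also have "e * e * (((P + 1) * c) ^ 2 * (1 - P * h) + P ^ 2 * (4 * M ^ 2 * h ^ 2)) = 
    (1 + 2 * P - P * h) * c ^ 2 + P ^ 2 * (4 * M ^ 2 * h ^ 2 + c ^ 2 * (1 - 2 * h - P * h))"
    unfolding e by (simp add: algebra_simps power2_eq_square)
  also have "pcong \<dots> ((1 + 2 * P - P * h) * c ^ 2 + 0) 2"
    using pi Mu h unfolding c_def by (intro pcong_add pcong_refl pcong_P_0 add_pint mult_pint power_pint diff_pint) auto
  finally show "pcong (B ^ 2) ((1 + 2 * P - P * h) * c ^ 2) 2" by simp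
  have "pcong (2 * A * B) (P * (e * inverse (2 * M)) * (- 2 * e * M * (2 - P * h))) 2"
    using pi Mu eu h A_pint by (intro pcong_mult A2 B2 mult_pint diff_pint) auto
  also have "P * (e * inverse (2 * M)) * (- 2 * e * M * (2 - P * h)) = - (e * e) * (2 * P - P ^ 2 * h)"
    using punitD(1)[OF Mu] by (simp add: field_simps power2_eq_square)
  also have "\<dots> = - 2 * P + P ^ 2 * h" unfolding e by simp
  also have "pcong \<dots> (- 2 * P + 0) 2" by (intro pcong_add pcong_refl pcong_P_0 h)
  finally have "pcong (2 * (A * B)) (2 * (- P)) 2" by (simp add: mult.assoc)
  then show "pcong (A * B) (- P) 2" by (rule pcong_cancel[OF punit_2])
qed

section \<open>The Fermat quotient of 2\<close>

lemma alternating_harmonic: "(\<Sum>k=1..n. (-1) ^ (k - 1) / of_nat k) = harmonic n - harmonic (n div 2)"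
proof (induction n)
  case (Suc n)
  show ?case
  proof (cases "even n")
    case True
    then have "Suc n div 2 = n div 2" by simp
    then show ?thesis using Suc True by simp
  next
    case False
    then have d: "Suc n div 2 = Suc (n div 2)" "Suc n = 2 * Suc (n div 2)" by presburger+
    have "harmonic (Suc n) - harmonic (Suc n div 2) = harmonic n - harmonic (n div 2) + (1 / of_nat (Suc n) - 1 / of_nat (Suc (n div 2)))"
      unfolding d(1) by (simp del: of_nat_Suc)
    also have "(1 / of_nat (Suc n) - 1 / of_nat (Suc (n div 2)) :: rat) = - 1 / of_nat (Suc n)"
      unfolding d(2) of_nat_mult by (simp add: field_simps del: of_nat_Suc)
    finally show ?thesis using Suc False by (simp del: of_nat_Suc)
  qed
qed simp

text \<open>Expand 2^p by binomial coefficients: modulo p^2 the k-th one is p (-1)^(k - 1) / k.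
  These terms are symmetric under k -> p - k modulo p, so the sum is twice its lower half, an
  alternating harmonic sum.\<close>

lemma two_power_pcong: "pcong (2 ^ (p - 1)) (1 + P * (harmonic half - harmonic (half div 2))) 2"
proof -
  have bd: "2 * half < p" "p \<le> 2 * half + 1" using p_eq by linarith+
  define t :: "nat \<Rightarrow> rat" where "t k = (-1) ^ (k - 1) / of_nat k" for k
  have t_pint: "t k \<in> pint p" if "0 < k" "k < p" for k
    unfolding t_def using that by (intro divide_pint punit_of_nat_less power_pint uminus_pint) auto
  have binom: "pcong (of_nat (p choose k)) (P * t k) 2" if "k \<in> {1..2 * half}" for k
  proof -
    obtain i where i: "k = Suc i" "i < 2 * half" using \<open>k \<in> _\<close> by (cases k) auto
    have ip: "i < p" "Suc i < p" using i bd by auto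
    have "Suc (2 * half) = p" using bd by linarith
    with Suc_times_binomial_eq[of "2 * half" i] have "k * (p choose k) = p * (2 * half choose i)"
      unfolding i by (simp only: mult.commute)
    then have "of_nat (k * (p choose k)) = (of_nat (p * (2 * half choose i)) :: rat)" by (rule arg_cong)
    moreover have "(of_nat (2 * half choose i) :: rat) = (-1) ^ i * dn i"
    proof -
      have "(of_nat (2 * half choose i) :: rat) = fact (2 * half) / (fact i * fact (2 * half - i))"
        using i by (intro binomial_fact) simp
      also have "fact (2 * half) = fact (2 * half - i) * (-1) ^ i * fact i * dn i"
        using i by (intro fact_eq_dn) simp
      finally show ?thesis by simp
    qed
    ultimately have *: "of_nat k * of_nat (p choose k) = P * ((-1) ^ i * dn i)" by (simp only: of_nat_mult)
    have "of_nat (p choose k) = of_nat k * of_nat (p choose k) / (of_nat k :: rat)" using i by simp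
    also have "\<dots> = P * (t k * dn i)" unfolding * by (simp add: t_def i(1))
    finally have "of_nat (p choose k) = P * (t k * dn i)" .
    moreover have "pcong (P * (t k * dn i)) (P * (t k * 1)) 2"
      using ip i by (intro pcong_lift pcong_scale dn_pcong_1 t_pint) auto
    ultimately show ?thesis by simp
  qed
  \<comment> \<open>Replacing k by p - k changes the parity, as p is odd, and also the sign of 1/k
    modulo p; the two signs cancel.\<close>
  have mirror: "pcong (t (p - k)) (t k) 1" if "k \<in> {1..half}" for k
  proof -
    have k: "0 < k" "k < p" "p - k < p" "0 < p - k" using that half_less by auto
    have "p - 1 = (p - k - 1) + k" using k by simp
    moreover have "even (p - 1)" using odd_p by simp
    ultimately have "even (p - k - 1) = even k" by (metis even_add)
    then have s: "((-1) ^ (p - k - 1) :: rat) = (-1) ^ k" by (simp add: uminus_power_if)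
    have s': "((-1) ^ k :: rat) = - ((-1) ^ (k - 1))" using k by (cases k) auto
    have "pcong (of_nat k * of_nat (p - k) * t (p - k)) (of_nat k * of_nat (p - k) * t k) 1"
    proof -
      have "of_nat k * of_nat (p - k) * t (p - k) = of_nat k * (-1) ^ k"
        unfolding t_def s using k by (simp add: field_simps)
      moreover have "of_nat k * of_nat (p - k) * t k = of_nat k * (-1) ^ k + P * (-1) ^ (k - 1)"
        unfolding t_def s' using k by (simp add: field_simps of_nat_diff)
      moreover have "pcong (of_nat k * (-1) ^ k + 0) (of_nat k * (-1) ^ k + P * (-1) ^ (k - 1)) 1"
        by (intro pcong_add pcong_refl pcong_sym[OF pcong_P_dvd]) (auto intro!: power_pint uminus_pint)
      ultimately show ?thesis by (simp only: add_0_right)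
    qed
    moreover have "punit (of_nat k * of_nat (p - k))" by (intro punit_mult punit_of_nat_less k)
    ultimately show ?thesis by (rule pcong_cancel[rotated])
  qed
  have "(\<Sum>k\<le>p. of_nat (p choose k)) = (2 ^ p :: rat)"
    using arg_cong[OF choose_row_sum[of p], of "of_nat :: nat \<Rightarrow> rat"] by simp
  moreover have "{..p} = insert 0 (insert p {1..2 * half})" using bd p_gt_3 by auto
  moreover have "p \<notin> {1..2 * half}" "p \<noteq> 0" using bd p_gt_3 by auto
  ultimately have "2 ^ p = 2 + (\<Sum>k=1..2 * half. of_nat (p choose k) :: rat)" by simp
  moreover have "pcong (\<Sum>k=1..2 * half. of_nat (p choose k)) (P * (\<Sum>k=1..2 * half. t k)) 2"
    unfolding sum_distrib_left by (intro pcong_sum binom)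
  ultimately have 1: "pcong (2 ^ p) (2 + P * (\<Sum>k=1..2 * half. t k)) 2"
    using pcong_add[OF pcong_refl[of 2 2]] by simp
  have "(\<Sum>k=1..2 * half. t k) = (\<Sum>k=1..half. t k) + (\<Sum>k=half+1..2 * half. t k)"
    by (rule sum.ub_add_nat[of 1 half _ half, folded mult_2]) simp
  also have "(\<Sum>k=half+1..2 * half. t k) = (\<Sum>k=1..half. t (p - k))"
    by (rule sum.reindex_bij_witness[of _ "\<lambda>k. p - k" "\<lambda>k. p - k"]) (use bd in auto)
  also have "pcong ((\<Sum>k=1..half. t k) + (\<Sum>k=1..half. t (p - k))) ((\<Sum>k=1..half. t k) + (\<Sum>k=1..half. t k)) 1"
    by (intro pcong_add pcong_refl pcong_sum mirror)
  finally have 2: "pcong (P * (\<Sum>k=1..2 * half. t k)) (P * (2 * (harmonic half - harmonic (half div 2)))) 2"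
    unfolding t_def alternating_harmonic by (intro pcong_lift) simp
  have "pcong (2 ^ p) (2 + P * (2 * (harmonic half - harmonic (half div 2)))) 2"
    by (rule pcong_trans[OF 1 pcong_add[OF pcong_refl 2]])
  moreover have "(2 :: rat) ^ p = 2 * 2 ^ (p - 1)" using p_gt_3 by (cases p) auto
  ultimately have "pcong (2 * 2 ^ (p - 1)) (2 * (1 + P * (harmonic half - harmonic (half div 2)))) 2"
    by (simp add: algebra_simps)
  then show ?thesis by (rule pcong_cancel[OF punit_2])
qed

section \<open>Jacobsthal sums\<close>

abbreviation rho :: "int \<Rightarrow> int" where "rho a \<equiv> Legendre a (int p)"

lemma rho_euler: "[rho a = a ^ half] (mod int p)"
  unfolding half_def using euler_criterion[of p a] prime_p p_gt_3 by simp

lemma rho_values: "rho a = 0 \<or> rho a = 1 \<or> rho a = -1"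
  by (simp add: Legendre_def)

lemma rho_eq_0_iff: "rho a = 0 \<longleftrightarrow> int p dvd a"
  by (auto simp: Legendre_def cong_0_iff)

text \<open>Two values among -1, 0 and 1 differ by at most 2, which is less than p.\<close>

lemma rho_eqI:
  assumes "[rho a = b] (mod int p)" "b = 0 \<or> b = 1 \<or> b = -1"
  shows "rho a = b"
proof (rule ccontr)
  assume "rho a \<noteq> b"
  moreover have "int p dvd rho a - b" using assms(1) by (simp add: cong_iff_dvd_diff)
  ultimately have "int p \<le> \<bar>rho a - b\<bar>" by (intro zdvd_imp_le) (auto simp: dvd_abs_iff)
  moreover have "\<bar>rho a - b\<bar> \<le> 2" using assms(2) rho_values[of a] by auto
  ultimately show False using p_gt_3 by simp
qed

lemma rho_cong: "[a = b] (mod int p) \<Longrightarrow> rho a = rho b"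
  by (rule rho_eqI) (meson rho_euler cong_pow cong_sym cong_trans, rule rho_values)

lemma rho_mult: "rho (a * b) = rho a * rho b"
proof (rule rho_eqI)
  have "[rho (a * b) = a ^ half * b ^ half] (mod int p)"
    using rho_euler[of "a * b"] by (simp add: power_mult_distrib)
  then show "[rho (a * b) = rho a * rho b] (mod int p)"
    using cong_mult[OF rho_euler rho_euler] cong_sym cong_trans by blast
  show "rho a * rho b = 0 \<or> rho a * rho b = 1 \<or> rho a * rho b = -1"
    using rho_values[of a] rho_values[of b] by auto
qed

lemma rho_square: "rho a * rho a = (if int p dvd a then 0 else 1)"
  using rho_values[of a] rho_eq_0_iff[of a] by auto

lemma rho_1: "rho 1 = 1"
  by (rule rho_eqI) (use rho_euler[of 1] in auto)

section \<open>Character sums over a complete residue system\<close>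

definition Zp :: "int set" where "Zp = {0..<int p}"

lemma finite_Zp [simp]: "finite Zp" by (simp add: Zp_def)

lemma card_Zp: "card Zp = p" by (simp add: Zp_def)

lemma Zp_dvd_iff: "a \<in> Zp \<Longrightarrow> int p dvd a \<longleftrightarrow> a = 0"
  unfolding Zp_def by (auto dest: zdvd_imp_le)

text \<open>The map k -> ck + d permutes the residues; periodicity of f absorbs the reduction modulo
  p.\<close>

lemma sum_Zp_reindex:
  fixes f :: "int \<Rightarrow> int"
  assumes f: "\<And>a b. [a = b] (mod int p) \<Longrightarrow> f a = f b" and c: "\<not> int p dvd c"
  shows "(\<Sum>k\<in>Zp. f (c * k + d)) = (\<Sum>k\<in>Zp. f k)"
proof -
  have p0: "int p > 0" using p_gt_3 by simp
  have inj: "inj_on (\<lambda>k. (c * k + d) mod int p) Zp"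
  proof (rule inj_onI)
    fix a b assume ab: "a \<in> Zp" "b \<in> Zp" "(c * a + d) mod int p = (c * b + d) mod int p"
    then have "[c * a + d = c * b + d] (mod int p)" by (simp add: cong_def)
    then have "[c * a = c * b] (mod int p)" by (simp add: cong_add_rcancel)
    moreover have "coprime c (int p)" using prime_imp_coprime[OF prime_int_p c] by (simp add: coprime_commute)
    ultimately have "[a = b] (mod int p)" by (simp add: cong_mult_lcancel)
    then show "a = b" using ab by (simp add: cong_def Zp_def)
  qed
  have "(\<lambda>k. (c * k + d) mod int p) ` Zp \<subseteq> Zp" using p0 by (auto simp: Zp_def)
  then have "bij_betw (\<lambda>k. (c * k + d) mod int p) Zp Zp"
    using inj endo_inj_surj[OF finite_Zp] by (simp add: bij_betw_def)
  then have "(\<Sum>k\<in>Zp. f k) = (\<Sum>k\<in>Zp. f ((c * k + d) mod int p))"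
    by (rule sum.reindex_bij_betw[symmetric])
  also have "\<dots> = (\<Sum>k\<in>Zp. f (c * k + d))" by (intro sum.cong refl f) (simp add: cong_def)
  finally show ?thesis by simp
qed

lemma primroot_int:
  obtains g :: int where "\<And>j. [g ^ j = 1] (mod int p) \<longleftrightarrow> (p - 1) dvd j" "\<not> int p dvd g"
proof -
  obtain a where a: "a \<in> totatives p" "ord p a = p - 1"
    using residue_prime_has_primroot[OF prime_p] by blast
  have "[int a ^ j = 1] (mod int p) \<longleftrightarrow> (p - 1) dvd j" for j
    using ord_divides[of a j p] a cong_int_iff[of "a ^ j" 1 p] by simp
  moreover have "\<not> int p dvd int a"
    using a prime_p p_gt_3 by (auto simp: totatives_def dest: coprime_common_divisor)
  ultimately show ?thesis using that by blast
qed

text \<open>A primitive root serves, since its power with exponent (p - 1)/2 is not 1.\<close>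

lemma nonresidue: obtains g where "rho g = -1"
proof -
  obtain g where g: "\<And>j. [g ^ j = 1] (mod int p) \<longleftrightarrow> (p - 1) dvd j" "\<not> int p dvd g"
    using primroot_int by blast
  have "\<not> (p - 1) dvd half" using p_eq p_gt_3 by (auto dest: dvd_imp_le)
  then have "rho g \<noteq> 1" using g(1)[of half] rho_euler[of g] cong_sym by metis
  moreover have "rho g \<noteq> 0" using g rho_eq_0_iff by blast
  ultimately show ?thesis using that rho_values[of g] by blast
qed

text \<open>Multiplication by a nonresidue permutes the residues and changes the sign of the
  sum.\<close>

lemma sum_rho: "(\<Sum>k\<in>Zp. rho k) = 0"
proof -
  obtain g where g: "rho g = -1" by (rule nonresidue)
  have "\<not> int p dvd g" using g rho_eq_0_iff[of g] by auto
  then have "(\<Sum>k\<in>Zp. rho (g * k + 0)) = (\<Sum>k\<in>Zp. rho k)" by (intro sum_Zp_reindex rho_cong)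
  then show ?thesis by (simp add: rho_mult g sum_negf)
qed

lemma sum_rho_square: "(\<Sum>k\<in>Zp. rho k * rho k) = int p - 1"
proof -
  have "(\<Sum>k\<in>Zp. rho k * rho k) = (\<Sum>k\<in>Zp. 1 - (if k = 0 then 1 else 0))"
    by (intro sum.cong refl) (simp add: rho_square Zp_dvd_iff)
  also have "\<dots> = int p - 1" using p_gt_3 by (simp add: sum_subtractf card_Zp) (simp add: Zp_def)
  finally show ?thesis .
qed

text \<open>Scaling by d shows that the sum is the same for all d prime to p. The total over all d
  is 0 and the value at d = 0 is p - 1, so the common value is -1.\<close>

lemma sum_rho_shift: "(\<Sum>k\<in>Zp. rho k * rho (k + d)) = (if int p dvd d then int p else 0) - 1"
proof -
  define J where "J d = (\<Sum>k\<in>Zp. rho k * rho (k + d))" for d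
  have per: "[a = b] (mod int p) \<Longrightarrow> rho a * rho (a + d) = rho b * rho (b + d)" for a b d
    using rho_cong[of a b] rho_cong[of "a + d" "b + d"] by (simp add: cong_add_rcancel)
  have J0: "J d = int p - 1" if "int p dvd d" for d
  proof -
    have "rho (k + d) = rho k" for k by (rule rho_cong) (use that in \<open>simp add: cong_iff_dvd_diff\<close>)
    then show ?thesis by (simp add: J_def sum_rho_square)
  qed
  have J1: "J d = J 1" if "\<not> int p dvd d" for d
  proof -
    have "J d = (\<Sum>k\<in>Zp. rho (d * k + 0) * rho (d * k + 0 + d))"
      unfolding J_def by (rule sum_Zp_reindex[symmetric, OF per that])
    also have "\<dots> = (\<Sum>k\<in>Zp. (rho d * rho d) * (rho k * rho (k + 1)))"
      by (intro sum.cong refl) (simp add: rho_mult[symmetric] algebra_simps)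
    also have "\<dots> = J 1" using that by (simp add: rho_square J_def)
    finally show ?thesis .
  qed
  have "(\<Sum>d\<in>Zp. J d) = (\<Sum>k\<in>Zp. rho k * (\<Sum>d\<in>Zp. rho (1 * d + k)))"
    unfolding J_def by (subst sum.swap) (simp add: sum_distrib_left add.commute)
  also have "\<dots> = 0"
  proof -
    have "(\<Sum>d\<in>Zp. rho (1 * d + k)) = (\<Sum>d\<in>Zp. rho d)" for k
      by (rule sum_Zp_reindex) (use rho_cong p_gt_3 in auto)
    then show ?thesis by (simp add: sum_rho)
  qed
  finally have "(\<Sum>d\<in>Zp. J d) = 0" .
  moreover have "(\<Sum>d\<in>Zp. J d) = J 0 + (\<Sum>d\<in>Zp - {0}. J d)"
    using p_gt_3 by (intro sum.remove) (auto simp: Zp_def)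
  moreover have "(\<Sum>d\<in>Zp - {0}. J d) = (\<Sum>d\<in>Zp - {0}. J 1)"
    by (intro sum.cong refl J1) (auto simp: Zp_dvd_iff)
  moreover have "card (Zp - {0}) = p - 1" using p_gt_3 by (simp add: card_Zp) (simp add: Zp_def)
  ultimately have "(int p - 1) * (1 + J 1) = 0"
    using J0[of 0] p_gt_3 by (simp add: of_nat_diff algebra_simps)
  then have "J 1 = -1" using p_gt_3 by simp
  then have "J d = (if int p dvd d then int p else 0) - 1" using J0[of d] J1[of d] by simp
  then show ?thesis by (simp add: J_def)
qed

section \<open>Jacobsthal sums of the cubic t^3 - kt\<close>

definition jacobsthal :: "int \<Rightarrow> int" where
  "jacobsthal k = (\<Sum>t\<in>Zp. rho t * rho (t ^ 2 - k))"

lemma jacobsthal_cong: "[a = b] (mod int p) \<Longrightarrow> jacobsthal a = jacobsthal b"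
  unfolding jacobsthal_def by (intro sum.cong refl arg_cong2[of _ _ _ _ "(*)"] rho_cong cong_diff cong_refl)

text \<open>Substituting ct for t pulls out c^3, whose symbol is that of c.\<close>

lemma jacobsthal_scale:
  assumes "\<not> int p dvd c" shows "jacobsthal (k * c ^ 2) = rho c * jacobsthal k"
proof -
  have "jacobsthal (k * c ^ 2) = (\<Sum>t\<in>Zp. rho (c * t + 0) * rho ((c * t + 0) ^ 2 - k * c ^ 2))"
    unfolding jacobsthal_def
    by (rule sum_Zp_reindex[symmetric, OF _ assms]) 
      (intro arg_cong2[of _ _ _ _ "(*)"] rho_cong cong_diff cong_refl cong_pow)
  also have "\<dots> = (\<Sum>t\<in>Zp. (rho c * rho c) * (rho c * (rho t * rho (t ^ 2 - k))))"
    by (intro sum.cong refl) (simp add: rho_mult[symmetric] algebra_simps power2_eq_square)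
  also have "\<dots> = rho c * jacobsthal k"
    using assms by (simp add: rho_square jacobsthal_def sum_distrib_left)
  finally show ?thesis .
qed

lemma jacobsthal_0: "jacobsthal 0 = 0"
proof -
  have "jacobsthal 0 = (\<Sum>t\<in>Zp. rho t)"
    unfolding jacobsthal_def
    by (intro sum.cong refl) (auto simp: power2_eq_square rho_mult rho_square rho_eq_0_iff)
  then show ?thesis by (simp add: sum_rho)
qed

text \<open>If ab is the square of d modulo p, then b d^2 and a b^2 are congruent; scaling both
  changes the sums by signs only.\<close>

lemma jacobsthal_square_cong:
  assumes "rho a = rho b" "rho a \<noteq> 0"
  shows "jacobsthal a ^ 2 = jacobsthal b ^ 2"
proof -
  have nd: "\<not> int p dvd a" "\<not> int p dvd b" using assms rho_eq_0_iff by metis+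
  have "rho (a * b) = 1" using assms rho_values[of a] by (auto simp: rho_mult)
  then have "QuadRes (int p) (a * b)" by (auto simp: Legendre_def split: if_splits)
  then obtain d where d: "[d ^ 2 = a * b] (mod int p)" by (auto simp: QuadRes_def)
  have "\<not> int p dvd d"
  proof
    assume "int p dvd d"
    then have "int p dvd d ^ 2" by (simp add: power2_eq_square)
    then have "int p dvd a * b" using cong_dvd_iff[OF cong_sym[OF d]] d cong_dvd_iff by blast
    then show False using nd prime_int_p by (simp add: prime_dvd_mult_iff)
  qed
  then have "rho d * rho d = 1" "rho b * rho b = 1" using nd by (simp_all add: rho_square)
  moreover have "[b * d ^ 2 = a * b ^ 2] (mod int p)"
    using cong_scalar_left[OF d, of b] by (simp add: power2_eq_square mult_ac)
  then have "rho d * jacobsthal b = rho b * jacobsthal a"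
    using jacobsthal_cong jacobsthal_scale[OF \<open>\<not> int p dvd d\<close>] jacobsthal_scale[OF nd(2)] by metis
  then have "(rho d * rho d) * jacobsthal b ^ 2 = (rho b * rho b) * jacobsthal a ^ 2"
    by (metis power2_eq_square power_mult_distrib)
  ultimately show ?thesis by simp
qed

text \<open>The sum of all squared Jacobsthal sums is computed in two ways: by classes of residues
  and nonresidues, and by expanding the squares and summing over k first, where only t = s and t =
  -s contribute a multiple of p.\<close>

lemma jacobsthal_sum_squares:
  assumes ev: "even half" and g: "rho g = -1"
  shows "jacobsthal 1 ^ 2 + jacobsthal g ^ 2 = 4 * int p"
proof -
  have rm1: "rho (-1) = 1"
    using rho_eqI[of "-1" 1] rho_euler[of "-1"] ev by (simp add: uminus_power_if)
  \<comment> \<open>The brackets are twice the indicators of residues and nonresidues; both vanish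
    for k = 0, as does \<open>jacobsthal 0\<close>.\<close>
  have two: "2 * jacobsthal k ^ 2 = jacobsthal 1 ^ 2 * (rho k * rho k + rho k) + jacobsthal g ^ 2 * (rho k * rho k - rho k)"
    for k
  proof -
    consider "rho k = 0" | "rho k = 1" | "rho k = -1" using rho_values by blast
    then show ?thesis
    proof cases
      case 1
      then have "[k = 0] (mod int p)" by (simp add: rho_eq_0_iff cong_0_iff)
      then have "jacobsthal k = 0" using jacobsthal_cong jacobsthal_0 by metis
      then show ?thesis using 1 by simp
    next
      case 2
      then show ?thesis using jacobsthal_square_cong[of k 1] rho_1 by simp
    next
      case 3
      then show ?thesis using jacobsthal_square_cong[of k g] g by simp
    qed
  qed
  have "2 * (\<Sum>k\<in>Zp. jacobsthal k ^ 2) = (jacobsthal 1 ^ 2 + jacobsthal g ^ 2) * (int p - 1)"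
    unfolding sum_distrib_left two
    by (simp only: sum.distrib sum_distrib_left[symmetric] sum_subtractf sum_rho sum_rho_square) (simp add: algebra_simps)
  moreover have "(\<Sum>k\<in>Zp. jacobsthal k ^ 2) = 2 * int p * (int p - 1)"
  proof -
    have "(\<Sum>k\<in>Zp. jacobsthal k ^ 2) = (\<Sum>k\<in>Zp. \<Sum>s\<in>Zp. \<Sum>t\<in>Zp. rho s * rho t * (rho (s ^ 2 - k) * rho (t ^ 2 - k)))"
      unfolding jacobsthal_def power2_eq_square[of "sum _ _"] sum_product by (simp add: mult_ac)
    also have "\<dots> = (\<Sum>s\<in>Zp. \<Sum>t\<in>Zp. \<Sum>k\<in>Zp. rho s * rho t * (rho (s ^ 2 - k) * rho (t ^ 2 - k)))"
      by (subst sum.swap, rule sum.cong[OF refl], rule sum.swap)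
    also have "\<dots> = (\<Sum>s\<in>Zp. \<Sum>t\<in>Zp. rho s * rho t * ((if int p dvd t ^ 2 - s ^ 2 then int p else 0) - 1))"
    proof (intro sum.cong refl)
      fix s t
      \<comment> \<open>The substitution k -> s^2 - k brings the inner sum to the form of
        \<open>sum_rho_shift\<close>.\<close>
      have "(\<Sum>k\<in>Zp. rho ((- 1) * k + s ^ 2) * rho ((- 1) * k + s ^ 2 + (t ^ 2 - s ^ 2))) = 
         (\<Sum>k\<in>Zp. rho k * rho (k + (t ^ 2 - s ^ 2)))"
        by (rule sum_Zp_reindex)
          (use p_gt_3 in \<open>auto intro!: arg_cong2[of _ _ _ _ "(*)"] rho_cong simp: cong_add_rcancel\<close>)
      then have "(\<Sum>k\<in>Zp. rho (s ^ 2 - k) * rho (t ^ 2 - k)) = (if int p dvd t ^ 2 - s ^ 2 then int p else 0) - 1"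
        unfolding sum_rho_shift by simp
      then show "(\<Sum>k\<in>Zp. rho s * rho t * (rho (s ^ 2 - k) * rho (t ^ 2 - k))) =
        rho s * rho t * ((if int p dvd t ^ 2 - s ^ 2 then int p else 0) - 1)"
        by (simp only: sum_distrib_left[symmetric])
    qed
    also have "\<dots> = (\<Sum>s\<in>Zp. 2 * int p * (rho s * rho s) - rho s * (\<Sum>t\<in>Zp. rho t))"
    proof (intro sum.cong refl)
      fix s assume s: "s \<in> Zp"
      have "(\<Sum>t\<in>Zp. rho s * rho t * ((if int p dvd t ^ 2 - s ^ 2 then int p else 0) - 1)) = 
        (\<Sum>t\<in>Zp. if int p dvd t ^ 2 - s ^ 2 then int p * (rho s * rho t) else 0) - rho s * (\<Sum>t\<in>Zp. rho t)"
        unfolding sum_distrib_left sum_subtractf[symmetric] by (intro sum.cong refl) (simp add: algebra_simps)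
      also have "(\<Sum>t\<in>Zp. if int p dvd t ^ 2 - s ^ 2 then int p * (rho s * rho t) else 0) = 
        (\<Sum>t\<in>{t\<in>Zp. int p dvd t ^ 2 - s ^ 2}. int p * (rho s * rho t))"
        by (rule sum.inter_filter[symmetric]) simp
      also have "\<dots> = 2 * int p * (rho s * rho s)"
      proof (cases "s = 0")
        case True
        then show ?thesis using rho_eq_0_iff[of 0] by simp
      next
        case False
        have "t \<in> Zp \<and> int p dvd t ^ 2 - s ^ 2 \<longleftrightarrow> t = s \<or> t = int p - s" for t
        proof
          assume t: "t \<in> Zp \<and> int p dvd t ^ 2 - s ^ 2"
          have "t ^ 2 - s ^ 2 = (t - s) * (t + s)" by (simp add: power2_eq_square algebra_simps)
          then consider "int p dvd t - s" | "int p dvd t + s" using t prime_int_p by (auto simp: prime_dvd_mult_iff)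
          then show "t = s \<or> t = int p - s"
          proof cases
            case 1
            then have "t mod int p = s mod int p" by (simp add: mod_eq_dvd_iff)
            then show ?thesis using s t by (simp add: Zp_def)
          next
            case 2
            then have "int p dvd (t + s) - int p" by (intro dvd_diff) auto
            moreover have "(t + s) - int p = t - (int p - s)" by simp
            ultimately have "int p dvd t - (int p - s)" by (simp only:)
            then have "t mod int p = (int p - s) mod int p" by (simp only: mod_eq_dvd_iff)
            moreover have "t mod int p = t" "(int p - s) mod int p = int p - s"
              using s t False by (auto intro!: mod_pos_pos_trivial simp: Zp_def simp del: minus_mod_self1)
            ultimately show ?thesis by linarith
          qed
        next
          assume "t = s \<or> t = int p - s"
          moreover have "int p dvd (int p - s) ^ 2 - s ^ 2"
            by (rule dvdI[of _ _ "int p - 2 * s"]) (simp add: power2_eq_square algebra_simps)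
          ultimately show "t \<in> Zp \<and> int p dvd t ^ 2 - s ^ 2" using s False by (auto simp: Zp_def)
        qed
        then have "{t\<in>Zp. int p dvd t ^ 2 - s ^ 2} = {s, int p - s}" by auto
        moreover have "s \<noteq> int p - s" using odd_p by presburger
        moreover have "rho (int p - s) = rho (-1 * s)" by (rule rho_cong) (simp add: cong_iff_dvd_diff)
        then have "rho (int p - s) = rho s" by (simp only: rho_mult rm1 mult_1_left)
        ultimately show ?thesis by (simp add: algebra_simps)
      qed
      finally show "(\<Sum>t\<in>Zp. rho s * rho t * ((if int p dvd t ^ 2 - s ^ 2 then int p else 0) - 1)) = 
        2 * int p * (rho s * rho s) - rho s * (\<Sum>t\<in>Zp. rho t)" .
    qed
    also have "\<dots> = 2 * int p * (int p - 1)"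
      by (simp add: sum_rho sum_distrib_left[symmetric] sum_rho_square)
    finally show ?thesis .
  qed
  ultimately have "(jacobsthal 1 ^ 2 + jacobsthal g ^ 2) * (int p - 1) = 2 * (2 * int p * (int p - 1))" by (simp only:)
  then have "(jacobsthal 1 ^ 2 + jacobsthal g ^ 2) * (int p - 1) = (4 * int p) * (int p - 1)" by (simp only: mult.assoc)
  moreover have "int p - 1 \<noteq> 0" using p_gt_3 by simp
  ultimately show ?thesis using mult_right_cancel by blast
qed

end

section \<open>Uniqueness of the representation as a sum of two squares\<close>

lemma two_squares_aux:
  fixes a b c d q :: int
  assumes q: "q > 0" "q = a ^ 2 + b ^ 2" "q = c ^ 2 + d ^ 2" and par: "even b" "odd c" and dv: "q dvd a * d - b * c"
  shows "a ^ 2 = c ^ 2"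
proof (cases "a * d - b * c = 0")
  case True
  have "q * (a ^ 2 - c ^ 2) = (a * d - b * c) * (a * d + b * c)"
    using arg_cong[OF q(3), of "\<lambda>z. z * a ^ 2"] arg_cong[OF q(2), of "\<lambda>z. z * c ^ 2"]
    by (simp add: algebra_simps power2_eq_square)
  then show ?thesis using True q(1) by simp
next
  case False
  then have "q \<le> \<bar>a * d - b * c\<bar>" using dv by (intro zdvd_imp_le) auto
  then have "q ^ 2 \<le> \<bar>a * d - b * c\<bar> ^ 2" using q by (intro power_mono) auto
  \<comment> \<open>Brahmagupta's identity. The first square is already at least q^2, so the second
    one vanishes; this forces b^2 = c^2, against the parities.\<close>
  moreover have "(a * d - b * c) ^ 2 + (a * c + b * d) ^ 2 = q ^ 2"
  proof -
    have "q ^ 2 = (a ^ 2 + b ^ 2) * (c ^ 2 + d ^ 2)" unfolding power2_eq_square[of q] by (rule arg_cong2[OF q(2,3)])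
    then show ?thesis by (simp add: power2_eq_square algebra_simps)
  qed
  ultimately have "(a * c + b * d) ^ 2 \<le> 0" unfolding power2_abs by linarith
  then have "a * c + b * d = 0" by simp
  then have "b * d = - (a * c)" by simp
  then have "(b * d) ^ 2 = (a * c) ^ 2" by (simp only: power2_minus)
  moreover have "(b * d) ^ 2 = (q - a ^ 2) * (q - c ^ 2)"
  proof -
    have "b ^ 2 = q - a ^ 2" "d ^ 2 = q - c ^ 2" using q(2) q(3) by simp_all
    then show ?thesis by (simp only: power_mult_distrib)
  qed
  moreover have "q * (q - a ^ 2 - c ^ 2) = (q - a ^ 2) * (q - c ^ 2) - (a * c) ^ 2"
    by (simp add: power2_eq_square algebra_simps)
  ultimately have "q * (q - a ^ 2 - c ^ 2) = 0" by linarith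
  then have "q - a ^ 2 - c ^ 2 = 0" using q(1) by simp
  then have "b ^ 2 = c ^ 2" using q(2) by simp
  then have "even (b ^ 2) = even (c ^ 2)" by simp
  then show ?thesis using par by simp
qed

text \<open>The prime q divides (ad - bc)(ad + bc); if it divides the second factor, replacing b by
  -b leads back to the first. The parities select which square is compared with which.\<close>

lemma two_squares_unique:
  fixes a b c d q :: int
  assumes "prime q" "q = a ^ 2 + b ^ 2" "q = c ^ 2 + d ^ 2" "even b" "odd c"
  shows "a ^ 2 = c ^ 2"
proof -
  have q: "q > 0" using assms(1) by (simp add: prime_gt_0_int)
  have "q * (a ^ 2 - c ^ 2) = (a * d - b * c) * (a * d + b * c)"
    using arg_cong[OF assms(3), of "\<lambda>z. z * a ^ 2"] arg_cong[OF assms(2), of "\<lambda>z. z * c ^ 2"]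
    by (simp add: algebra_simps power2_eq_square)
  then have "q dvd (a * d - b * c) * (a * d + b * c)" by (metis dvd_triv_left)
  then consider "q dvd a * d - b * c" | "q dvd a * d - (- b) * c"
    using assms(1) by (auto simp: prime_dvd_mult_iff)
  then show ?thesis
  proof cases
    case 1
    then show ?thesis by (rule two_squares_aux[OF q assms(2-5)])
  next
    case 2
    moreover have "q = a ^ 2 + (- b) ^ 2" "even (- b)" using assms(2,4) by simp_all
    ultimately show ?thesis using two_squares_aux[OF q _ assms(3) _ assms(5)] by blast
  qed
qed

section \<open>Jacobsthal's theorem\<close>

context prime_gt_3
begin

text \<open>For even \<open>half\<close> the symbol of -1 is 1, so t and p - t contribute
  equally.\<close>

lemma jacobsthal_double:
  assumes ev: "even half"
  shows "jacobsthal k = 2 * (\<Sum>t=1..int half. rho t * rho (t ^ 2 - k))"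
proof -
  have rm1: "rho (-1) = 1"
    using rho_eqI[of "-1" 1] rho_euler[of "-1"] ev by (simp add: uminus_power_if)
  have p: "int p = 2 * int half + 1" using p_eq by linarith
  have "Zp = insert 0 ({1..int half} \<union> {int half + 1..2 * int half})" unfolding Zp_def p by auto
  then have "jacobsthal k = (\<Sum>t\<in>insert 0 ({1..int half} \<union> {int half + 1..2 * int half}). rho t * rho (t ^ 2 - k))"
    unfolding jacobsthal_def by simp
  also have "\<dots> = (\<Sum>t=1..int half. rho t * rho (t ^ 2 - k)) + (\<Sum>t=int half + 1..2 * int half. rho t * rho (t ^ 2 - k))"
    using rho_eq_0_iff[of 0] by (subst sum.insert) (auto simp: sum.union_disjoint)
  also have "(\<Sum>t=int half + 1..2 * int half. rho t * rho (t ^ 2 - k)) = 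
      (\<Sum>t=1..int half. rho (int p - t) * rho ((int p - t) ^ 2 - k))"
    by (rule sum.reindex_bij_witness[of _ "\<lambda>t. int p - t" "\<lambda>t. int p - t"]) (auto simp: p)
  also have "\<dots> = (\<Sum>t=1..int half. rho t * rho (t ^ 2 - k))"
  proof (intro sum.cong refl arg_cong2[of _ _ _ _ "(*)"])
    fix t
    have "rho (int p - t) = rho (-1 * t)" by (rule rho_cong) (simp add: cong_iff_dvd_diff)
    then show "rho (int p - t) = rho t" by (simp only: rho_mult rm1 mult_1_left)
    have "(int p - t) ^ 2 - k - (t ^ 2 - k) = int p * (int p - 2 * t)" by (simp add: power2_eq_square algebra_simps)
    then show "rho ((int p - t) ^ 2 - k) = rho (t ^ 2 - k)" by (intro rho_cong) (simp add: cong_iff_dvd_diff)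
  qed
  finally show ?thesis by simp
qed

text \<open>Halving the sums turns the identity for 4p into p = T(1)^2 + T(g)^2. Since T(1) is odd,
  uniqueness matches it with x.\<close>

lemma jacobsthal_1_square:
  assumes ev: "even half" and xy: "int p = x ^ 2 + 4 * y ^ 2"
  shows "jacobsthal 1 ^ 2 = 4 * x ^ 2"
proof -
  obtain g where g: "rho g = -1" by (rule nonresidue)
  define T where "T k = (\<Sum>t=1..int half. rho t * rho (t ^ 2 - k))" for k
  have "4 * (T 1 ^ 2 + T g ^ 2) = 4 * int p"
    using jacobsthal_sum_squares[OF ev g] unfolding jacobsthal_double[OF ev] T_def[symmetric] by (simp add: power_mult_distrib)
  then have pT: "int p = T 1 ^ 2 + T g ^ 2" by simp
  have "odd (T 1)"
  proof -
    \<comment> \<open>Only the summand at t = 1 is zero, the others are 1 or -1; hence T(1) has the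
      parity of \<open>half - 1\<close>.\<close>
    have "{t \<in> {1..int half}. odd (rho t * rho (t ^ 2 - 1))} = {2..int half}"
    proof (rule Set.set_eqI)
      fix t
      show "t \<in> {t \<in> {1..int half}. odd (rho t * rho (t ^ 2 - 1))} \<longleftrightarrow> t \<in> {2..int half}"
      proof (cases "t \<in> {2..int half}")
        case True
        have "int p = 2 * int half + 1" using p_eq by linarith
        then have "0 < t" "t < int p" "0 < t - 1" "t - 1 < int p" "0 < t + 1" "t + 1 < int p"
          using True half_gt_1 by auto
        then have "\<not> int p dvd t" "\<not> int p dvd t - 1" "\<not> int p dvd t + 1" by (simp_all only: zdvd_not_zless not_False_eq_True)
        moreover have "t ^ 2 - 1 = (t - 1) * (t + 1)" by (simp add: power2_eq_square algebra_simps)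
        ultimately have "\<not> int p dvd t" "\<not> int p dvd t ^ 2 - 1" using prime_int_p by (auto simp: prime_dvd_mult_iff)
        then have "rho t \<noteq> 0" "rho (t ^ 2 - 1) \<noteq> 0" using rho_eq_0_iff by blast+
        then have "odd (rho t)" "odd (rho (t ^ 2 - 1))" using rho_values[of t] rho_values[of "t ^ 2 - 1"] by auto
        then show ?thesis using True by auto
      next
        case False
        moreover have "rho 0 = 0" by (simp add: rho_eq_0_iff)
        ultimately show ?thesis by (cases "t = 1") auto
      qed
    qed
    moreover have "odd (card {2..int half})"
    proof -
      have "card {2..int half} = half - 1" by simp
      then show ?thesis using ev half_gt_1 by simp
    qed
    ultimately show ?thesis unfolding T_def by (simp add: even_sum_iff)
  qed
  moreover have "odd x"
  proof -
    have "odd (int p)" using odd_p by simp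
    then show ?thesis unfolding xy by simp
  qed
  moreover have "int p = x ^ 2 + (2 * y) ^ 2" using xy by (simp add: power_mult_distrib)
  ultimately have "x ^ 2 = T 1 ^ 2" using two_squares_unique[of "int p" x "2 * y" "T 1" "T g"] prime_int_p pT by simp
  then show ?thesis unfolding jacobsthal_double[OF ev] T_def[symmetric] by (simp add: power_mult_distrib)
qed

section \<open>The Jacobsthal sum modulo p^2\<close>

lemma power_p_cong:
  fixes a b :: int
  assumes "[a = b] (mod int p)" shows "[a ^ p = b ^ p] (mod int p ^ 2)"
proof -
  obtain n where n: "p = Suc n" using p_gt_3 by (cases p) auto
  \<comment> \<open>The cofactor of a - b in a^p - b^p has p terms, all congruent to b^(p - 1), so
    it supplies a second factor p.\<close>
  have "[(\<Sum>i<Suc n. a ^ i * b ^ (n - i)) = (\<Sum>i<Suc n. b ^ i * b ^ (n - i))] (mod int p)"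
    by (intro cong_sum cong_mult cong_pow assms cong_refl)
  also have "(\<Sum>i<Suc n. b ^ i * b ^ (n - i)) = (\<Sum>i<Suc n. b ^ n)"
    by (intro sum.cong refl) (simp flip: power_add)
  also have "[\<dots> = 0] (mod int p)" by (simp add: n cong_0_iff)
  finally have "int p dvd (\<Sum>i<Suc n. a ^ i * b ^ (n - i))" by (simp only: cong_0_iff)
  moreover have "int p dvd a - b" using assms by (simp add: cong_iff_dvd_diff)
  ultimately have "int p * int p dvd (a - b) * (\<Sum>i<Suc n. a ^ i * b ^ (n - i))" by (rule mult_dvd_mono[rotated])
  then show ?thesis
    unfolding cong_iff_dvd_diff n diff_power_eq_sum power2_eq_square by (simp add: n)
qed

text \<open>Sums of powers over the Teichmueller representatives \<open>t ^ p\<close> are as orthogonal modulo \<open>p\<^sup>2\<close> as over the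
  prime field.\<close>

lemma teichmueller_power_sum:
  assumes j: "j > 0"
  shows "[(\<Sum>t\<in>Zp. (t ^ p) ^ j) = (if (p - 1) dvd j then int p - 1 else 0)] (mod int p ^ 2)"
proof (cases "(p - 1) dvd j")
  case True
  then obtain i where i: "j = (p - 1) * i" by blast
  have "[(t ^ p) ^ j = (if t = 0 then 0 else 1)] (mod int p ^ 2)" if t: "t \<in> Zp" for t
  proof (cases "t = 0")
    case True
    then show ?thesis using j p_gt_3 by (simp add: power_0_left)
  next
    case False
    define a where "a = nat t"
    have a: "t = int a" "0 < a" "a < p" using t False by (auto simp: a_def Zp_def)
    have "coprime a p" using a prime_p by (metis coprime_commute dvd_imp_le not_le prime_imp_coprime)
    \<comment> \<open>By Euler's theorem modulo p^2 the exponent p(p - 1) suffices, and pj is a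
      multiple of it.\<close>
    then have "[a ^ totient (p ^ 2) = 1] (mod p ^ 2)" by (intro euler_theorem) simp
    moreover have "totient (p ^ 2) = p * (p - 1)" using prime_p by (simp add: totient_prime_power)
    ultimately have "[(a ^ (p * (p - 1))) ^ i = 1 ^ i] (mod p ^ 2)" by (intro cong_pow) simp
    then have "[(a ^ p) ^ j = 1] (mod p ^ 2)" by (simp add: i power_mult[symmetric] mult.assoc)
    then have "[int ((a ^ p) ^ j) = int 1] (mod int (p ^ 2))" by (simp only: cong_int_iff)
    then show ?thesis using False a(2) by (simp add: a(1))
  qed
  then have "[(\<Sum>t\<in>Zp. (t ^ p) ^ j) = (\<Sum>t\<in>Zp. (if t = 0 then 0 else 1))] (mod int p ^ 2)"
    by (rule cong_sum)
  also have "(\<Sum>t\<in>Zp. (if t = 0 then 0 else 1 :: int)) = (\<Sum>t\<in>Zp. 1 - (if t = 0 then 1 else 0))"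
    by (intro sum.cong) auto
  also have "\<dots> = int p - 1" using p_gt_3 by (simp add: sum_subtractf card_Zp) (simp add: Zp_def)
  finally show ?thesis using True by simp
next
  case False
  obtain g where g: "\<And>j. [g ^ j = 1] (mod int p) \<longleftrightarrow> (p - 1) dvd j" "\<not> int p dvd g"
    using primroot_int by blast
  \<comment> \<open>Reducing modulo p^2 makes the summand periodic with period p, as reindexing the
    residues requires.\<close>
  define f where "f t = (t ^ p) ^ j mod int p ^ 2" for t :: int
  have f: "f a = f b" if "[a = b] (mod int p)" for a b
    using cong_pow[OF power_p_cong[OF that], of j] by (simp add: f_def cong_def)
  have ft: "[f t = (t ^ p) ^ j] (mod int p ^ 2)" for t by (simp add: f_def cong_def)
  let ?s = "\<Sum>t\<in>Zp. (t ^ p) ^ j"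
  have "[?s = (\<Sum>t\<in>Zp. f t)] (mod int p ^ 2)" by (intro cong_sum cong_sym[OF ft])
  also have "(\<Sum>t\<in>Zp. f t) = (\<Sum>t\<in>Zp. f (g * t + 0))" by (rule sum_Zp_reindex[symmetric, OF f g(2)])
  also have "[\<dots> = (\<Sum>t\<in>Zp. ((g * t + 0) ^ p) ^ j)] (mod int p ^ 2)" by (intro cong_sum ft)
  also have "(\<Sum>t\<in>Zp. ((g * t + 0) ^ p) ^ j) = (g ^ p) ^ j * ?s"
    by (simp add: power_mult_distrib sum_distrib_left)
  finally have "int p ^ 2 dvd ((g ^ p) ^ j - 1) * ?s"
    by (subst dvd_minus_iff[symmetric]) (simp add: cong_iff_dvd_diff algebra_simps)
  \<comment> \<open>As p is prime to p - 1, the exponent pj is no multiple of p - 1 either, so the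
    factor by which the sum is reproduced is not 1 even modulo p.\<close>
  moreover have "\<not> int p dvd (g ^ p) ^ j - 1"
  proof
    assume "int p dvd (g ^ p) ^ j - 1"
    then have "(p - 1) dvd p * j" using g(1)[of "p * j"] by (simp add: cong_iff_dvd_diff power_mult)
    moreover have "coprime (p - 1) p" using coprime_diff_one_left_nat[of p] p_gt_3 by simp
    ultimately show False using False by (simp add: coprime_dvd_mult_right_iff)
  qed
  then have "coprime (int p ^ 2) ((g ^ p) ^ j - 1)"
    using prime_imp_coprime[OF prime_int_p] by simp
  ultimately have "int p ^ 2 dvd ?s" by (simp add: coprime_dvd_mult_right_iff)
  then show ?thesis using False by (simp add: cong_0_iff)
qed

text \<open>The cubic (3v - v^3)/2 fixes 1 and -1 and has derivative 0 there, so it refines Euler's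
  criterion from modulus p to modulus p^2.\<close>

lemma rho_lift: "[2 * rho u = 3 * u ^ half - u ^ (3 * half)] (mod int p ^ 2)"
proof (cases "int p dvd u")
  case True
  \<comment> \<open>For multiples of p both powers are divisible by p^2 because \<open>half\<close>
    is at least 2.\<close>
  have "int p ^ 2 dvd u ^ half"
    using dvd_trans[OF dvd_power_same[OF True] le_imp_power_dvd[of 2 half u]] half_gt_1 by simp
  moreover have "int p ^ 2 dvd u ^ (3 * half)"
    using dvd_trans[OF dvd_power_same[OF True] le_imp_power_dvd[of 2 "3 * half" u]] half_gt_1 by simp
  ultimately show ?thesis using True rho_eq_0_iff[of u] by (simp add: cong_iff_dvd_diff)
next
  case False
  define r where "r = rho u"
  have r: "r * r = 1" using False by (simp add: r_def rho_square)
  obtain e where e: "u ^ half = r + int p * e"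
    using rho_euler[of u] unfolding r_def by (auto simp: cong_iff_lin)
  have "u ^ (3 * half) = (u ^ half) ^ 3" by (simp add: power_mult[symmetric] mult.commute)
  then have "2 * rho u - (3 * u ^ half - u ^ (3 * half)) = (r + 3 * int p * e) * (r * r - 1) + int p ^ 2 * (3 * r * e ^ 2 + int p * e ^ 3)"
    unfolding r_def[symmetric] e by (simp add: algebra_simps power2_eq_square power3_eq_cube)
  also have "\<dots> = int p ^ 2 * (3 * r * e ^ 2 + int p * e ^ 3)" unfolding r by simp
  finally have "2 * rho u - (3 * u ^ half - u ^ (3 * half)) = int p ^ 2 * (3 * r * e ^ 2 + int p * e ^ 3)" .
  then show ?thesis by (simp add: cong_iff_dvd_diff)
qed

text \<open>Expand x^q (x^2 - 1)^q; the power sums over t^p keep only exponents divisible by p - 1.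
  Even q gives the sign (-1)^(q - i) = (-1)^i.\<close>

lemma cubic_power_sum:
  assumes q: "q > 0" "even q"
  shows "[(\<Sum>t\<in>Zp. ((t ^ p) ^ 3 - t ^ p) ^ q) = 
     (int p - 1) * (\<Sum>i\<in>{i. i \<le> q \<and> (p - 1) dvd q + 2 * i}. (-1) ^ i * int (q choose i))] (mod int p ^ 2)"
proof -
  have "(x ^ 3 - x) ^ q = (\<Sum>i\<le>q. (-1) ^ i * int (q choose i) * x ^ (q + 2 * i))" for x :: int
  proof -
    have "(x ^ 3 - x) ^ q = x ^ q * (x ^ 2 + (-1)) ^ q"
      by (simp add: power_mult_distrib[symmetric] algebra_simps power2_eq_square power3_eq_cube)
    also have "\<dots> = (\<Sum>i\<le>q. x ^ q * (int (q choose i) * (x ^ 2) ^ i * (-1) ^ (q - i)))"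
      unfolding binomial_ring sum_distrib_left by simp
    also have "\<dots> = (\<Sum>i\<le>q. (-1) ^ i * int (q choose i) * x ^ (q + 2 * i))"
    proof (intro sum.cong refl)
      fix i assume "i \<in> {..q}"
      then have "even (q - i) = even i" using q by simp
      then have "((-1) ^ (q - i) :: int) = (-1) ^ i" by (simp add: uminus_power_if)
      then show "x ^ q * (int (q choose i) * (x ^ 2) ^ i * (-1) ^ (q - i)) = (-1) ^ i * int (q choose i) * x ^ (q + 2 * i)"
        by (simp add: power_add power_mult[symmetric])
    qed
    finally show ?thesis .
  qed
  then have "(\<Sum>t\<in>Zp. ((t ^ p) ^ 3 - t ^ p) ^ q) = (\<Sum>i\<le>q. (-1) ^ i * int (q choose i) * (\<Sum>t\<in>Zp. (t ^ p) ^ (q + 2 * i)))"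
    by (simp only: sum_distrib_left) (rule sum.swap)
  also have "[\<dots> = (\<Sum>i\<le>q. (-1) ^ i * int (q choose i) * (if (p - 1) dvd q + 2 * i then int p - 1 else 0))] (mod int p ^ 2)"
    using q by (intro cong_sum cong_mult cong_refl teichmueller_power_sum) simp
  also have "(\<Sum>i\<le>q. (-1) ^ i * int (q choose i) * (if (p - 1) dvd q + 2 * i then int p - 1 else 0)) = 
     (\<Sum>i\<le>q. if (p - 1) dvd q + 2 * i then (int p - 1) * ((-1) ^ i * int (q choose i)) else 0)"
    by (intro sum.cong refl) simp
  also have "\<dots> = (\<Sum>i\<in>{i\<in>{..q}. (p - 1) dvd q + 2 * i}. (int p - 1) * ((-1) ^ i * int (q choose i)))"
    by (rule sum.inter_filter[symmetric]) simp
  also have "\<dots> = (int p - 1) * (\<Sum>i\<in>{i. i \<le> q \<and> (p - 1) dvd q + 2 * i}. (-1) ^ i * int (q choose i))"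
    by (simp add: sum_distrib_left)
  finally show ?thesis .
qed

text \<open>By Fermat t may be replaced by t^p inside the symbol. The lifted symbol then leaves
  power sums of the cubic with exponents \<open>half = 2 * m\<close> and
  \<open>3 * half = 6 * m\<close>.\<close>

lemma jacobsthal_1_cong:
  assumes m: "half = 2 * m"
  shows "[2 * jacobsthal 1 = (int p - 1) * (-1) ^ m * (3 * int (2 * m choose m) - 2 * int (6 * m choose m) - int (6 * m choose (3 * m)))] (mod int p ^ 2)"
proof -
  have m0: "m > 0" using m half_gt_1 by simp
  have pm: "p - 1 = 4 * m" using p_eq m by simp
  have "2 * jacobsthal 1 = (\<Sum>t\<in>Zp. 2 * rho ((t ^ p) ^ 3 - t ^ p))"
    unfolding jacobsthal_def sum_distrib_left
  proof (intro sum.cong refl)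
    fix t :: int
    have "[t ^ p = t] (mod int p)"
    proof (cases "int p dvd t")
      case True
      then have "int p dvd t ^ p" using p_gt_3 by (simp add: dvd_power_iff dvd_trans[OF True dvd_power])
      then show ?thesis using True by (simp add: cong_iff_dvd_diff)
    next
      case False
      then have "[rho t * rho t = t ^ half * t ^ half] (mod int p)" by (intro cong_mult rho_euler)
      then have "[1 * t = t ^ (2 * half) * t] (mod int p)"
        using False by (intro cong_scalar_right) (simp add: rho_square mult_2 power_add)
      moreover have "t ^ p = t ^ (2 * half) * t" by (subst p_eq) simp
      ultimately show ?thesis by (simp add: cong_sym_eq)
    qed
    then have "[(t ^ p) ^ 3 - t ^ p = t ^ 3 - t] (mod int p)" by (intro cong_diff cong_pow)
    then have "rho ((t ^ p) ^ 3 - t ^ p) = rho (t ^ 3 - t)" by (rule rho_cong)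
    also have "t ^ 3 - t = t * (t ^ 2 - 1)" by (simp add: power2_eq_square power3_eq_cube algebra_simps)
    finally show "2 * (rho t * rho (t ^ 2 - 1)) = 2 * rho ((t ^ p) ^ 3 - t ^ p)" by (simp add: rho_mult)
  qed
  also have "[\<dots> = (\<Sum>t\<in>Zp. 3 * ((t ^ p) ^ 3 - t ^ p) ^ half - ((t ^ p) ^ 3 - t ^ p) ^ (3 * half))] (mod int p ^ 2)"
    by (intro cong_sum rho_lift)
  also have "(\<Sum>t\<in>Zp. 3 * ((t ^ p) ^ 3 - t ^ p) ^ half - ((t ^ p) ^ 3 - t ^ p) ^ (3 * half)) = 
     3 * (\<Sum>t\<in>Zp. ((t ^ p) ^ 3 - t ^ p) ^ (2 * m)) - (\<Sum>t\<in>Zp. ((t ^ p) ^ 3 - t ^ p) ^ (6 * m))"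
    by (simp add: sum_subtractf sum_distrib_left m)
  also have "[\<dots> = 3 * ((int p - 1) * (\<Sum>i\<in>{i. i \<le> 2 * m \<and> (p - 1) dvd 2 * m + 2 * i}. (-1) ^ i * int (2 * m choose i))) - 
      (int p - 1) * (\<Sum>i\<in>{i. i \<le> 6 * m \<and> (p - 1) dvd 6 * m + 2 * i}. (-1) ^ i * int (6 * m choose i))] (mod int p ^ 2)"
    using m0 by (intro cong_diff cong_mult cong_refl cubic_power_sum) auto
  \<comment> \<open>The exponent lies between 2m and 6m, where 4m is the only multiple of p - 1 =
    4m.\<close>
  also have "{i. i \<le> 2 * m \<and> (p - 1) dvd 2 * m + 2 * i} = {m}"
  proof -
    have "i = m" if "i \<le> 2 * m" "2 * m + 2 * i = 4 * m * k" for i k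
    proof -
      have "k = 1"
      proof (rule ccontr)
        assume "k \<noteq> 1"
        then consider "k = 0" | "k \<ge> 2" by linarith
        then show False
        proof cases
          case 2
          then have "4 * m * 2 \<le> 4 * m * k" by (intro mult_le_mono) auto
          then show False using that m0 by linarith
        qed (use that m0 in auto)
      qed
      then show ?thesis using that by simp
    qed
    then show ?thesis unfolding pm by (auto elim!: dvdE)
  qed
  \<comment> \<open>The exponent lies between 6m and 18m; the multiples of 4m there are 8m, 12m and
    16m.\<close>
  also have "{i. i \<le> 6 * m \<and> (p - 1) dvd 6 * m + 2 * i} = {m, 3 * m, 5 * m}"
  proof -
    have "i = m \<or> i = 3 * m \<or> i = 5 * m" if "i \<le> 6 * m" "6 * m + 2 * i = 4 * m * k" for i k
    proof -
      have "k = 2 \<or> k = 3 \<or> k = 4"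
      proof (rule ccontr)
        assume "\<not> (k = 2 \<or> k = 3 \<or> k = 4)"
        then consider "k \<le> 1" | "k \<ge> 5" by linarith
        then show False
        proof cases
          case 1
          then have "4 * m * k \<le> 4 * m * 1" by (intro mult_le_mono) auto
          then show False using that m0 by linarith
        next
          case 2
          then have "4 * m * 5 \<le> 4 * m * k" by (intro mult_le_mono) auto
          then show False using that m0 by linarith
        qed
      qed
      then show ?thesis using that by auto
    qed
    moreover have "4 * m dvd 6 * m + 2 * m" "4 * m dvd 6 * m + 2 * (3 * m)" "4 * m dvd 6 * m + 2 * (5 * m)"
      by (rule dvdI[of _ _ 2], simp, rule dvdI[of _ _ 3], simp, rule dvdI[of _ _ 4], simp)
    ultimately show ?thesis unfolding pm using m0 by (auto elim!: dvdE)
  qed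
  also have "3 * ((int p - 1) * (\<Sum>i\<in>{m}. (-1) ^ i * int (2 * m choose i))) - 
      (int p - 1) * (\<Sum>i\<in>{m, 3 * m, 5 * m}. (-1) ^ i * int (6 * m choose i)) = 
     (int p - 1) * (-1) ^ m * (3 * int (2 * m choose m) - 2 * int (6 * m choose m) - int (6 * m choose (3 * m)))"
  proof -
    have "6 * m choose (5 * m) = 6 * m choose m" using binomial_symmetric[of "5 * m" "6 * m"] by simp
    moreover have "((-1) ^ (3 * m) :: int) = (-1) ^ m" "((-1) ^ (5 * m) :: int) = (-1) ^ m"
      by (simp_all add: uminus_power_if)
    ultimately show ?thesis using m0 by (simp add: algebra_simps)
  qed
  finally show ?thesis .
qed

text \<open>Modulo p^2, \<open>c1\<close> is b/2 (1 + p(h - 2)) and \<open>c3\<close> is -2p/b.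
  Inserted into \<open>jacobsthal_1_cong\<close> and squared, they give b^2 (1 - ph) + 2p, whose
  first term is \<open>A ^ 2\<close> by \<open>A_B_even\<close>.\<close>

lemma jacobsthal_square_pcong:
  assumes m: "half = 2 * m"
  shows "pcong (of_int (jacobsthal 1) ^ 2) (A ^ 2 + 2 * P) 2"
proof -
  define e :: rat where "e = (-1) ^ m"
  define b :: rat where "b = of_nat (2 * m choose m)"
  define h where "h = harmonic (2 * m) - harmonic m"
  define r :: rat where "r = 1 / of_nat (2 * m)"
  define s :: rat where "s = of_int (jacobsthal 1)"
  define c1 c3 :: rat where "c1 = of_nat (6 * m choose m)" and "c3 = of_nat (6 * m choose (3 * m))"
  have m0: "m > 0" using m half_gt_1 by simp
  have e: "e * e = 1" "e \<noteq> 0" by (simp_all add: e_def sign_square)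
  have mp: "m < p" "2 * m < p" "m - 1 < p" "2 * m - 1 < p" using half_less m by auto
  have pm: "p = 4 * m + 1" using p_eq m by simp
  have b: "b = fact (2 * m) / (fact m * fact m)" unfolding b_def by (rule binomial_mid)
  have bu: "punit b" unfolding b using mp by (intro punit_divide punit_mult punit_fact)
  have eu: "punit e" unfolding e_def by (intro punit_power punit_uminus punit_1)
  have r_pint: "r \<in> pint p" unfolding r_def using mp m0 by (intro inverse_pint) auto
  have h_pint: "h \<in> pint p" unfolding h_def using mp by (intro diff_pint harmonic_pint)
  have pi: "e \<in> pint p" "b \<in> pint p" "inverse b \<in> pint p" "r \<in> pint p" "h \<in> pint p"
    using punitD[OF bu] punitD[OF eu] r_pint h_pint by auto
  \<comment> \<open>From p = 4m + 1; in particular r is -2 modulo p.\<close>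
  have Pr: "P * r = r + 2" unfolding r_def using m0 by (simp add: pm field_simps)
  have nz: "dn m \<noteq> 0" "dn (2 * m) \<noteq> 0" "up (m - 1) \<noteq> 0" "P \<noteq> 0"
    using punit_dn punit_up mp punitD(1) p_gt_3 by auto
  have fp: "fact (p + k) = up k * fact p * fact k" for k by (simp add: up_eq)
  \<comment> \<open>Here 6m = p + (2m - 1), and likewise 5m = p + (m - 1).\<close>
  have f6: "fact (6 * m) = up (2 * m - 1) * fact p * fact (2 * m - 1)"
    using fp[of "2 * m - 1"] m0 by (simp add: pm)
  have f5: "fact (5 * m) = up (m - 1) * fact p * fact (m - 1)"
    using fp[of "m - 1"] m0 by (simp add: pm)
  have fm: "fact m = of_nat m * (fact (m - 1) :: rat)" "fact (2 * m) = 2 * of_nat m * (fact (2 * m - 1) :: rat)"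
    using m0 fact_reduce[of m, where ?'a = rat] fact_reduce[of "2 * m", where ?'a = rat] by simp_all
  have c1: "c1 = b / 2 * (up (2 * m - 1) * inverse (up (m - 1)))"
  proof -
    have gen: "u * q * y / (n * x * (v * q * x)) = 2 * n * y / (n * x * (n * x)) / 2 * (u * inverse v)"
      if "q \<noteq> 0" "x \<noteq> 0" "n \<noteq> 0" "v \<noteq> 0" for u v q x y n :: rat
      using that by (simp add: field_simps)
    have "c1 = fact (6 * m) / (fact m * fact (5 * m))"
      unfolding c1_def using binomial_fact[where ?'a = rat and n = "6 * m" and k = m] by simp
    also have "\<dots> = b / 2 * (up (2 * m - 1) * inverse (up (m - 1)))"
      unfolding b f6 f5 fm by (rule gen) (use m0 nz in auto)
    finally show ?thesis .
  qed
  \<comment> \<open>The factor p occurs once in (6m)! and not in (3m)!; \<open>r\<close> comes from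
    writing (2m - 1)! as (2m)! / (2m).\<close>
  have c3: "c3 = P * (r * inverse b * (dn m * dn m * up (2 * m - 1) * inverse (dn (2 * m))))"
  proof -
    have f4: "fact (4 * m) = fact (3 * m) * e * fact m * dn m"
      using fact_eq_dn[of m] m by (simp add: e_def)
    have f4': "fact (4 * m) = fact (2 * m) * fact (2 * m) * dn (2 * m)"
      using fact_eq_dn[of half] m by simp
    \<comment> \<open>Comparing the two reflections of (4m)! = (p - 1)! expresses (3m)! through
      (2m)! and m!.\<close>
    have f3: "fact (3 * m) = e * fact (2 * m) * fact (2 * m) * dn (2 * m) / (fact m * dn m)"
    proof -
      have "e * (fact (3 * m) * e * fact m * dn m) = e * (fact (2 * m) * fact (2 * m) * dn (2 * m))"
        using f4 f4' by simp
      then have "(e * e) * fact (3 * m) * (fact m * dn m) = e * fact (2 * m) * fact (2 * m) * dn (2 * m)"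
        by (simp only: mult_ac)
      then show ?thesis using e nz by (simp add: field_simps)
    qed
    have fP: "fact p = P * (fact (2 * m) * fact (2 * m) * dn (2 * m))"
      unfolding f4'[symmetric] by (simp add: pm)
    have gen: "u * (q * (z * z * d')) * y / (e * z * z * d' / (x * d) * (e * z * z * d' / (x * d))) = 
       q * (1 / (2 * n) * inverse (z / (x * x)) * (d * d * u * inverse d'))"
      if "q \<noteq> 0" "x \<noteq> 0" "y \<noteq> 0" "z \<noteq> 0" "n \<noteq> 0" "d \<noteq> 0" "d' \<noteq> 0" "z = 2 * n * y" for u q x y z n d d' :: rat
    proof -
      have "u * (q * (z * z * d')) * y / (e * z * z * d' / (x * d) * (e * z * z * d' / (x * d))) = 
        u * (q * (z * z * d')) * y / ((e * e) * (z * z * d' / (x * d) * (z * z * d' / (x * d))))"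
        by (simp add: mult_ac)
      also have "\<dots> = u * q * y * x * x * d * d / (z * z * d')"
        unfolding e using that(1-7) by (simp add: field_simps)
      also have "\<dots> = q * (1 / (2 * n) * inverse (z / (x * x)) * (d * d * u * inverse d'))"
        using that by (simp add: field_simps)
      finally show ?thesis .
    qed
    have "c3 = fact (6 * m) / (fact (3 * m) * fact (3 * m))"
      unfolding c3_def using binomial_mid[of "3 * m"] by simp
    also have "\<dots> = P * (1 / (2 * of_nat m) * inverse (fact (2 * m) / (fact m * fact m)) * (dn m * dn m * up (2 * m - 1) * inverse (dn (2 * m))))"
      unfolding f6 f3 fP by (rule gen) (use m0 nz p_gt_3 fm(2) in auto)
    finally show ?thesis unfolding b r_def by simp
  qed
  have c1_cong: "pcong c1 (b / 2 * (1 + P * (h - 2))) 2"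
  proof -
    let ?H = "harmonic (2 * m - 1)" and ?K = "harmonic (m - 1)"
    have HK: "?H \<in> pint p" "?K \<in> pint p" by (rule harmonic_pint[OF mp(4)], rule harmonic_pint[OF mp(3)])
    have b2: "b / 2 \<in> pint p" using pi punit_2 by (intro divide_pint)
    have s1: "harmonic (Suc k) = harmonic k + 1 / of_nat (Suc k)" for k by simp
    have "harmonic (2 * m) = ?H + r" using s1[of "2 * m - 1"] m0 by (simp add: r_def)
    moreover have "harmonic m = ?K + 2 * r" using s1[of "m - 1"] m0 by (simp add: r_def)
    ultimately have hr: "?H - ?K = h + r" by (simp add: h_def)
    have "pcong c1 (b / 2 * ((1 + P * ?H) * (1 - P * ?K))) 2"
      unfolding c1 using mp HK by (intro pcong_scale b2 pcong_mult up_pcong inverse_up_pcong punitD(2)[OF punit_up]) auto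
    also have "b / 2 * ((1 + P * ?H) * (1 - P * ?K)) = b / 2 * (1 + P * (?H - ?K)) - P ^ 2 * (b / 2 * (?H * ?K))"
      by (simp add: algebra_simps power2_eq_square)
    \<comment> \<open>By \<open>Pr\<close>, r may be written as pr - 2, which moves it to second
      order.\<close>
    also have "P * (?H - ?K) = P * (h - 2) + P ^ 2 * r"
      unfolding hr using arg_cong[OF Pr, of "\<lambda>z. P * z"] by (simp add: algebra_simps power2_eq_square)
    also have "b / 2 * (1 + (P * (h - 2) + P ^ 2 * r)) - P ^ 2 * (b / 2 * (?H * ?K)) = 
      b / 2 * (1 + P * (h - 2)) + P ^ 2 * (b / 2 * (r - ?H * ?K))"
      by (simp add: algebra_simps)
    also have "pcong \<dots> (b / 2 * (1 + P * (h - 2)) + 0) 2"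
      using HK pi b2 by (intro pcong_add pcong_refl pcong_P_0 mult_pint diff_pint) auto
    finally show ?thesis by simp
  qed
  have c3_cong: "pcong c3 (P * (- 2 * inverse b)) 2"
  proof -
    have u1: "pcong (up (2 * m - 1)) 1 1"
      using pcong_trans[OF pcong_weaken[OF up_pcong[OF mp(4)]] pcong_of_one_plus(1)[OF harmonic_pint[OF mp(4)]]] .
    have dp: "dn m \<in> pint p" "up (2 * m - 1) \<in> pint p" using mp punit_dn punit_up punitD(2) by auto
    have "pcong (dn m * dn m * up (2 * m - 1) * inverse (dn (2 * m))) (1 * 1 * 1 * 1) 1"
      using mp dp by (intro pcong_mult u1 dn_pcong_1 inverse_dn_pcong_1 mult_pint) auto
    then have "pcong (r * inverse b * (dn m * dn m * up (2 * m - 1) * inverse (dn (2 * m)))) (r * inverse b * 1) 1"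
      using pi by (intro pcong_scale mult_pint) auto
    also have "r * inverse b * 1 = - 2 * inverse b + P * (r * inverse b)"
      unfolding mult.assoc[symmetric] Pr by (simp add: algebra_simps)
    also have "pcong \<dots> (- 2 * inverse b + 0) 1"
      using pi by (intro pcong_add pcong_refl pcong_P_dvd mult_pint)
    finally show ?thesis unfolding c3 by (intro pcong_lift) simp
  qed
  have "pcong (of_int (2 * jacobsthal 1)) 
     (of_int ((int p - 1) * (-1) ^ m * (3 * int (2 * m choose m) - 2 * int (6 * m choose m) - int (6 * m choose (3 * m))))) 2"
    by (intro pcong_of_int jacobsthal_1_cong m)
  then have "pcong (2 * s) ((P - 1) * e * (3 * b - 2 * c1 - c3)) 2"
    by (simp add: s_def e_def b_def c1_def c3_def)
  also have "pcong ((P - 1) * e * (3 * b - 2 * c1 - c3)) 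
     ((P - 1) * e * (3 * b - 2 * (b / 2 * (1 + P * (h - 2))) - P * (- 2 * inverse b))) 2"
    using pi by (intro pcong_scale pcong_diff pcong_refl c1_cong c3_cong mult_pint diff_pint) auto
  also have "(P - 1) * e * (3 * b - 2 * (b / 2 * (1 + P * (h - 2))) - P * (- 2 * inverse b)) = 
     e * (- 2 * b + b * P * h - 2 * P * inverse b) + P ^ 2 * (e * (2 * b - b * h + 2 * inverse b))"
    by (simp add: algebra_simps power2_eq_square)
  also have "pcong \<dots> (e * (- 2 * b + b * P * h - 2 * P * inverse b) + 0) 2"
    using pi by (intro pcong_add pcong_refl pcong_P_0 mult_pint diff_pint add_pint) auto
  finally have s2: "pcong (2 * s) (e * (- 2 * b + b * P * h - 2 * P * inverse b)) 2" by simp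
  have "pcong ((2 * s) ^ 2) ((e * (- 2 * b + b * P * h - 2 * P * inverse b)) ^ 2) 2"
    using pi by (intro pcong_power s2 mult_pint diff_pint add_pint uminus_pint) auto
  also have "(e * (- 2 * b + b * P * h - 2 * P * inverse b)) ^ 2 = 
    (e * e) * (4 * (b ^ 2 * (1 - P * h) + 2 * P * (b * inverse b)) + P ^ 2 * (b ^ 2 * h ^ 2 + 4 * inverse b ^ 2 - 4 * h * (b * inverse b)))"
    by (simp add: algebra_simps power2_eq_square)
  also have "\<dots> = 4 * (b ^ 2 * (1 - P * h) + 2 * P) + P ^ 2 * (b ^ 2 * h ^ 2 + 4 * inverse b ^ 2 - 4 * h)"
    using e punitD(1)[OF bu] by simp
  also have "pcong \<dots> (4 * (b ^ 2 * (1 - P * h) + 2 * P) + 0) 2"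
    using pi by (intro pcong_add pcong_refl pcong_P_0 mult_pint diff_pint add_pint power_pint) auto
  finally have "pcong (4 * s ^ 2) (4 * (b ^ 2 * (1 - P * h) + 2 * P)) 2" by (simp add: power_mult_distrib)
  then have "pcong (s ^ 2) (b ^ 2 * (1 - P * h) + 2 * P) 2" by (rule pcong_cancel[OF punit_4])
  also have "pcong (b ^ 2 * (1 - P * h) + 2 * P) (A ^ 2 + 2 * P) 2"
    using pcong_sym[OF A_B_even(3)[OF m]] unfolding b_def h_def by (intro pcong_add pcong_refl)
  finally show ?thesis by (simp add: s_def)
qed

section \<open>Conclusion by the residue of p modulo 4\<close>

lemma punit_54: "punit 54" and punit_81: "punit 81"
  using punit_mult[OF punit_2 punit_27] punit_mult[OF punit_9 punit_9] by simp_all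

text \<open>Jacobsthal's theorem gives A^2 = 4x^2 - 2p modulo p^2; together with AB = p and B^2 = 0
  this determines both sums through \<open>S_reduction\<close>.\<close>

lemma S_1_mod_4:
  assumes "p mod 4 = 1" and xy: "int p = x ^ 2 + 4 * y ^ 2"
  shows "pcong (S 2) (10/27 * of_int (x ^ 2) - 4/9 * P) 2" "pcong (S 3) (- (4/81) * of_int (x ^ 2) + 4/27 * P) 2"
proof -
  have "p = 4 * (p div 4) + 1" using assms(1) by presburger
  then have m: "half = 2 * (p div 4)" using p_eq by linarith
  define X :: rat where "X = of_int (x ^ 2)"
  have "of_int (jacobsthal 1) ^ 2 = (of_int (jacobsthal 1 ^ 2) :: rat)" by simp
  also have "jacobsthal 1 ^ 2 = 4 * x ^ 2" by (rule jacobsthal_1_square[OF _ xy]) (simp add: m)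
  finally have "of_int (jacobsthal 1) ^ 2 = 4 * X" by (simp add: X_def)
  then have "pcong (4 * X - 2 * P) (A ^ 2 + 2 * P - 2 * P) 2"
    using jacobsthal_square_pcong[OF m] by (intro pcong_diff pcong_refl) simp
  then have A2: "pcong (A ^ 2) (4 * X - 2 * P) 2" using pcong_sym by simp
  note AB = A_B_even[OF m]
  have "pcong (54 * S 2) (3 * 0 - 14 * P + 5 * (4 * X - 2 * P)) 2"
    by (rule pcong_trans[OF S_reduction(1)]) (intro pcong_add pcong_diff pcong_scale AB(1,2) A2; simp)
  then have "pcong (54 * S 2) (54 * (10/27 * X - 4/9 * P)) 2" by (simp add: algebra_simps)
  then show "pcong (S 2) (10/27 * of_int (x ^ 2) - 4/9 * P) 2"
    unfolding X_def by (rule pcong_cancel[OF punit_54])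
  have "pcong (81 * S 3) (- (6 * 0 - 10 * P + (4 * X - 2 * P))) 2"
    by (rule pcong_trans[OF S_reduction(2)]) (intro pcong_uminus pcong_add pcong_diff pcong_scale AB(1,2) A2; simp)
  then have "pcong (81 * S 3) (81 * (- (4/81) * X + 4/27 * P)) 2" by (simp add: algebra_simps)
  then show "pcong (S 3) (- (4/81) * of_int (x ^ 2) + 4/27 * P) 2"
    unfolding X_def by (rule pcong_cancel[OF punit_81])
qed

text \<open>The harmonic difference in B^2 is the Fermat quotient of 2 modulo p, which turns B^2
  into R_1(p); further A^2 = 0 and AB = -p modulo p^2.\<close>

lemma S_3_mod_4:
  assumes "p mod 4 = 3"
  shows "pcong (S 2) (7/27 * P + 1/18 * R1 p) 2" "pcong (S 3) (- (10/81) * P - 2/27 * R1 p) 2"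
proof -
  define j where "j = p div 4"
  have "p = 4 * j + 3" using assms unfolding j_def by presburger
  then have j: "half = 2 * j + 1" using p_eq by linarith
  define c :: rat where "c = of_nat (half choose j)"
  define h where "h = harmonic half - harmonic j"
  have AB: "pcong (A * B) (- P) 2" "pcong (A ^ 2) 0 2" "pcong (B ^ 2) ((1 + 2 * P - P * h) * c ^ 2) 2"
    unfolding c_def h_def by (rule A_B_odd[OF j])+
  have "half div 2 = j" using j by simp
  then have "pcong (2 ^ (p - 1)) (1 + P * h) 2" using two_power_pcong by (simp add: h_def)
  then have "pcong (c ^ 2 * (2 * P + 2 - 2 ^ (p - 1))) (c ^ 2 * (2 * P + 2 - (1 + P * h))) 2"
    unfolding c_def by (intro pcong_scale pcong_diff pcong_refl) auto
  moreover have "R1 p = c ^ 2 * (2 * P + 2 - 2 ^ (p - 1))"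
    unfolding R1_def c_def half_def j_def by simp
  moreover have "c ^ 2 * (2 * P + 2 - (1 + P * h)) = (1 + 2 * P - P * h) * c ^ 2" by (simp add: algebra_simps)
  ultimately have "pcong (R1 p) ((1 + 2 * P - P * h) * c ^ 2) 2" by (simp only:)
  then have B2: "pcong (B ^ 2) (R1 p) 2" by (rule pcong_trans[OF AB(3) pcong_sym])
  have "pcong (54 * S 2) (3 * R1 p - 14 * (- P) + 5 * 0) 2"
    by (rule pcong_trans[OF S_reduction(1)]) (intro pcong_add pcong_diff pcong_scale AB(1,2) B2; simp)
  then have "pcong (54 * S 2) (54 * (7/27 * P + 1/18 * R1 p)) 2" by (simp add: algebra_simps)
  then show "pcong (S 2) (7/27 * P + 1/18 * R1 p) 2" by (rule pcong_cancel[OF punit_54])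
  have "pcong (81 * S 3) (- (6 * R1 p - 10 * (- P) + 0)) 2"
    by (rule pcong_trans[OF S_reduction(2)]) (intro pcong_uminus pcong_add pcong_diff pcong_scale AB(1,2) B2; simp)
  moreover have "- (6 * R1 p - 10 * (- P) + 0) = 81 * (- (10/81) * P - 2/27 * R1 p)" by (simp add: algebra_simps)
  ultimately have "pcong (81 * S 3) (81 * (- (10/81) * P - 2/27 * R1 p)) 2" by (simp only:)
  then show "pcong (S 3) (- (10/81) * P - 2/27 * R1 p) 2" by (rule pcong_cancel[OF punit_81])
qed

end

theorem theorem3p6:
  fixes p :: nat
  assumes "prime p" and "p > 3"
  shows "(p mod 4 = 1 \<longrightarrow> (\<forall>x y :: int. int p = x^2 + 4 * y^2 \<longrightarrow>
            rat_cong (\<Sum>k=0..(p - 1) div 2. of_nat (k^2 * (2*k choose k)^3) / (-8)^k)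
                     (10/27 * of_int (x^2) - 4/9 * of_nat p) p 2
          \<and> rat_cong (\<Sum>k=0..(p - 1) div 2. of_nat (k^3 * (2*k choose k)^3) / (-8)^k)
                     (-(4/81) * of_int (x^2) + 4/27 * of_nat p) p 2))
       \<and> (p mod 4 = 3 \<longrightarrow>
            rat_cong (\<Sum>k=0..(p - 1) div 2. of_nat (k^2 * (2*k choose k)^3) / (-8)^k)
                     (7/27 * of_nat p + 1/18 * R1 p) p 2
          \<and> rat_cong (\<Sum>k=0..(p - 1) div 2. of_nat (k^3 * (2*k choose k)^3) / (-8)^k)
                     (-(10/81) * of_nat p - 2/27 * R1 p) p 2)"
proof -
  interpret prime_gt_3 p by unfold_locales (fact assms)+
  show ?thesis
    using S_1_mod_4 S_3_mod_4 unfolding S_def by blast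
qed

end
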